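(* Fix $\alpha>2$, $\beta\in[0,1/2)$, $\varepsilon_0\in(0,1)$, $q>0$, $a>0$ and $A>\sqrt{a^2+1}\,M_q^{1/q}$. Then there is a constant $C>0$, depending on $\alpha,\beta,\varepsilon_0,q,a$ and $A$, such that $$\liminf_{n\to\infty}\; n^{2\beta}\,(\log n)^{\alpha+2}\, R_n^{\sigma}(\mathcal{F}_0(\alpha,\beta,\varepsilon_0,q,a,A;n))\ \ge\ C$$ and $$\liminf_{n\to\infty}\; n^{2\beta}\,(\log n)^{\alpha+1}\, R_n^{u}(\mathcal{F}_0(\alpha,\beta,\varepsilon_0,q,a,A;n))\ \ge\ C .$$
   Context: Model. $\phi$ denotes the density of $N(0,1)$ and $M_q=E|Z|^q$ for $Z\sim N(0,1)$. One observes $X_1,\dots,X_n$ i.i.d. with density $$f(x)=(1-\varepsilon)\frac1{\sigma_0}\phi\Big(\frac{x-u_0}{\sigma_0}\Big)+\varepsilon\int\frac1\sigma\phi\Big(\frac{x-u}{\sigma}\Big)\,dH(u,\sigma),$$ where $\varepsilon\in(0,1)$ is the proportion (it may depend on $n$, written $\varepsilon_n$), $(u_0,\sigma_0)$ are the null parameters and $H$ is a mixing distribution on $(u,\sigma)$. Let $H(\sigma)$ be the marginal distribution of $\sigma$ and $H(u|\sigma)$ the conditional distribution of $u$ given $\sigma$. The density $f$ is called eligible if it has this form with $H(\sigma)$ supported on $[\sigma_0,\infty)$ and $H(u|\sigma)$ having a density $h(u|\sigma)$ for every $\sigma\ge\sigma_0$. $\mathcal{F}$ is the set of all eligible $f$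 (for eligible $f$ the parameters $\varepsilon,u_0,\sigma_0$ are identifiable, so they are regarded as functions of $f$). Write $\hat h(t|\sigma)=\int e^{itu}h(u|\sigma)\,du$, $\tilde h(t|\sigma)=\int e^{itu}h(u+u_0|\sigma)\,du$, with $\tilde h'$ the derivative in $t$. Parameter space. $\mathcal{F}_0(\alpha,\beta,\varepsilon_0,q,a,A;n)$ is the set of $f\in\mathcal{F}$ such that: (i) $\sigma_0\ge a$ and $\int|x|^qf(x)\,dx\le A^q$; (ii) $\limsup_{t\to\infty}\sup_{\sigma\ge\sigma_0}\{|t|^{\alpha}|\hat h(t|\sigma)|\}\le A$ and $\limsup_{t\to\infty}\sup_{\sigma\ge\sigma_0}\{|t|^{\alpha+1}|\tilde h'(t|\sigma)|\}\le A$; (iii) $\varepsilon_n\le\eta_n$, where $\eta_n=\varepsilon_0n^{-\beta}$. Minimax risks. $R_n^\sigma(\mathcal{F}_0)=\inf_{\hat\sigma_0^2}\sup_{f\in\mathcal{F}_0}E[\hat\sigma_0^2-\sigma_0^2]^2$ and $R_n^u(\mathcal{F}_0)=\inf_{\hat u_0}\sup_{f\in\mathcal{F}_0}E[\hat u_0-u_0]^2$, the infima being over all estimators based on $X_1,\dots,X_n$. *)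

theory Defs
  imports "HOL-Probability.Probability"
begin

definition abs_normal_moment :: "real \<Rightarrow> real" where
  "abs_normal_moment q = (\<integral>z. \<bar>z\<bar> powr q * std_normal_density z \<partial>lborel)"

text \<open>
  A mixing distribution \<open>H\<close> is a measure on pairs \<open>(u, \<sigma>)\<close>. Throughout, \<open>h u \<sigma>\<close> stands for the
  conditional density \<open>h(u|\<sigma>)\<close>. Its values for \<open>\<sigma> < \<sigma>0\<close> are irrelevant, since the marginal of
  \<open>\<sigma>\<close> lives on \<open>{\<sigma>0..}\<close>.
\<close>

definition gauss_mixture :: "real \<Rightarrow> real \<Rightarrow> real \<Rightarrow> (real \<times> real) measure \<Rightarrow> real \<Rightarrow> real" where
  "gauss_mixture \<epsilon> u0 \<sigma>0 H x =
     (1 - \<epsilon>) * normal_density u0 \<sigma>0 x + \<epsilon> * (\<integral>(u, \<sigma>). normal_density u \<sigma> x \<partial>H)"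

abbreviation sigma_marginal :: "(real \<times> real) measure \<Rightarrow> real measure" where
  "sigma_marginal H \<equiv> distr H borel snd"

text \<open>
  The equation for \<open>H\<close> says \<open>H(du, d\<sigma>) = h(u|\<sigma>) du H(d\<sigma>)\<close>, i.e. \<open>h(\<cdot>|\<sigma>)\<close> is a version of
  the density of the conditional distribution of \<open>u\<close> given \<open>\<sigma>\<close>.
\<close>

definition has_cond_density ::
  "(real \<times> real) measure \<Rightarrow> real \<Rightarrow> (real \<Rightarrow> real \<Rightarrow> real) \<Rightarrow> bool" where
  "has_cond_density H \<sigma>0 h \<longleftrightarrow>
     (\<lambda>(u, \<sigma>). h u \<sigma>) \<in> borel_measurable borel \<and>
     (\<forall>\<sigma>\<ge>\<sigma>0. (\<forall>u. 0 \<le> h u \<sigma>) \<and> (\<integral>\<^sup>+u. ennreal (h u \<sigma>) \<partial>lborel) = 1) \<and>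
     H = density (lborel \<Otimes>\<^sub>M sigma_marginal H) (\<lambda>(u, \<sigma>). ennreal (h u \<sigma>))"

definition eligible_rep ::
  "(real \<Rightarrow> real) \<Rightarrow> real \<Rightarrow> real \<Rightarrow> real \<Rightarrow> (real \<times> real) measure \<Rightarrow> (real \<Rightarrow> real \<Rightarrow> real) \<Rightarrow> bool" where
  "eligible_rep f \<epsilon> u0 \<sigma>0 H h \<longleftrightarrow>
     0 < \<epsilon> \<and> \<epsilon> < 1 \<and> 0 < \<sigma>0 \<and>
     prob_space H \<and> sets H = sets borel \<and>
     (AE \<sigma> in sigma_marginal H. \<sigma>0 \<le> \<sigma>) \<and>
     has_cond_density H \<sigma>0 h \<and>
     f = gauss_mixture \<epsilon> u0 \<sigma>0 H"

definition eligible :: "(real \<Rightarrow> real) set" where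
  "eligible = {f. \<exists>\<epsilon> u0 \<sigma>0 H h. eligible_rep f \<epsilon> u0 \<sigma>0 H h}"

text \<open>
  \<open>\<epsilon>\<close>, \<open>u0\<close> and \<open>\<sigma>0\<close> as functions of the density; see \<open>identifiable\<close> below. The mixing
  distribution \<open>H\<close> itself is not determined by \<open>f\<close>.
\<close>

definition null_params :: "(real \<Rightarrow> real) \<Rightarrow> real \<times> real \<times> real" where
  "null_params f = (THE (\<epsilon>, u0, \<sigma>0). \<exists>H h. eligible_rep f \<epsilon> u0 \<sigma>0 H h)"

definition proportion :: "(real \<Rightarrow> real) \<Rightarrow> real" where
  "proportion f = fst (null_params f)"

definition null_mean :: "(real \<Rightarrow> real) \<Rightarrow> real" where
  "null_mean f = fst (snd (null_params f))"

definition null_sd :: "(real \<Rightarrow> real) \<Rightarrow> real" where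
  "null_sd f = snd (snd (null_params f))"

definition h_hat :: "(real \<Rightarrow> real \<Rightarrow> real) \<Rightarrow> real \<Rightarrow> real \<Rightarrow> complex" where
  "h_hat h \<sigma> t = (\<integral>u. iexp (t * u) * complex_of_real (h u \<sigma>) \<partial>lborel)"

definition h_tilde :: "(real \<Rightarrow> real \<Rightarrow> real) \<Rightarrow> real \<Rightarrow> real \<Rightarrow> real \<Rightarrow> complex" where
  "h_tilde h u0 \<sigma> t = (\<integral>u. iexp (t * u) * complex_of_real (h (u + u0) \<sigma>) \<partial>lborel)"

text \<open>
  The suprema over \<open>\<sigma>\<close> may be infinite, hence the extended reals. Since \<open>vector_derivative\<close> is
  total, the existence of the derivative of \<open>h_tilde\<close> has to be required explicitly.
\<close>

definition tail_condition ::
  "real \<Rightarrow> real \<Rightarrow> real \<Rightarrow> real \<Rightarrow> (real \<Rightarrow> real \<Rightarrow> real) \<Rightarrow> bool" where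
  "tail_condition \<alpha> A u0 \<sigma>0 h \<longleftrightarrow>
     Limsup at_top (\<lambda>t::real. SUP \<sigma>\<in>{\<sigma>0..}. ereal (\<bar>t\<bar> powr \<alpha> * cmod (h_hat h \<sigma> t))) \<le> ereal A \<and>
     (\<forall>\<sigma>\<ge>\<sigma>0. \<forall>t. h_tilde h u0 \<sigma> differentiable (at t)) \<and>
     Limsup at_top (\<lambda>t::real. SUP \<sigma>\<in>{\<sigma>0..}.
        ereal (\<bar>t\<bar> powr (\<alpha> + 1) * cmod (vector_derivative (h_tilde h u0 \<sigma>) (at t)))) \<le> ereal A"

definition param_space ::
  "real \<Rightarrow> real \<Rightarrow> real \<Rightarrow> real \<Rightarrow> real \<Rightarrow> real \<Rightarrow> nat \<Rightarrow> (real \<Rightarrow> real) set" where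
  "param_space \<alpha> \<beta> \<epsilon>0 q a A n = {f \<in> eligible.
     a \<le> null_sd f \<and>
     (\<integral>\<^sup>+x. ennreal (\<bar>x\<bar> powr q * f x) \<partial>lborel) \<le> ennreal (A powr q) \<and>
     (\<exists>H h. eligible_rep f (proportion f) (null_mean f) (null_sd f) H h \<and>
            tail_condition \<alpha> A (null_mean f) (null_sd f) h) \<and>
     proportion f \<le> \<epsilon>0 * real n powr (- \<beta>)}"

definition sample_space :: "nat \<Rightarrow> (nat \<Rightarrow> real) measure" where
  "sample_space n = (\<Pi>\<^sub>M i\<in>{..<n}. (borel :: real measure))"

definition sample_law :: "nat \<Rightarrow> (real \<Rightarrow> real) \<Rightarrow> (nat \<Rightarrow> real) measure" where
  "sample_law n f = (\<Pi>\<^sub>M i\<in>{..<n}. density lborel (\<lambda>x. ennreal (f x)))"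

definition minimax_risk :: "nat \<Rightarrow> (real \<Rightarrow> real) set \<Rightarrow> ((real \<Rightarrow> real) \<Rightarrow> real) \<Rightarrow> ennreal" where
  "minimax_risk n F \<theta> =
     (INF T \<in> borel_measurable (sample_space n).
        SUP f \<in> F. \<integral>\<^sup>+X. ennreal ((T X - \<theta> f)\<^sup>2) \<partial>sample_law n f)"

definition risk_sigma :: "nat \<Rightarrow> (real \<Rightarrow> real) set \<Rightarrow> ennreal" where
  "risk_sigma n F = minimax_risk n F (\<lambda>f. (null_sd f)\<^sup>2)"

definition risk_u :: "nat \<Rightarrow> (real \<Rightarrow> real) set \<Rightarrow> ennreal" where
  "risk_u n F = minimax_risk n F null_mean"

subsection \<open>Identifiability of the null parameters\<close>

text \<open>
  By the Riemann-Lebesgue lemma, \<open>exp (\<sigma>0\<^sup>2 t\<^sup>2 / 2 - i t u0)\<close> times the Fourier transform of \<open>f\<close>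
  tends to \<open>1 - \<epsilon>\<close>, which pins down \<open>\<sigma>0\<close>, \<open>\<epsilon>\<close> and \<open>u0\<close>.
\<close>

lemma iexp_meas[measurable]: "(\<lambda>u. iexp (t * u)) \<in> borel_measurable borel"
  by (intro borel_measurable_continuous_onI continuous_intros)


lemma integrable_iexp_mult:
  fixes f :: "real \<Rightarrow> real"
  assumes "integrable lborel f"
  shows "integrable lborel (\<lambda>u. f u *\<^sub>R iexp (t * u))"
proof (rule Bochner_Integration.integrable_bound[OF assms])
  show "(\<lambda>u. f u *\<^sub>R iexp (t * u)) \<in> borel_measurable lborel"
    using assms by measurable
  show "AE x in lborel. norm (f x *\<^sub>R iexp (t * x)) \<le> norm (f x)"
    by simp
qed

lemma riemann_lebesgue_limit:
  fixes f :: "real \<Rightarrow> real" and g :: "nat \<Rightarrow> real \<Rightarrow> real"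
  assumes f: "integrable lborel f" and g: "\<And>i. integrable lborel (g i)"
    and gt: "\<And>i. ((\<lambda>t. \<integral>u. g i u *\<^sub>R iexp (t * u) \<partial>lborel) \<longlongrightarrow> 0) at_top"
    and lim: "\<And>u. (\<lambda>i. g i u) \<longlonglongrightarrow> f u" and bd: "\<And>i u. norm (g i u) \<le> 2 * norm (f u)"
  shows "((\<lambda>t. \<integral>u. f u *\<^sub>R iexp (t * u) \<partial>lborel) \<longlongrightarrow> 0) at_top"
proof (rule tendstoI)
  fix e :: real assume e: "0 < e"
  have "(\<lambda>i. \<integral>u. norm (f u - g i u) \<partial>lborel) \<longlonglongrightarrow> (\<integral>u. (0::real) \<partial>(lborel :: real measure))"
  proof (rule integral_dominated_convergence[where w="\<lambda>u. 3 * norm (f u)" and f="\<lambda>u. 0" and s="\<lambda>i u. norm (f u - g i u)"])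
    show "integrable lborel (\<lambda>u. 3 * norm (f u))" using f by auto
    show "AE u in lborel. (\<lambda>i. norm (f u - g i u)) \<longlonglongrightarrow> 0"
    proof (rule AE_I2)
      fix u show "(\<lambda>i. norm (f u - g i u)) \<longlonglongrightarrow> 0"
        using tendsto_norm[OF tendsto_diff[OF tendsto_const lim[of u], of "f u"]] by simp
    qed
    fix i show "AE u in lborel. norm (norm (f u - g i u)) \<le> 3 * norm (f u)"
    proof (rule AE_I2)
      fix u show "norm (norm (f u - g i u)) \<le> 3 * norm (f u)"
        using bd[of i u] norm_triangle_ineq4[of "f u" "g i u"] by simp
    qed
  qed (use f g in measurable)
  then have "(\<lambda>i. \<integral>u. norm (f u - g i u) \<partial>lborel) \<longlonglongrightarrow> 0" by simp
  from order_tendstoD(2)[OF this, of "e / 2"] e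
  obtain i where i: "(\<integral>u. norm (f u - g i u) \<partial>lborel) < e / 2"
    by (auto simp: eventually_sequentially)
  have "\<forall>\<^sub>F t in at_top. norm (\<integral>u. g i u *\<^sub>R iexp (t * u) \<partial>lborel) < e / 2"
    using tendstoD[OF gt[of i], of "e/2"] e by simp
  then show "\<forall>\<^sub>F t in at_top. dist (\<integral>u. f u *\<^sub>R iexp (t * u) \<partial>lborel) 0 < e"
  proof eventually_elim
    case (elim t)
    have "(\<integral>u. f u *\<^sub>R iexp (t * u) \<partial>lborel) - (\<integral>u. g i u *\<^sub>R iexp (t * u) \<partial>lborel)
       = (\<integral>u. f u *\<^sub>R iexp (t * u) - g i u *\<^sub>R iexp (t * u) \<partial>lborel)"
      by (rule Bochner_Integration.integral_diff[symmetric]) (intro integrable_iexp_mult f g)+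
    also have "\<dots> = (\<integral>u. (f u - g i u) *\<^sub>R iexp (t * u) \<partial>lborel)"
      by (simp only: scaleR_diff_left)
    finally have "norm ((\<integral>u. f u *\<^sub>R iexp (t * u) \<partial>lborel) - (\<integral>u. g i u *\<^sub>R iexp (t * u) \<partial>lborel))
       \<le> (\<integral>u. norm (f u - g i u) \<partial>lborel)"
      using integral_norm_bound[of lborel "\<lambda>u. (f u - g i u) *\<^sub>R iexp (t * u)"] by simp
    with i elim show ?case
      using norm_triangle_sub[of "\<integral>u. f u *\<^sub>R iexp (t * u) \<partial>lborel" "\<integral>u. g i u *\<^sub>R iexp (t * u) \<partial>lborel"]
      by simp
  qed
qed

lemma riemann_lebesgue_interval:
  fixes a b :: real
  assumes le: "a \<le> b"
  shows "((\<lambda>t. \<integral>u. indicat_real {a..b} u *\<^sub>R iexp (t * u) \<partial>lborel) \<longlongrightarrow> 0) at_top"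
proof -
  have eq: "(\<integral>u. indicat_real {a..b} u *\<^sub>R iexp (t * u) \<partial>lborel)
      = iexp (t * b) / (\<i> * t) - iexp (t * a) / (\<i> * t)" if "t > 0" for t
  proof (rule integral_FTC_Icc[OF le])
    fix x
    have "((\<lambda>z. exp (\<i> * (complex_of_real t * z)) / (\<i> * t)) has_field_derivative iexp (t * x)) (at (of_real x))"
      using that by (auto intro!: derivative_eq_intros simp: mult.commute[of _ \<i>] mult.left_commute[of _ \<i>])
    from has_vector_derivative_real_field[OF this]
    show "((\<lambda>u. iexp (t * u) / (\<i> * t)) has_vector_derivative iexp (t * x)) (at x within {a..b})"
      by simp
  qed (intro continuous_intros)
  have bd: "norm (\<integral>u. indicat_real {a..b} u *\<^sub>R iexp (t * u) \<partial>lborel) \<le> 2 / t" if "t > 0" for t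
    unfolding eq[OF that] using that
    by (intro order_trans[OF norm_triangle_ineq4]) (auto simp: norm_divide norm_mult)
  show ?thesis
  proof (rule Lim_null_comparison)
    show "\<forall>\<^sub>F t in at_top. norm (\<integral>u. indicat_real {a..b} u *\<^sub>R iexp (t * u) \<partial>lborel) \<le> 2 / t"
      using eventually_gt_at_top[of 0] by eventually_elim (rule bd)
    show "((\<lambda>t::real. 2 / t) \<longlongrightarrow> 0) at_top"
      by (rule tendsto_divide_0[OF tendsto_const]) (auto intro: filterlim_at_top_imp_at_infinity filterlim_ident)
  qed
qed

lemma finite_indicator_integrable:
  assumes "B \<in> sets borel"
  shows "integrable lborel (indicat_real (B \<inter> {-N..N::real}))"
proof -
  have "emeasure lborel (B \<inter> {-N..N}) \<le> emeasure lborel {-N..N}"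
    by (intro emeasure_mono) auto
  also have "\<dots> < \<infinity>" by (simp add: emeasure_lborel_Icc_eq)
  finally show ?thesis using assms by (subst integrable_indicator_iff) auto
qed

lemma riemann_lebesgue_bounded_set:
  fixes N :: real
  assumes "A \<in> sets borel" "0 \<le> N"
  shows "((\<lambda>t. \<integral>u. indicat_real (A \<inter> {-N..N}) u *\<^sub>R iexp (t * u) \<partial>lborel) \<longlongrightarrow> 0) at_top"
proof -
  have bs: "sets borel = sigma_sets UNIV (range (atMost :: real \<Rightarrow> real set))"
    by (subst borel_eq_atMost) auto
  have "Int_stable (range (atMost :: real \<Rightarrow> real set))" by (auto simp: Int_stable_def)
  moreover have "range (atMost :: real \<Rightarrow> real set) \<subseteq> Pow UNIV" by simp
  moreover have "A \<in> sigma_sets UNIV (range (atMost :: real \<Rightarrow> real set))" using assms bs by simp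
  ultimately show ?thesis
  proof (induct rule: sigma_sets_induct_disjoint)
    case (basic B)
    then obtain a where B: "B = {..a}" by auto
    show ?case
    proof (cases "-N \<le> a")
      case False
      then have "B \<inter> {-N..N} = {}" unfolding B by auto
      then show ?thesis by simp
    next
      case True
      have Beq: "B \<inter> {-N..N} = {-N..min a N}" unfolding B by auto
      show ?thesis unfolding Beq using True assms by (intro riemann_lebesgue_interval) auto
    qed
  next
    case empty then show ?case by simp
  next
    case (compl B)
    have Bm: "B \<in> sets borel" using compl bs by simp
    have eq: "indicat_real ((UNIV - B) \<inter> {-N..N}) u = indicat_real {-N..N} u - indicat_real (B \<inter> {-N..N}) u" for u
      by (auto simp: indicator_def)
    have "(\<integral>u. indicat_real ((UNIV - B) \<inter> {-N..N}) u *\<^sub>R iexp (t * u) \<partial>lborel)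
        = (\<integral>u. indicat_real {-N..N} u *\<^sub>R iexp (t * u) \<partial>lborel)
          - (\<integral>u. indicat_real (B \<inter> {-N..N}) u *\<^sub>R iexp (t * u) \<partial>lborel)" for t
      unfolding eq scaleR_diff_left
      using finite_indicator_integrable[of UNIV N] finite_indicator_integrable[OF Bm, of N]
      by (intro Bochner_Integration.integral_diff integrable_iexp_mult) auto
    then show ?case
      using tendsto_diff[OF riemann_lebesgue_interval[of "-N" N] compl(2)] assms by simp
  next
    case (union B)
    have Bm: "B i \<in> sets borel" for i using union bs by blast
    define g where "g = (\<lambda>k u. \<Sum>i<k. indicat_real (B i \<inter> {-N..N}) u)"
    have gU: "g k u = indicat_real ((\<Union>i<k. B i) \<inter> {-N..N}) u" for k u
    proof -
      have "indicat_real (\<Union>i<k. B i \<inter> {-N..N}) u = (\<Sum>i<k. indicat_real (B i \<inter> {-N..N}) u)"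
        using union(1) by (intro indicator_UN_disjoint) (auto simp: disjoint_family_on_def)
      then show ?thesis by (simp add: g_def)
    qed
    show ?case
    proof (rule riemann_lebesgue_limit[where g=g])
      show "integrable lborel (indicat_real (\<Union> (range B) \<inter> {- N..N}))"
        by (rule finite_indicator_integrable) (use Bm in auto)
      show gi: "integrable lborel (g i)" for i
        unfolding g_def using finite_indicator_integrable[OF Bm] by auto
      show "((\<lambda>t. \<integral>u. g i u *\<^sub>R iexp (t * u) \<partial>lborel) \<longlongrightarrow> 0) at_top" for i
      proof -
        have "(\<integral>u. g i u *\<^sub>R iexp (t * u) \<partial>lborel)
           = (\<Sum>j<i. \<integral>u. indicat_real (B j \<inter> {-N..N}) u *\<^sub>R iexp (t * u) \<partial>lborel)" for t
          unfolding g_def scaleR_sum_left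
          by (intro Bochner_Integration.integral_sum integrable_iexp_mult finite_indicator_integrable Bm)
        moreover have "((\<lambda>t. \<Sum>j<i. \<integral>u. indicat_real (B j \<inter> {-N..N}) u *\<^sub>R iexp (t * u) \<partial>lborel)
            \<longlongrightarrow> (\<Sum>j<i. 0)) at_top"
          by (intro tendsto_sum union)
        ultimately show ?thesis by simp
      qed
      show "(\<lambda>i. g i u) \<longlonglongrightarrow> indicat_real (\<Union> (range B) \<inter> {- N..N}) u" for u
      proof (cases "u \<in> \<Union> (range B)")
        case True
        then obtain j where j: "u \<in> B j" by auto
        have "\<forall>\<^sub>F i in sequentially. g i u = indicat_real (\<Union> (range B) \<inter> {- N..N}) u"
          using eventually_gt_at_top[of j]
          by eventually_elim (use j in \<open>auto simp: gU indicator_def\<close>)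
        then show ?thesis by (rule tendsto_eventually)
      next
        case False
        then have "g i u = indicat_real (\<Union> (range B) \<inter> {- N..N}) u" for i
          by (auto simp: gU indicator_def)
        then show ?thesis by simp
      qed
      show "norm (g i u) \<le> 2 * norm (indicat_real (\<Union> (range B) \<inter> {- N..N}) u)" for i u
        by (auto simp: gU indicator_def)
    qed
  qed
qed

lemma riemann_lebesgue:
  fixes f :: "real \<Rightarrow> real"
  assumes "integrable lborel f"
  shows "((\<lambda>t. \<integral>u. f u *\<^sub>R iexp (t * u) \<partial>lborel) \<longlongrightarrow> 0) at_top"
  using assms
proof (induct f rule: integrable_induct)
  case (base A c)
  have Am: "A \<in> sets borel" using base by simp
  have ind: "((\<lambda>t. \<integral>u. indicat_real A u *\<^sub>R iexp (t * u) \<partial>lborel) \<longlongrightarrow> 0) at_top"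
  proof (rule riemann_lebesgue_limit[where g="\<lambda>n. indicat_real (A \<inter> {-real n..real n})"])
    show "integrable lborel (indicat_real A)" using base by simp
    show "(\<lambda>i. indicat_real (A \<inter> {- real i..real i}) u) \<longlonglongrightarrow> indicat_real A u" for u
    proof (rule tendsto_eventually)
      obtain m where m: "\<bar>u\<bar> \<le> real m" using real_arch_simple by blast
      show "\<forall>\<^sub>F i in sequentially. indicat_real (A \<inter> {- real i..real i}) u = indicat_real A u"
        using eventually_ge_at_top[of m]
      proof eventually_elim
        case (elim i)
        then have "\<bar>u\<bar> \<le> real i" using m by linarith
        then show ?case by (auto simp: indicator_def)
      qed
    qed
    show "norm (indicat_real (A \<inter> {- real i..real i}) u) \<le> 2 * norm (indicat_real A u)" for i u
      by (auto simp: indicator_def)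
  qed (rule finite_indicator_integrable riemann_lebesgue_bounded_set Am of_nat_0_le_iff)+
  have "(\<integral>u. (indicat_real A u *\<^sub>R c) *\<^sub>R iexp (t * u) \<partial>lborel)
      = c *\<^sub>R (\<integral>u. indicat_real A u *\<^sub>R iexp (t * u) \<partial>lborel)" for t
    by (subst Bochner_Integration.integral_scaleR_right[symmetric]) (simp_all add: mult.commute)
  then show ?case using tendsto_scaleR[OF tendsto_const[of c] ind] by simp
next
  case (add f g)
  have "(\<integral>u. (f u + g u) *\<^sub>R iexp (t * u) \<partial>lborel)
      = (\<integral>u. f u *\<^sub>R iexp (t * u) \<partial>lborel) + (\<integral>u. g u *\<^sub>R iexp (t * u) \<partial>lborel)" for t
    unfolding scaleR_add_left
    by (intro Bochner_Integration.integral_add integrable_iexp_mult add)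
  then show ?case using tendsto_add[OF add(2) add(4)] by simp
next
  case (lim f s)
  show ?case by (rule riemann_lebesgue_limit[OF lim(5) lim(1) lim(2)]) (use lim in auto)
qed

lemma normal_fourier:
  assumes "0 < s"
  shows "(\<integral>x. normal_density u s x *\<^sub>R iexp (t * x) \<partial>lborel) = iexp (t * u) * of_real (exp (- (s\<^sup>2 * t\<^sup>2) / 2))"
proof -
  have "(\<integral>x. normal_density u s x *\<^sub>R iexp (t * x) \<partial>lborel)
     = \<bar>s\<bar> *\<^sub>R (\<integral>x. normal_density u s (u + s * x) *\<^sub>R iexp (t * (u + s * x)) \<partial>lborel)"
    using assms by (intro lborel_integral_real_affine) simp
  also have "\<dots> = (\<integral>x. s *\<^sub>R (normal_density u s (u + s * x) *\<^sub>R iexp (t * (u + s * x))) \<partial>lborel)"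
    unfolding integral_scaleR_right using assms by simp
  also have "\<dots> = (\<integral>x. iexp (t * u) * (std_normal_density x *\<^sub>R iexp ((t * s) * x)) \<partial>lborel)"
  proof (rule Bochner_Integration.integral_cong[OF refl])
    fix x
    have "s * normal_density u s (u + s * x) = std_normal_density x"
      using assms by (simp add: normal_density_def real_sqrt_mult power_mult_distrib)
    moreover have "iexp (t * (u + s * x)) = iexp (t * u) * iexp ((t * s) * x)"
      by (simp add: exp_add[symmetric] algebra_simps)
    ultimately show "s *\<^sub>R (normal_density u s (u + s * x) *\<^sub>R iexp (t * (u + s * x)))
        = iexp (t * u) * (std_normal_density x *\<^sub>R iexp ((t * s) * x))"
      by (metis mult_scaleR_right scaleR_scaleR)
  qed
  also have "\<dots> = iexp (t * u) * (\<integral>x. std_normal_density x *\<^sub>R iexp ((t * s) * x) \<partial>lborel)"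
    by (rule integral_mult_right_zero)
  also have "(\<integral>x. std_normal_density x *\<^sub>R iexp ((t * s) * x) \<partial>lborel) = char std_normal_distribution (t * s)"
    unfolding char_def by (subst integral_density) auto
  also have "\<dots> = of_real (exp (- (s\<^sup>2 * t\<^sup>2) / 2))"
    by (simp add: char_std_normal_distribution power_mult_distrib mult.commute)
  finally show ?thesis .
qed

lemma normal_density_pair_measurable:
  "(\<lambda>(p, x). normal_density (fst p) (snd p) x *\<^sub>R iexp (t * x)) \<in> borel_measurable ((borel :: (real\<times>real) measure) \<Otimes>\<^sub>M borel)"
  unfolding normal_density_def split_beta borel_prod[symmetric] by measurable

lemma normal_mixture_integrable:
  fixes H :: "(real \<times> real) measure"
  assumes "prob_space H" and sets: "sets H = sets borel"
    and sig: "AE p in H. 0 < snd p"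
  shows "integrable (H \<Otimes>\<^sub>M lborel) (\<lambda>(p, x). normal_density (fst p) (snd p) x *\<^sub>R iexp (t * x))"
proof -
  interpret prob_space H by fact
  interpret pair_sigma_finite H lborel ..
  have m[measurable]: "(\<lambda>(p, x). normal_density (fst p) (snd p) x *\<^sub>R iexp (t * x)) \<in> borel_measurable (H \<Otimes>\<^sub>M lborel)"
    using normal_density_pair_measurable[of t]
    by (subst measurable_cong_sets[OF sets_pair_measure_cong[OF sets sets_lborel] refl])
  show ?thesis
  proof (rule Fubini_integrable)
    show "integrable H (\<lambda>p. \<integral>x. norm (case (p, x) of (p, x) \<Rightarrow> normal_density (fst p) (snd p) x *\<^sub>R iexp (t * x)) \<partial>lborel)"
    proof (rule integrable_const_bound[where B=1])
      show "AE p in H. norm (\<integral>x. norm (case (p, x) of (p, x) \<Rightarrow> normal_density (fst p) (snd p) x *\<^sub>R iexp (t * x)) \<partial>lborel) \<le> 1"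
        using sig by eventually_elim simp
    qed measurable
    show "AE p in H. integrable lborel (\<lambda>x. case (p, x) of (p, x) \<Rightarrow> normal_density (fst p) (snd p) x *\<^sub>R iexp (t * x))"
      using sig by eventually_elim (simp only: prod.case, rule integrable_iexp_mult, simp)
  qed fact
qed

lemma borel_measurable_snd_real: "(snd :: real \<times> real \<Rightarrow> real) \<in> borel_measurable borel"
  by (intro borel_measurable_continuous_onI continuous_intros)

lemma eligible_rep_snd:
  assumes "eligible_rep f \<epsilon> u0 \<sigma>0 H h"
  shows "AE p in H. \<sigma>0 \<le> snd p"
proof -
  have "sets H = sets borel" using assms by (simp add: eligible_rep_def)
  then have [measurable]: "snd \<in> measurable H borel"
    by (subst measurable_cong_sets[OF _ refl]) (assumption, rule borel_measurable_snd_real)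
  show ?thesis using assms by (subst AE_distr_iff[symmetric, of snd H borel]) (auto simp: eligible_rep_def)
qed

lemma eligible_fourier:
  assumes r: "eligible_rep f \<epsilon> u0 \<sigma>0 H h"
  shows "(\<integral>x. f x *\<^sub>R iexp (t * x) \<partial>lborel) =
    (1 - \<epsilon>) *\<^sub>R (iexp (t * u0) * of_real (exp (- (\<sigma>0\<^sup>2 * t\<^sup>2) / 2))) +
    \<epsilon> *\<^sub>R (\<integral>p. iexp (t * fst p) * of_real (exp (- ((snd p)\<^sup>2 * t\<^sup>2) / 2)) \<partial>H)"
proof -
  have H: "prob_space H" "sets H = sets borel" and s0: "0 < \<sigma>0" and f: "f = gauss_mixture \<epsilon> u0 \<sigma>0 H"
    using r by (auto simp: eligible_rep_def)
  interpret prob_space H by fact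
  interpret pair_sigma_finite H lborel ..
  have sig: "AE p in H. 0 < snd p" using eligible_rep_snd[OF r] s0 by auto
  note int = normal_mixture_integrable[OF H sig, of t]
  have eq: "f x *\<^sub>R iexp (t * x) = (1 - \<epsilon>) *\<^sub>R (normal_density u0 \<sigma>0 x *\<^sub>R iexp (t * x))
      + \<epsilon> *\<^sub>R (\<integral>p. normal_density (fst p) (snd p) x *\<^sub>R iexp (t * x) \<partial>H)" for x
  proof -
    have "(\<integral>p. normal_density (fst p) (snd p) x *\<^sub>R iexp (t * x) \<partial>H)
        = (\<integral>p. normal_density (fst p) (snd p) x \<partial>H) *\<^sub>R iexp (t * x)"
      by (simp only: scaleR_conv_of_real integral_mult_left_zero integral_complex_of_real)
    then show ?thesis
      by (simp only: f gauss_mixture_def scaleR_add_left case_prod_unfold scaleR_scaleR)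
  qed
  have i1: "integrable lborel (\<lambda>x. normal_density u0 \<sigma>0 x *\<^sub>R iexp (t * x))"
    using s0 by (intro integrable_iexp_mult) auto
  have i2: "integrable lborel (\<lambda>x. \<integral>p. normal_density (fst p) (snd p) x *\<^sub>R iexp (t * x) \<partial>H)"
    using integrable_snd[OF int] .
  have "(\<integral>x. f x *\<^sub>R iexp (t * x) \<partial>lborel) =
     (1 - \<epsilon>) *\<^sub>R (\<integral>x. normal_density u0 \<sigma>0 x *\<^sub>R iexp (t * x) \<partial>lborel)
      + \<epsilon> *\<^sub>R (\<integral>x. (\<integral>p. normal_density (fst p) (snd p) x *\<^sub>R iexp (t * x) \<partial>H) \<partial>lborel)"
    unfolding eq
    by (subst Bochner_Integration.integral_add)
       (use i1 i2 in \<open>auto simp only: integrable_scaleR_right integral_scaleR_right\<close>)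
  also have "(\<integral>x. (\<integral>p. normal_density (fst p) (snd p) x *\<^sub>R iexp (t * x) \<partial>H) \<partial>lborel)
     = (\<integral>p. (\<integral>x. normal_density (fst p) (snd p) x *\<^sub>R iexp (t * x) \<partial>lborel) \<partial>H)"
    by (rule Fubini_integral[OF int])
  also have "\<dots> = (\<integral>p. iexp (t * fst p) * of_real (exp (- ((snd p)\<^sup>2 * t\<^sup>2) / 2)) \<partial>H)"
  proof (rule integral_cong_AE)
    show "(\<lambda>p. \<integral>x. normal_density (fst p) (snd p) x *\<^sub>R iexp (t * x) \<partial>lborel) \<in> borel_measurable H"
      using integrable_fst[OF int] by (rule borel_measurable_integrable)
    show "(\<lambda>p. iexp (t * fst p) * of_real (exp (- ((snd p)\<^sup>2 * t\<^sup>2) / 2))) \<in> borel_measurable H"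
      unfolding measurable_cong_sets[OF H(2) refl] borel_prod[symmetric] by measurable
    show "AE p in H. (\<integral>x. normal_density (fst p) (snd p) x *\<^sub>R iexp (t * x) \<partial>lborel)
      = iexp (t * fst p) * of_real (exp (- ((snd p)\<^sup>2 * t\<^sup>2) / 2))"
      using sig by eventually_elim (rule normal_fourier)
  qed
  finally show ?thesis using normal_fourier[OF s0, of u0 t] by simp
qed

lemma eligible_mixture_decay:
  assumes r: "eligible_rep f \<epsilon> u0 \<sigma>0 H h"
  shows "((\<lambda>t. of_real (exp (\<sigma>0\<^sup>2 * t\<^sup>2 / 2)) *
      (\<integral>p. iexp (t * fst p) * of_real (exp (- ((snd p)\<^sup>2 * t\<^sup>2) / 2)) \<partial>H)) \<longlongrightarrow> 0) at_top"
proof -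
  define S where "S = sigma_marginal H"
  have H: "prob_space H" "sets H = sets borel" and s0: "0 < \<sigma>0"
    and hm: "(\<lambda>(u, \<sigma>). h u \<sigma>) \<in> borel_measurable borel"
    and h0: "\<And>u \<sigma>. \<sigma>0 \<le> \<sigma> \<Longrightarrow> 0 \<le> h u \<sigma>"
    and h1: "\<And>\<sigma>. \<sigma>0 \<le> \<sigma> \<Longrightarrow> (\<integral>\<^sup>+u. ennreal (h u \<sigma>) \<partial>lborel) = 1"
    and Hd: "H = density (lborel \<Otimes>\<^sub>M S) (\<lambda>(u, \<sigma>). ennreal (h u \<sigma>))"
    using r by (auto simp: eligible_rep_def has_cond_density_def S_def)
  have AS: "AE \<sigma> in S. \<sigma>0 \<le> \<sigma>"
    using r unfolding eligible_rep_def S_def by blast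
  interpret prob_space H by fact
  have sndm: "snd \<in> measurable H borel"
    by (subst measurable_cong_sets[OF H(2) refl]) (rule borel_measurable_snd_real)
  interpret S: prob_space S unfolding S_def by (rule prob_space_distr[OF sndm])
  interpret P: pair_sigma_finite lborel S ..
  have setS[measurable_cong]: "sets S = sets borel" by (simp add: S_def)
  have setP: "sets (lborel \<Otimes>\<^sub>M S) = sets borel"
    using sets_pair_measure_cong[OF sets_lborel setS] unfolding borel_prod .
  have hm2[measurable]: "(\<lambda>p. h (fst p) (snd p)) \<in> borel_measurable (lborel \<Otimes>\<^sub>M S)"
    using hm unfolding measurable_cong_sets[OF setP refl] case_prod_unfold .
  have hm3[measurable]: "(\<lambda>u. h u \<sigma>) \<in> borel_measurable borel" for \<sigma>
    using measurable_compose[OF _ hm[unfolded borel_prod[symmetric]], of "\<lambda>u. (u, \<sigma>)" borel]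
    by simp
  have hi: "integrable lborel (\<lambda>u. h u \<sigma>)" if "\<sigma>0 \<le> \<sigma>" for \<sigma>
    using h0[OF that] h1[OF that] by (intro integrableI_nonneg) auto
  have hI: "(\<integral>u. h u \<sigma> \<partial>lborel) = 1" if "\<sigma>0 \<le> \<sigma>" for \<sigma>
    using h0[OF that] h1[OF that] by (subst integral_eq_nn_integral) auto
  have APair: "AE p in lborel \<Otimes>\<^sub>M S. \<sigma>0 \<le> snd p"
  proof (rule P.AE_pair_measure)
    show "{p \<in> space (lborel \<Otimes>\<^sub>M S). \<sigma>0 \<le> snd p} \<in> sets (lborel \<Otimes>\<^sub>M S)" by measurable
  qed (use AS in auto)
  have nn: "AE p in lborel \<Otimes>\<^sub>M S. 0 \<le> h (fst p) (snd p)"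
    using APair by eventually_elim (rule h0)
  define g where "g = (\<lambda>t (p::real\<times>real). iexp (t * fst p) * complex_of_real (exp (- ((snd p)\<^sup>2 * t\<^sup>2) / 2)))"
  have gm[measurable]: "g t \<in> borel_measurable (lborel \<Otimes>\<^sub>M S)" for t
    unfolding g_def by measurable
  have hint: "integrable (lborel \<Otimes>\<^sub>M S) (\<lambda>p. h (fst p) (snd p))"
  proof (rule integrableI_nonneg[OF hm2 nn])
    have "(\<integral>\<^sup>+p. ennreal (h (fst p) (snd p)) \<partial>(lborel \<Otimes>\<^sub>M S)) = emeasure H (space H)"
    proof -
      have "emeasure H (space H)
          = emeasure (density (lborel \<Otimes>\<^sub>M S) (\<lambda>p. ennreal (h (fst p) (snd p)))) (space (lborel \<Otimes>\<^sub>M S))"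
        by (subst (1 2) Hd) (simp only: case_prod_unfold space_density)
      also have "\<dots> = (\<integral>\<^sup>+p. ennreal (h (fst p) (snd p)) * indicator (space (lborel \<Otimes>\<^sub>M S)) p \<partial>(lborel \<Otimes>\<^sub>M S))"
        by (rule emeasure_density) measurable
      also have "\<dots> = (\<integral>\<^sup>+p. ennreal (h (fst p) (snd p)) \<partial>(lborel \<Otimes>\<^sub>M S))"
        by (rule nn_integral_cong) simp
      finally show ?thesis by simp
    qed
    then show "(\<integral>\<^sup>+p. ennreal (h (fst p) (snd p)) \<partial>(lborel \<Otimes>\<^sub>M S)) < \<infinity>"
      using emeasure_space_1 by simp
  qed
  have gint: "integrable (lborel \<Otimes>\<^sub>M S) (\<lambda>(u, \<sigma>). h u \<sigma> *\<^sub>R g t (u, \<sigma>))" for t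
    by (rule Bochner_Integration.integrable_bound[OF hint])
       (auto simp: split_beta g_def norm_mult intro!: AE_I2 mult_left_le)
  have eq: "(\<integral>p. g t p \<partial>H) = (\<integral>\<sigma>. (\<integral>u. h u \<sigma> *\<^sub>R iexp (t * u) \<partial>lborel) * of_real (exp (- (\<sigma>\<^sup>2 * t\<^sup>2) / 2)) \<partial>S)" for t
  proof -
    have "(\<integral>p. g t p \<partial>H) = (\<integral>p. h (fst p) (snd p) *\<^sub>R g t p \<partial>(lborel \<Otimes>\<^sub>M S))"
      by (subst Hd, subst integral_density[symmetric]) (use nn in \<open>simp_all add: case_prod_unfold\<close>)
    also have "\<dots> = (\<integral>\<sigma>. (\<integral>u. h u \<sigma> *\<^sub>R g t (u, \<sigma>) \<partial>lborel) \<partial>S)"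
      using P.integral_snd[OF gint[of t]] by (simp add: case_prod_unfold)
    also have "\<dots> = (\<integral>\<sigma>. (\<integral>u. (h u \<sigma> *\<^sub>R iexp (t * u)) * of_real (exp (- (\<sigma>\<^sup>2 * t\<^sup>2) / 2)) \<partial>lborel) \<partial>S)"
      by (simp add: g_def)
    finally show ?thesis by (simp only: integral_mult_left_zero)
  qed
  have main: "((\<lambda>t. \<integral>\<sigma>. (\<integral>u. h u \<sigma> *\<^sub>R iexp (t * u) \<partial>lborel) * of_real (exp (- ((\<sigma>\<^sup>2 - \<sigma>0\<^sup>2) * t\<^sup>2) / 2)) \<partial>S)
     \<longlongrightarrow> (\<integral>\<sigma>. 0 \<partial>S)) at_top"
  proof (rule integral_dominated_convergence_at_top[where w="\<lambda>_. 1"])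
    have "norm ((\<integral>u. h u \<sigma> *\<^sub>R iexp (t * u) \<partial>lborel) * of_real (exp (- ((\<sigma>\<^sup>2 - \<sigma>0\<^sup>2) * t\<^sup>2) / 2)))
       \<le> norm (\<integral>u. h u \<sigma> *\<^sub>R iexp (t * u) \<partial>lborel)"  if "\<sigma>0 \<le> \<sigma>" for t \<sigma>
      using that s0 by (auto simp: norm_mult power_mono intro!: mult_left_le)
    note B1 = this
    have B2: "norm (\<integral>u. h u \<sigma> *\<^sub>R iexp (t * u) \<partial>lborel) \<le> 1" if "\<sigma>0 \<le> \<sigma>" for t \<sigma>
    proof -
      have "norm (\<integral>u. h u \<sigma> *\<^sub>R iexp (t * u) \<partial>lborel) \<le> (\<integral>u. norm (h u \<sigma> *\<^sub>R iexp (t * u)) \<partial>lborel)"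
        by (rule integral_norm_bound)
      also have "\<dots> = 1" using h0[OF that] hI[OF that] by simp
      finally show ?thesis .
    qed
    show "\<forall>\<^sub>F t in at_top. AE \<sigma> in S. norm ((\<integral>u. h u \<sigma> *\<^sub>R iexp (t * u) \<partial>lborel) * of_real (exp (- ((\<sigma>\<^sup>2 - \<sigma>0\<^sup>2) * t\<^sup>2) / 2))) \<le> 1"
    proof (rule always_eventually, rule allI)
      fix t show "AE \<sigma> in S. norm ((\<integral>u. h u \<sigma> *\<^sub>R iexp (t * u) \<partial>lborel) * of_real (exp (- ((\<sigma>\<^sup>2 - \<sigma>0\<^sup>2) * t\<^sup>2) / 2))) \<le> 1"
        using AS by eventually_elim (rule order_trans[OF B1 B2])
    qed
    show "AE \<sigma> in S. ((\<lambda>t. (\<integral>u. h u \<sigma> *\<^sub>R iexp (t * u) \<partial>lborel) * of_real (exp (- ((\<sigma>\<^sup>2 - \<sigma>0\<^sup>2) * t\<^sup>2) / 2))) \<longlongrightarrow> 0) at_top"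
      using AS
    proof eventually_elim
      case (elim \<sigma>)
      show ?case
        by (rule Lim_null_comparison[OF always_eventually tendsto_norm_zero[OF riemann_lebesgue[OF hi[OF elim]]]])
           (use B1[OF elim] in blast)
    qed
    have [measurable]: "(\<lambda>p. h (snd p) (fst p)) \<in> borel_measurable (S \<Otimes>\<^sub>M lborel)"
      using measurable_compose[OF measurable_pair_swap' hm2] by (simp add: split_beta)
    show "(\<lambda>\<sigma>. (\<integral>u. h u \<sigma> *\<^sub>R iexp (t * u) \<partial>lborel) * of_real (exp (- ((\<sigma>\<^sup>2 - \<sigma>0\<^sup>2) * t\<^sup>2) / 2))) \<in> borel_measurable S" for t
    proof -
      have "(\<lambda>p. h (snd p) (fst p) *\<^sub>R iexp (t * snd p)) \<in> borel_measurable (S \<Otimes>\<^sub>M lborel)"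
        by measurable
      then have [measurable]: "(\<lambda>\<sigma>. \<integral>u. h u \<sigma> *\<^sub>R iexp (t * u) \<partial>lborel) \<in> borel_measurable S"
        by (intro lborel.borel_measurable_lebesgue_integral) (simp add: split_beta)
      show ?thesis by measurable
    qed
  qed auto
  have "of_real (exp (\<sigma>0\<^sup>2 * t\<^sup>2 / 2)) * (\<integral>p. g t p \<partial>H)
     = (\<integral>\<sigma>. (\<integral>u. h u \<sigma> *\<^sub>R iexp (t * u) \<partial>lborel) * of_real (exp (- ((\<sigma>\<^sup>2 - \<sigma>0\<^sup>2) * t\<^sup>2) / 2)) \<partial>S)" for t
  proof -
    have *: "complex_of_real (exp (\<sigma>0\<^sup>2 * t\<^sup>2 / 2)) * of_real (exp (- (\<sigma>\<^sup>2 * t\<^sup>2) / 2)) = of_real (exp (- ((\<sigma>\<^sup>2 - \<sigma>0\<^sup>2) * t\<^sup>2) / 2))" for \<sigma>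
      unfolding of_real_mult[symmetric] exp_add[symmetric] by (simp add: field_simps)
    show ?thesis
      unfolding eq integral_mult_right_zero[symmetric] *[symmetric]
      by (simp only: mult.assoc mult.left_commute)
  qed
  with main show ?thesis by (simp add: g_def)
qed

lemma eligible_limit:
  assumes r: "eligible_rep f \<epsilon> u0 \<sigma>0 H h"
  shows "((\<lambda>t. of_real (exp (\<sigma>0\<^sup>2 * t\<^sup>2 / 2)) * iexp (- (t * u0)) * (\<integral>x. f x *\<^sub>R iexp (t * x) \<partial>lborel))
     \<longlongrightarrow> of_real (1 - \<epsilon>)) at_top"
proof -
  define D where "D = (\<lambda>t. of_real (exp (\<sigma>0\<^sup>2 * t\<^sup>2 / 2)) *
      (\<integral>p. iexp (t * fst p) * of_real (exp (- ((snd p)\<^sup>2 * t\<^sup>2) / 2)) \<partial>H))"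
  have D: "(D \<longlongrightarrow> 0) at_top" using eligible_mixture_decay[OF r] by (simp add: D_def)
  have 1: "of_real (exp (\<sigma>0\<^sup>2 * t\<^sup>2 / 2)) * iexp (- (t * u0)) * (\<integral>x. f x *\<^sub>R iexp (t * x) \<partial>lborel)
      = of_real (1 - \<epsilon>) + \<epsilon> *\<^sub>R (iexp (- (t * u0)) * D t)" for t
  proof -
    have a: "complex_of_real (exp (\<sigma>0\<^sup>2 * t\<^sup>2 / 2)) * of_real (exp (- (\<sigma>0\<^sup>2 * t\<^sup>2) / 2)) = 1"
      unfolding of_real_mult[symmetric] exp_add[symmetric] by simp
    have b: "iexp (- (t * u0)) * iexp (t * u0) = 1"
      unfolding exp_add[symmetric] by simp
    have gen: "E * I * (c *\<^sub>R (J * K) + \<epsilon> *\<^sub>R X) = c *\<^sub>R ((E * K) * (I * J)) + \<epsilon> *\<^sub>R (I * (E * X))" for E I J K X :: complex and c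
      by (simp add: algebra_simps)
    show ?thesis
      unfolding eligible_fourier[OF r] gen a b D_def by (simp add: scaleR_conv_of_real)
  qed
  have "((\<lambda>t. \<epsilon> *\<^sub>R (iexp (- (t * u0)) * D t)) \<longlongrightarrow> 0) at_top"
  proof (rule Lim_null_comparison)
    show "\<forall>\<^sub>F t in at_top. norm (\<epsilon> *\<^sub>R (iexp (- (t * u0)) * D t)) \<le> \<bar>\<epsilon>\<bar> * norm (D t)"
      by (intro always_eventually allI) (simp add: norm_mult del: of_real_mult of_real_minus)
    show "((\<lambda>t. \<bar>\<epsilon>\<bar> * norm (D t)) \<longlongrightarrow> 0) at_top"
      using tendsto_mult[OF tendsto_const tendsto_norm_zero[OF D], of "\<bar>\<epsilon>\<bar>"] by simp
  qed
  from tendsto_add[OF tendsto_const this, of "of_real (1 - \<epsilon>)"]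
  show ?thesis unfolding 1 by simp
qed

lemma eligible_sd_le:
  assumes r: "eligible_rep f \<epsilon> u0 \<sigma>0 H h" and r': "eligible_rep f \<epsilon>' u0' \<sigma>0' H' h'"
  shows "\<sigma>0' \<le> \<sigma>0"
proof (rule ccontr)
  assume "\<not> \<sigma>0' \<le> \<sigma>0"
  then have lt: "\<sigma>0 < \<sigma>0'" by simp
  have p: "0 < \<sigma>0" "\<epsilon> < 1" using r by (auto simp: eligible_rep_def)
  define G where "G = (\<lambda>t. \<integral>x. f x *\<^sub>R iexp (t * x) \<partial>lborel)"
  have A: "((\<lambda>t. exp (\<sigma>0\<^sup>2 * t\<^sup>2 / 2) * norm (G t)) \<longlongrightarrow> \<bar>1 - \<epsilon>\<bar>) at_top"
    using tendsto_norm[OF eligible_limit[OF r]] by (simp add: norm_mult G_def del: of_real_mult of_real_minus of_real_diff)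
  have B: "((\<lambda>t. exp (\<sigma>0'\<^sup>2 * t\<^sup>2 / 2) * norm (G t)) \<longlongrightarrow> \<bar>1 - \<epsilon>'\<bar>) at_top"
    using tendsto_norm[OF eligible_limit[OF r']] by (simp add: norm_mult G_def del: of_real_mult of_real_minus of_real_diff)
  define k where "k = (\<sigma>0'\<^sup>2 - \<sigma>0\<^sup>2) / 2"
  have k: "0 < k" using lt p by (simp add: k_def power_strict_mono)
  have "((\<lambda>t. exp (- k * t\<^sup>2)) \<longlongrightarrow> 0) at_top"
  proof (rule filterlim_compose[OF exp_at_bot])
    have "filterlim (\<lambda>t::real. t\<^sup>2) at_top at_top" by (rule filterlim_pow_at_top[OF _ filterlim_ident]) simp
    then show "filterlim (\<lambda>t::real. - k * t\<^sup>2) at_bot at_top"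
      using k by (intro filterlim_tendsto_neg_mult_at_bot[OF tendsto_const]) auto
  qed
  from tendsto_mult[OF this B]
  have "((\<lambda>t. exp (- k * t\<^sup>2) * (exp (\<sigma>0'\<^sup>2 * t\<^sup>2 / 2) * norm (G t))) \<longlongrightarrow> 0) at_top" by simp
  also have "(\<lambda>t. exp (- k * t\<^sup>2) * (exp (\<sigma>0'\<^sup>2 * t\<^sup>2 / 2) * norm (G t))) = (\<lambda>t. exp (\<sigma>0\<^sup>2 * t\<^sup>2 / 2) * norm (G t))"
    unfolding mult.assoc[symmetric] exp_add[symmetric] by (rule ext) (simp add: k_def field_simps)
  finally have "\<bar>1 - \<epsilon>\<bar> = 0" using A tendsto_unique[OF trivial_limit_at_top_linorder] by blast
  then show False using p by simp
qed

lemma identifiable: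
  assumes r: "eligible_rep f \<epsilon> u0 \<sigma>0 H h" and r': "eligible_rep f \<epsilon>' u0' \<sigma>0' H' h'"
  shows "\<epsilon> = \<epsilon>' \<and> u0 = u0' \<and> \<sigma>0 = \<sigma>0'"
proof -
  have s: "\<sigma>0 = \<sigma>0'" using eligible_sd_le[OF r r'] eligible_sd_le[OF r' r] by simp
  have p: "\<epsilon> < 1" "\<epsilon>' < 1" using r r' by (auto simp: eligible_rep_def)
  define G where "G = (\<lambda>t. of_real (exp (\<sigma>0\<^sup>2 * t\<^sup>2 / 2)) * (\<integral>x. f x *\<^sub>R iexp (t * x) \<partial>lborel))"
  have A: "((\<lambda>t. iexp (- (t * u0)) * G t) \<longlongrightarrow> of_real (1 - \<epsilon>)) at_top"
    using eligible_limit[OF r] by (simp only: G_def mult.assoc mult.left_commute)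
  have B: "((\<lambda>t. iexp (- (t * u0')) * G t) \<longlongrightarrow> of_real (1 - \<epsilon>')) at_top"
    using eligible_limit[OF r'] by (simp only: G_def s mult.assoc mult.left_commute)
  have nA: "((\<lambda>t. norm (G t)) \<longlongrightarrow> \<bar>1 - \<epsilon>\<bar>) at_top"
    using tendsto_norm[OF A] by (simp add: norm_mult del: of_real_mult of_real_minus of_real_diff)
  have nB: "((\<lambda>t. norm (G t)) \<longlongrightarrow> \<bar>1 - \<epsilon>'\<bar>) at_top"
    using tendsto_norm[OF B] by (simp add: norm_mult del: of_real_mult of_real_minus of_real_diff)
  have e: "\<epsilon> = \<epsilon>'"
    using tendsto_unique[OF trivial_limit_at_top_linorder nA nB] p by simp
  have ne: "complex_of_real (1 - \<epsilon>) \<noteq> 0" using p by simp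
  define d where "d = u0' - u0"
  have "((\<lambda>t. (iexp (- (t * u0)) * G t) / (iexp (- (t * u0')) * G t)) \<longlongrightarrow> of_real (1 - \<epsilon>) / of_real (1 - \<epsilon>)) at_top"
    by (rule tendsto_divide[OF A B[folded e] ne])
  then have "((\<lambda>t. (iexp (- (t * u0)) * G t) / (iexp (- (t * u0')) * G t)) \<longlongrightarrow> 1) at_top" using ne by simp
  moreover have abs_1e: "0 < \<bar>1 - \<epsilon>\<bar>" using p by simp
  have "\<forall>\<^sub>F t in at_top. (iexp (- (t * u0)) * G t) / (iexp (- (t * u0')) * G t) = iexp (t * d)"
    using order_tendstoD(1)[OF nA abs_1e]
  proof eventually_elim
    case (elim t)
    have "iexp (t * d) = iexp (- (t * u0)) / iexp (- (t * u0'))"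
      unfolding exp_diff[symmetric] by (simp add: d_def algebra_simps)
    then show ?case using elim by simp
  qed
  ultimately have L: "((\<lambda>t. iexp (t * d)) \<longlongrightarrow> 1) at_top"
    by (rule Lim_transform_eventually)
  have "d = 0"
  proof (rule ccontr)
    assume d: "d \<noteq> 0"
    have "filterlim (\<lambda>t. t + pi / d) at_top at_top"
      by (simp add: add.commute[of _ "pi / d"] filterlim_tendsto_add_at_top[OF tendsto_const filterlim_ident])
    from filterlim_compose[OF L this]
    have "((\<lambda>t. iexp ((t + pi / d) * d)) \<longlongrightarrow> 1) at_top" .
    moreover have "iexp ((t + pi / d) * d) = - iexp (t * d)" for t
    proof -
      have "(t + pi / d) * d = t * d + pi" using d by (simp add: field_simps)
      then have "iexp ((t + pi / d) * d) = iexp (t * d) * iexp pi"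
        by (simp only: of_real_add distrib_left exp_add)
      then show ?thesis by simp
    qed
    ultimately have "((\<lambda>t. - iexp (t * d)) \<longlongrightarrow> 1) at_top" by simp
    from tendsto_unique[OF trivial_limit_at_top_linorder this tendsto_minus[OF L]]
    show False by simp
  qed
  then show ?thesis using s e by (simp add: d_def)
qed

lemma eligible_rep_params:
  assumes "eligible_rep f \<epsilon> u0 \<sigma>0 H h"
  shows "proportion f = \<epsilon>" "null_mean f = u0" "null_sd f = \<sigma>0"
proof -
  have "null_params f = (\<epsilon>, u0, \<sigma>0)"
    unfolding null_params_def
  proof (rule the_equality)
    show "case (\<epsilon>, u0, \<sigma>0) of (\<epsilon>, u0, \<sigma>0) \<Rightarrow> \<exists>H h. eligible_rep f \<epsilon> u0 \<sigma>0 H h"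
      using assms by blast
    fix z assume "case z of (\<epsilon>, u0, \<sigma>0) \<Rightarrow> \<exists>H h. eligible_rep f \<epsilon> u0 \<sigma>0 H h"
    then obtain e u s H' h' where "z = (e, u, s)" "eligible_rep f e u s H' h'"
      by (cases z) auto
    then show "z = (\<epsilon>, u0, \<sigma>0)" using identifiable[OF assms] by metis
  qed
  then show "proportion f = \<epsilon>" "null_mean f = u0" "null_sd f = \<sigma>0"
    by (simp_all add: proportion_def null_mean_def null_sd_def)
qed

end

theory Submission
  imports Defs "HOL-Real_Asymp.Real_Asymp"
begin

text \<open>
  This is a two-point (Le Cam) argument. Two members of the class are exhibited whose null
  parameters differ by the claimed rate, but whose densities are so close that \<open>n\<close> observations
  cannot tell them apart; no estimator can then be accurate at both.

  Write \<open>\<phi>\<^sub>S\<close> for the centred Gaussian density of variance \<open>S\<close>, put \<open>\<epsilon> = \<epsilon>0 n\<^sup>-\<^sup>\<beta>\<close> and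
  \<open>S = a\<^sup>2 + \<delta>\<close>, and let \<open>\<phi>\<close> be the standard normal density. The two models are
  \<open>f0 = (1 - \<epsilon>) N(0, S) + \<epsilon> \<phi>\<^sub>S * \<phi>\<close> and \<open>f1 = (1 - \<epsilon>) N(\<mu>, a\<^sup>2) + \<epsilon> \<phi>\<^sub>S * h\<close>. For the variance one
  takes \<open>\<mu> = 0\<close> and a small \<open>\<delta> > 0\<close>, for the mean \<open>\<delta> = 0\<close> and a small \<open>\<mu> > 0\<close>. They would
  coincide if \<open>\<phi>\<^sub>S * (h - \<phi>)\<close> were equal to \<open>(1 - \<epsilon>) / \<epsilon>\<close> times \<open>N(0, S) - N(\<mu>, a\<^sup>2)\<close>. Formally this
  deconvolution has a solution of the form \<open>h(u) = \<phi>(u) (1 + \<integral> G(s) e\<^sup>i\<^sup>s\<^sup>u ds)\<close>, a superposition of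
  waves under a Gaussian envelope with an explicit weight \<open>G\<close>
  (\<open>normal_density_spectral\<close>, \<open>normal_smoothing_of_wave\<close>), but the integral does not converge: the
  formal solution is not a function. Cutting the frequencies at \<open>\<bar>s\<bar> \<le> T\<close> makes \<open>h\<close> a genuine
  density, and the price is tiny, because a wave of frequency \<open>s\<close> under the Gaussian envelope is
  damped by a factor \<open>exp (- c s\<^sup>2)\<close> when it is convolved with \<open>\<phi>\<^sub>S\<close>. So \<open>f1 \<ge> f0\<close> up to an error
  of mass \<open>O(exp (- b T\<^sup>2 / 4))\<close> (\<open>convolution_model_gap\<close>), which is \<open>O(n\<^sup>-\<^sup>2)\<close> for a suitable \<open>T\<close> of
  order \<open>sqrt (ln n)\<close>.

  The truncated \<open>h\<close> is a probability density comparable with \<open>\<phi>\<close> as soon as the truncated weight has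
  small mass; that mass is of order \<open>(\<delta> T\<^sup>3 + \<mu> T\<^sup>2) / \<epsilon>\<close> (\<open>gap_weight_mass\<close>). With
  \<open>\<delta> = \<epsilon> * ln n powr (- (\<alpha> + 2) / 2)\<close>, or \<open>\<mu> = \<epsilon> * ln n powr (- (\<alpha> + 1) / 2)\<close>, it is of
  order \<open>ln n powr ((1 - \<alpha>) / 2)\<close> and so tends to \<open>0\<close>. This also gives the moment condition,
  since both densities are then dominated by nearly unit multiples of Gaussian mixtures of variance
  close to at most \<open>a\<^sup>2 + 1\<close>. The tail condition holds because the Fourier transform of \<open>h\<close> is an integral
  of Gaussians centred in \<open>[-T, T]\<close>, which decays faster than any power together with its derivative
  (\<open>fast_decay_tilted_normal\<close>). The squared separations \<open>\<delta>\<^sup>2\<close> and \<open>\<mu>\<^sup>2\<close> are the two rates.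
\<close>

section \<open>The two-point lower bound\<close>

lemma sigma_finite_density_real:
  fixes f :: "real \<Rightarrow> real"
  assumes [measurable]: "f \<in> borel_measurable borel"
  shows "sigma_finite_measure (density lborel (\<lambda>x. ennreal (f x)))"
  by (subst sigma_finite_measure.sigma_finite_iff_density_finite[OF sigma_finite_lborel]) auto

text \<open>
  Both sample laws are given densities against one dominating measure, so that risks under
  different models can be compared pointwise. Finite-dimensional boxes determine the product measure.
\<close>
lemma sample_law_eq_density:
  assumes [measurable]: "f \<in> borel_measurable borel"
  shows "sample_law n f =
    density (\<Pi>\<^sub>M i\<in>{..<n}. (lborel :: real measure)) (\<lambda>X. \<Prod>i<n. ennreal (f (X i)))"
proof -
  interpret L: product_sigma_finite "\<lambda>_::nat. lborel :: real measure" ..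
  interpret D: product_sigma_finite "\<lambda>_::nat. density lborel (\<lambda>x. ennreal (f x))"
    unfolding product_sigma_finite_def using sigma_finite_density_real[OF assms] by blast
  have "density (\<Pi>\<^sub>M i\<in>{..<n}. (lborel :: real measure)) (\<lambda>X. \<Prod>i<n. ennreal (f (X i)))
      = (\<Pi>\<^sub>M i\<in>{..<n}. density lborel (\<lambda>x. ennreal (f x)))"
  proof (rule D.PiM_eqI)
    show "sets (density (\<Pi>\<^sub>M i\<in>{..<n}. (lborel :: real measure)) (\<lambda>X. \<Prod>i<n. ennreal (f (X i))))
        = sets (\<Pi>\<^sub>M i\<in>{..<n}. density lborel (\<lambda>x. ennreal (f x)))"
      unfolding sets_density by (rule sets_PiM_cong) simp_all
    fix A :: "nat \<Rightarrow> real set"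
    assume "\<And>i. i \<in> {..<n} \<Longrightarrow> A i \<in> sets (density lborel (\<lambda>x. ennreal (f x)))"
    then have A: "A i \<in> sets borel" if "i < n" for i using that by simp
    have "emeasure (density (\<Pi>\<^sub>M i\<in>{..<n}. (lborel :: real measure)) (\<lambda>X. \<Prod>i<n. ennreal (f (X i)))) (Pi\<^sub>E {..<n} A)
       = (\<integral>\<^sup>+X. (\<Prod>i<n. ennreal (f (X i))) * indicator (Pi\<^sub>E {..<n} A) X \<partial>(\<Pi>\<^sub>M i\<in>{..<n}. lborel))"
    proof (rule emeasure_density)
      show "(\<lambda>X. \<Prod>i<n. ennreal (f (X i))) \<in> borel_measurable (\<Pi>\<^sub>M i\<in>{..<n}. (lborel :: real measure))"
        by (intro borel_measurable_prod_ennreal measurable_compose[OF measurable_component_singleton]) auto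
      show "Pi\<^sub>E {..<n} A \<in> sets (\<Pi>\<^sub>M i\<in>{..<n}. (lborel :: real measure))"
        using A by (intro sets_PiM_I_finite) auto
    qed
    also have "\<dots> = (\<integral>\<^sup>+X. (\<Prod>i<n. ennreal (f (X i)) * indicator (A i) (X i)) \<partial>(\<Pi>\<^sub>M i\<in>{..<n}. lborel))"
    proof (rule nn_integral_cong)
      fix X :: "nat \<Rightarrow> real" assume X: "X \<in> space (\<Pi>\<^sub>M i\<in>{..<n}. (lborel :: real measure))"
      have "indicator (Pi\<^sub>E {..<n} A) X = (\<Prod>i<n. indicator (A i) (X i) :: ennreal)"
      proof (cases "X \<in> Pi\<^sub>E {..<n} A")
        case True
        then have "(\<Prod>i<n. indicator (A i) (X i) :: ennreal) = (\<Prod>i<n. 1)"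
          by (intro prod.cong refl) (auto simp: PiE_def Pi_def)
        then show ?thesis using True by simp
      next
        case False
        then obtain i where "i < n" "X i \<notin> A i"
          using X by (auto simp: space_PiM PiE_iff)
        then have "(\<Prod>i<n. indicator (A i) (X i) :: ennreal) = 0"
          by (intro prod_zero) (auto intro!: bexI[of _ i])
        then show ?thesis using False by simp
      qed
      then show "(\<Prod>i<n. ennreal (f (X i))) * indicator (Pi\<^sub>E {..<n} A) X
          = (\<Prod>i<n. ennreal (f (X i)) * indicator (A i) (X i))"
        by (simp add: prod.distrib)
    qed
    also have "\<dots> = (\<Prod>i<n. \<integral>\<^sup>+x. ennreal (f x) * indicator (A i) x \<partial>lborel)"
    proof (rule L.product_nn_integral_prod)
      fix i assume "i \<in> {..<n}"
      then have [measurable]: "A i \<in> sets borel" using A by simp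
      show "(\<lambda>x. ennreal (f x) * indicator (A i) x) \<in> borel_measurable lborel" by measurable
    qed simp
    also have "\<dots> = (\<Prod>i<n. emeasure (density lborel (\<lambda>x. ennreal (f x))) (A i))"
    proof (rule prod.cong)
      fix i assume "i \<in> {..<n}"
      then show "(\<integral>\<^sup>+x. ennreal (f x) * indicator (A i) x \<partial>lborel) = emeasure (density lborel (\<lambda>x. ennreal (f x))) (A i)"
        using A by (intro emeasure_density[symmetric]) auto
    qed simp
    finally show "emeasure (density (\<Pi>\<^sub>M i\<in>{..<n}. (lborel :: real measure)) (\<lambda>X. \<Prod>i<n. ennreal (f (X i)))) (Pi\<^sub>E {..<n} A)
       = (\<Prod>i\<in>{..<n}. emeasure (density lborel (\<lambda>x. ennreal (f x))) (A i))" .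
  qed simp
  then show ?thesis unfolding sample_law_def by simp
qed

text \<open>
  By \<open>(T - \<theta>0)\<^sup>2 + (T - \<theta>1)\<^sup>2 \<ge> (\<theta>1 - \<theta>0)\<^sup>2 / 2\<close>, the two risks together are at least that bound
  integrated against the minimum of the two sample densities. The minimum of two products is at
  least the product of the minima, so the affinity of the samples is at least the \<open>n\<close>-th power of
  the affinity of one observation.
\<close>
lemma minimax_risk_two_point:
  assumes F: "f0 \<in> F" "f1 \<in> F"
    and m[measurable]: "f0 \<in> borel_measurable borel" "f1 \<in> borel_measurable borel"
    and affinity: "ennreal p \<le> (\<integral>\<^sup>+x. min (ennreal (f0 x)) (ennreal (f1 x)) \<partial>lborel)"
    and p: "0 \<le> p"
  shows "ennreal ((\<theta> f1 - \<theta> f0)\<^sup>2 / 4 * p ^ n) \<le> minimax_risk n F \<theta>"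
  unfolding minimax_risk_def
proof (rule INF_greatest)
  fix T :: "(nat \<Rightarrow> real) \<Rightarrow> real" assume T: "T \<in> borel_measurable (sample_space n)"
  interpret L: product_sigma_finite "\<lambda>_::nat. lborel :: real measure" ..
  define M where "M = (\<Pi>\<^sub>M i\<in>{..<n}. (lborel :: real measure))"
  have "sets M = sets (sample_space n)" unfolding M_def sample_space_def by (intro sets_PiM_cong) auto
  with T have [measurable]: "T \<in> borel_measurable M" by (simp cong: measurable_cong_sets)
  have comp: "(\<lambda>X. X i) \<in> borel_measurable M" if "i < n" for i
    using measurable_component_singleton[of i "{..<n}" "\<lambda>_. lborel :: real measure"] that
    unfolding M_def by simp
  have pm: "(\<lambda>X. \<Prod>i<n. ennreal (f (X i))) \<in> borel_measurable M"
    if "f \<in> borel_measurable borel" for f :: "real \<Rightarrow> real"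
    using that by (intro borel_measurable_prod_ennreal measurable_compose[OF comp]) auto
  have em: "(\<lambda>X. ennreal ((T X - c)\<^sup>2)) \<in> borel_measurable M" for c
    by measurable
  define R where "R = (\<lambda>f. \<integral>\<^sup>+X. ennreal ((T X - \<theta> f)\<^sup>2) \<partial>sample_law n f)"
  have R: "R f = (\<integral>\<^sup>+X. (\<Prod>i<n. ennreal (f (X i))) * ennreal ((T X - \<theta> f)\<^sup>2) \<partial>M)"
    if "f \<in> borel_measurable borel" for f
    unfolding R_def sample_law_eq_density[OF that] M_def[symmetric]
    by (rule nn_integral_density[OF pm[OF that] em])
  define \<Delta> where "\<Delta> = (\<theta> f1 - \<theta> f0)\<^sup>2 / 2"
  have \<Delta>: "0 \<le> \<Delta>" by (simp add: \<Delta>_def)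
  define g where "g = (\<lambda>x. min (ennreal (f0 x)) (ennreal (f1 x)))"
  have [measurable]: "g \<in> borel_measurable borel" unfolding g_def by measurable
  have "ennreal (\<Delta> * p ^ n) = ennreal \<Delta> * ennreal p ^ n"
    using p \<Delta> by (simp add: ennreal_mult ennreal_power)
  also have "\<dots> \<le> ennreal \<Delta> * (\<integral>\<^sup>+x. g x \<partial>lborel) ^ n"
    by (intro mult_left_mono power_mono) (use affinity in \<open>auto simp: g_def\<close>)
  also have "\<dots> = ennreal \<Delta> * (\<integral>\<^sup>+X. (\<Prod>i<n. g (X i)) \<partial>M)"
    unfolding M_def by (subst L.product_nn_integral_prod) auto
  also have "\<dots> = (\<integral>\<^sup>+X. ennreal \<Delta> * (\<Prod>i<n. g (X i)) \<partial>M)"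
    by (intro nn_integral_cmult[symmetric] borel_measurable_prod_ennreal measurable_compose[OF comp]) auto
  also have "\<dots> \<le> (\<integral>\<^sup>+X. (\<Prod>i<n. ennreal (f0 (X i))) * ennreal ((T X - \<theta> f0)\<^sup>2)
        + (\<Prod>i<n. ennreal (f1 (X i))) * ennreal ((T X - \<theta> f1)\<^sup>2) \<partial>M)"
  proof (rule nn_integral_mono)
    fix X
    have "0 \<le> (T X - \<theta> f0 + (T X - \<theta> f1))\<^sup>2" by simp
    then have "\<Delta> \<le> (T X - \<theta> f0)\<^sup>2 + (T X - \<theta> f1)\<^sup>2"
      unfolding \<Delta>_def power2_eq_square by (simp add: field_simps)
    then have "ennreal \<Delta> \<le> ennreal ((T X - \<theta> f0)\<^sup>2) + ennreal ((T X - \<theta> f1)\<^sup>2)"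
      by (metis ennreal_leI ennreal_plus zero_le_power2)
    then have "ennreal \<Delta> * (\<Prod>i<n. g (X i)) \<le>
       (ennreal ((T X - \<theta> f0)\<^sup>2) + ennreal ((T X - \<theta> f1)\<^sup>2)) * (\<Prod>i<n. g (X i))"
      by (rule mult_right_mono) simp
    also have "\<dots> = (\<Prod>i<n. g (X i)) * ennreal ((T X - \<theta> f0)\<^sup>2) + (\<Prod>i<n. g (X i)) * ennreal ((T X - \<theta> f1)\<^sup>2)"
      by (simp add: algebra_simps)
    also have "\<dots> \<le> (\<Prod>i<n. ennreal (f0 (X i))) * ennreal ((T X - \<theta> f0)\<^sup>2)
        + (\<Prod>i<n. ennreal (f1 (X i))) * ennreal ((T X - \<theta> f1)\<^sup>2)"
      by (intro add_mono mult_right_mono prod_mono_ennreal) (auto simp: g_def)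
    finally show "ennreal \<Delta> * (\<Prod>i<n. g (X i)) \<le> (\<Prod>i<n. ennreal (f0 (X i))) * ennreal ((T X - \<theta> f0)\<^sup>2)
        + (\<Prod>i<n. ennreal (f1 (X i))) * ennreal ((T X - \<theta> f1)\<^sup>2)" .
  qed
  also have "\<dots> = R f0 + R f1"
    unfolding R[OF m(1)] R[OF m(2)] by (intro nn_integral_add borel_measurable_times_ennreal pm m em)
  also have "\<dots> \<le> (SUP f\<in>F. R f) + (SUP f\<in>F. R f)"
    using F by (intro add_mono SUP_upper)
  also have "\<dots> = ennreal 2 * (SUP f\<in>F. R f)"
    by (simp add: mult_2)
  finally have *: "ennreal (\<Delta> * p ^ n) \<le> ennreal 2 * (SUP f\<in>F. R f)" .
  have "ennreal ((\<theta> f1 - \<theta> f0)\<^sup>2 / 4 * p ^ n) = ennreal (1/2) * ennreal (\<Delta> * p ^ n)"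
    using p by (subst ennreal_mult[symmetric]) (auto simp: \<Delta>_def)
  also have "\<dots> \<le> ennreal (1/2) * (ennreal 2 * (SUP f\<in>F. R f))"
    using * by (rule mult_left_mono) simp
  also have "\<dots> = (SUP f\<in>F. R f)"
    by (subst mult.assoc[symmetric], subst ennreal_mult[symmetric]) auto
  finally show "ennreal ((\<theta> f1 - \<theta> f0)\<^sup>2 / 4 * p ^ n)
      \<le> (SUP f\<in>F. \<integral>\<^sup>+X. ennreal ((T X - \<theta> f)\<^sup>2) \<partial>sample_law n f)"
    unfolding R_def .
qed

section \<open>Gaussian spectral representation of the null densities\<close>

text \<open>
  The weight with which the waves \<open>e\<^sup>i\<^sup>s\<^sup>u\<close>, under a standard Gaussian envelope in \<open>u\<close>, formally add up
  to a point mass at \<open>\<mu>\<close> to which the heat flow has been applied backwards for time \<open>\<delta>\<close>. For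
  \<open>\<delta> = \<mu> = 0\<close> it is the constant \<open>1 / sqrt (2 \<pi>)\<close>, the Fourier inversion formula for the point mass
  at \<open>0\<close> divided by the value \<open>1 / sqrt (2 \<pi>)\<close> of the envelope there.
\<close>
definition null_spectrum :: "real \<Rightarrow> real \<Rightarrow> real \<Rightarrow> complex" where
  "null_spectrum \<delta> \<mu> s =
     of_real (exp ((\<delta> / (1 + \<delta>)) * s\<^sup>2 / 2 + \<mu>\<^sup>2 / (2 * (1 + \<delta>))) / sqrt (2 * pi * (1 + \<delta>))) *
     iexp (s * (- \<mu> / (1 + \<delta>)))"

lemma gaussian_eq_normal_density:
  assumes "0 < b"
  shows "exp (- b * s\<^sup>2 / 2) = sqrt (2 * pi / b) * normal_density 0 (1 / sqrt b) s"
  using assms by (simp add: normal_density_def power_divide real_sqrt_divide real_sqrt_mult)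

lemma gaussian_fourier:
  assumes b: "0 < b"
  shows "integrable lborel (\<lambda>s. complex_of_real (exp (- b * s\<^sup>2 / 2)) * iexp (s * r))"
    and "(\<integral>s. complex_of_real (exp (- b * s\<^sup>2 / 2)) * iexp (s * r) \<partial>lborel)
       = of_real (sqrt (2 * pi / b) * exp (- r\<^sup>2 / (2 * b)))"
proof -
  have eq: "complex_of_real (exp (- b * s\<^sup>2 / 2)) * iexp (s * r)
      = of_real (sqrt (2 * pi / b)) * (normal_density 0 (1 / sqrt b) s *\<^sub>R iexp (r * s))" for s
    unfolding gaussian_eq_normal_density[OF b] by (simp add: scaleR_conv_of_real mult.commute[of s r])
  have i: "integrable lborel (\<lambda>s. normal_density 0 (1 / sqrt b) s *\<^sub>R iexp (r * s))"
    using b by (intro integrable_iexp_mult) auto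
  show "integrable lborel (\<lambda>s. complex_of_real (exp (- b * s\<^sup>2 / 2)) * iexp (s * r))"
    unfolding eq using i by (rule integrable_mult_right)
  have "(\<integral>s. normal_density 0 (1 / sqrt b) s *\<^sub>R iexp (r * s) \<partial>lborel) = of_real (exp (- r\<^sup>2 / (2 * b)))"
    using b by (subst normal_fourier) (auto simp: power_divide)
  then show "(\<integral>s. complex_of_real (exp (- b * s\<^sup>2 / 2)) * iexp (s * r) \<partial>lborel)
       = of_real (sqrt (2 * pi / b) * exp (- r\<^sup>2 / (2 * b)))"
    unfolding eq integral_mult_right_zero by (simp only: of_real_mult)
qed

text \<open>
  The growth \<open>exp ((\<delta> / (1 + \<delta>)) s\<^sup>2 / 2)\<close> of the weight is beaten by a Gaussian factor with
  \<open>k > \<delta> / (1 + \<delta>)\<close>, which leaves a Gaussian Fourier integral.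
\<close>
lemma null_spectrum_fourier:
  assumes \<delta>: "0 \<le> \<delta>" and k: "\<delta> / (1 + \<delta>) < k"
  defines "b \<equiv> k - \<delta> / (1 + \<delta>)"
  shows "integrable lborel (\<lambda>s. null_spectrum \<delta> \<mu> s * (of_real (exp (- k * s\<^sup>2 / 2)) * iexp (s * r)))"
    and "(\<integral>s. null_spectrum \<delta> \<mu> s * (of_real (exp (- k * s\<^sup>2 / 2)) * iexp (s * r)) \<partial>lborel)
       = of_real (exp (\<mu>\<^sup>2 / (2 * (1 + \<delta>)) - (r - \<mu> / (1 + \<delta>))\<^sup>2 / (2 * b)) / sqrt ((1 + \<delta>) * b))"
proof -
  have b: "0 < b" using k by (simp add: b_def)
  define c where "c = exp (\<mu>\<^sup>2 / (2 * (1 + \<delta>))) / sqrt (2 * pi * (1 + \<delta>))"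
  have eq: "null_spectrum \<delta> \<mu> s * (of_real (exp (- k * s\<^sup>2 / 2)) * iexp (s * r))
      = of_real c * (of_real (exp (- b * s\<^sup>2 / 2)) * iexp (s * (r - \<mu> / (1 + \<delta>))))" for s
  proof -
    have 1: "exp ((\<delta> / (1 + \<delta>)) * s\<^sup>2 / 2 + \<mu>\<^sup>2 / (2 * (1 + \<delta>))) / sqrt (2 * pi * (1 + \<delta>)) * exp (- k * s\<^sup>2 / 2)
        = c * exp (- b * s\<^sup>2 / 2)"
    proof -
      have "d * s\<^sup>2 / 2 + B + - k * s\<^sup>2 / 2 = B + - (k - d) * s\<^sup>2 / 2" for d B :: real
        by (simp add: field_simps)
      moreover have "exp P / q * exp R = exp (P + R) / q" for P q R :: real by (simp add: exp_add)
      ultimately show ?thesis unfolding c_def b_def by metis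
    qed
    have 2: "iexp (s * (- \<mu> / (1 + \<delta>))) * iexp (s * r) = iexp (s * (r - \<mu> / (1 + \<delta>)))"
      unfolding exp_add[symmetric] by (simp add: algebra_simps)
    have "null_spectrum \<delta> \<mu> s * (of_real (exp (- k * s\<^sup>2 / 2)) * iexp (s * r))
      = of_real (exp ((\<delta> / (1 + \<delta>)) * s\<^sup>2 / 2 + \<mu>\<^sup>2 / (2 * (1 + \<delta>))) / sqrt (2 * pi * (1 + \<delta>)) * exp (- k * s\<^sup>2 / 2))
        * (iexp (s * (- \<mu> / (1 + \<delta>))) * iexp (s * r))"
      unfolding null_spectrum_def of_real_mult by (simp only: mult_ac)
    then show ?thesis unfolding 1 2 by (simp only: of_real_mult mult.assoc)
  qed
  show "integrable lborel (\<lambda>s. null_spectrum \<delta> \<mu> s * (of_real (exp (- k * s\<^sup>2 / 2)) * iexp (s * r)))"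
    unfolding eq using gaussian_fourier(1)[OF b] by (rule integrable_mult_right)
  have "c * (sqrt (2 * pi / b) * exp (- (r - \<mu> / (1 + \<delta>))\<^sup>2 / (2 * b)))
     = exp (\<mu>\<^sup>2 / (2 * (1 + \<delta>)) - (r - \<mu> / (1 + \<delta>))\<^sup>2 / (2 * b)) / sqrt ((1 + \<delta>) * b)"
  proof -
    have "exp P / sqrt (2 * pi * \<eta>) * (sqrt (2 * pi / b) * exp (- Y / Z)) = exp (P - Y / Z) / sqrt (\<eta> * b)"
      if "0 < \<eta>" for P Y Z \<eta> :: real
      using that b by (simp add: exp_diff exp_minus real_sqrt_divide real_sqrt_mult divide_inverse real_sqrt_inverse) (simp add: field_simps)
    then show ?thesis unfolding c_def using \<delta> by simp
  qed
  then show "(\<integral>s. null_spectrum \<delta> \<mu> s * (of_real (exp (- k * s\<^sup>2 / 2)) * iexp (s * r)) \<partial>lborel)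
       = of_real (exp (\<mu>\<^sup>2 / (2 * (1 + \<delta>)) - (r - \<mu> / (1 + \<delta>))\<^sup>2 / (2 * b)) / sqrt ((1 + \<delta>) * b))"
    unfolding eq integral_mult_right_zero gaussian_fourier(2)[OF b] by (simp only: of_real_mult[symmetric])
qed

text \<open>
  The formal point mass has total mass one. Hence a difference of two such weights has vanishing
  integral against \<open>exp (- s\<^sup>2 / 2)\<close>, and centring the waves costs nothing except for the truncation.
\<close>
lemma null_spectrum_mass:
  assumes \<delta>: "0 \<le> \<delta>"
  shows "integrable lborel (\<lambda>s. null_spectrum \<delta> \<mu> s * of_real (exp (- s\<^sup>2 / 2)))"
    and "(\<integral>s. null_spectrum \<delta> \<mu> s * of_real (exp (- s\<^sup>2 / 2)) \<partial>lborel) = 1"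
proof -
  have k: "\<delta> / (1 + \<delta>) < 1" using \<delta> by (simp add: field_simps)
  have b: "1 - \<delta> / (1 + \<delta>) = 1 / (1 + \<delta>)" using \<delta> by (simp add: field_simps)
  show "integrable lborel (\<lambda>s. null_spectrum \<delta> \<mu> s * of_real (exp (- s\<^sup>2 / 2)))"
    using null_spectrum_fourier(1)[OF \<delta> k, of \<mu> 0] by simp
  have "\<mu>\<^sup>2 / (2 * \<eta>) - (0 - \<mu> / \<eta>)\<^sup>2 / (2 * (1 / \<eta>)) = 0" if "0 < \<eta>" for \<eta> :: real
    using that by (simp add: power_divide power2_eq_square)
  from this[of "1 + \<delta>"] \<delta>
  have "\<mu>\<^sup>2 / (2 * (1 + \<delta>)) - (0 - \<mu> / (1 + \<delta>))\<^sup>2 / (2 * (1 / (1 + \<delta>))) = 0" by simp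
  moreover have "(1 + \<delta>) * (1 / (1 + \<delta>)) = 1" using \<delta> by simp
  ultimately show "(\<integral>s. null_spectrum \<delta> \<mu> s * of_real (exp (- s\<^sup>2 / 2)) \<partial>lborel) = 1"
    using null_spectrum_fourier(2)[OF \<delta> k, of \<mu> 0, unfolded b] by simp
qed

text \<open>
  Convolving the formal superposition with the Gaussian of variance \<open>S = a\<^sup>2 + \<delta>\<close> turns it into the
  normal density with mean \<open>\<mu>\<close> and variance \<open>S - \<delta> = a\<^sup>2\<close>: each wave is damped according to
  \<open>normal_smoothing_of_wave\<close>, and the damped integral converges because
  \<open>S / (1 + S) - \<delta> / (1 + \<delta>) = a\<^sup>2 / ((1 + S) (1 + \<delta>)) > 0\<close>.
\<close>
lemma normal_density_spectral:
  assumes a: "0 < a" and \<delta>: "0 \<le> \<delta>"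
  defines "S \<equiv> a\<^sup>2 + \<delta>"
  shows "integrable lborel (\<lambda>s. null_spectrum \<delta> \<mu> s * (of_real (exp (- (S / (1 + S)) * s\<^sup>2 / 2)) * iexp (s * (x / (1 + S)))))"
    and "of_real (normal_density 0 (sqrt (1 + S)) x) *
       (\<integral>s. null_spectrum \<delta> \<mu> s * (of_real (exp (- (S / (1 + S)) * s\<^sup>2 / 2)) * iexp (s * (x / (1 + S)))) \<partial>lborel)
     = of_real (normal_density \<mu> a x)"
proof -
  define D where "D = 1 + S"
  define \<eta> where "\<eta> = 1 + \<delta>"
  define b where "b = S / D - \<delta> / \<eta>"
  have \<eta>: "0 < \<eta>" using \<delta> by (simp add: \<eta>_def)
  have Deq: "D = a\<^sup>2 + \<eta>" by (simp add: D_def S_def \<eta>_def)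
  have D: "0 < D" using a \<eta> unfolding Deq by (simp add: add_pos_pos)
  have bb: "b = a\<^sup>2 / (D * \<eta>)"
  proof -
    have "b = (S * \<eta> - \<delta> * D) / (D * \<eta>)" unfolding b_def using D \<eta> by (simp add: field_simps)
    also have "S * \<eta> - \<delta> * D = a\<^sup>2" by (simp add: S_def D_def \<eta>_def algebra_simps)
    finally show ?thesis .
  qed
  have b: "0 < b" using a D \<eta> by (simp add: bb)
  then have k: "\<delta> / (1 + \<delta>) < S / (1 + S)" by (simp add: b_def D_def \<eta>_def)
  show "integrable lborel (\<lambda>s. null_spectrum \<delta> \<mu> s * (of_real (exp (- (S / (1 + S)) * s\<^sup>2 / 2)) * iexp (s * (x / (1 + S)))))"
    by (rule null_spectrum_fourier(1)[OF \<delta> k])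
  \<comment> \<open>completing the square in \<open>x\<close>, with \<open>D = a\<^sup>2 + \<eta>\<close>\<close>
  have e: "- (x\<^sup>2 / (2 * D)) + (\<mu>\<^sup>2 / (2 * \<eta>) - (x / D - \<mu> / \<eta>)\<^sup>2 / (2 * b)) = - ((x - \<mu>)\<^sup>2 / (2 * a\<^sup>2))"
  proof -
    have 1: "(x / D - \<mu> / \<eta>)\<^sup>2 / (2 * b) = (x * \<eta> - \<mu> * D)\<^sup>2 / (2 * a\<^sup>2 * D * \<eta>)"
      unfolding bb using D \<eta> a by (simp add: divide_simps) (simp add: power2_eq_square algebra_simps)
    have 2: "(x * \<eta> - \<mu> * D)\<^sup>2 + x\<^sup>2 * a\<^sup>2 * \<eta> - \<mu>\<^sup>2 * a\<^sup>2 * D = (x - \<mu>)\<^sup>2 * D * \<eta>"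
      unfolding Deq by (simp add: power2_eq_square algebra_simps)
    show ?thesis unfolding 1 using D \<eta> a arg_cong[OF 2, of "\<lambda>z. z / (2 * a\<^sup>2 * D * \<eta>)"]
      by (simp add: add_divide_distrib diff_divide_distrib)
  qed
  have s: "sqrt (2 * pi * (sqrt D)\<^sup>2) * sqrt (\<eta> * b) = sqrt (2 * pi * a\<^sup>2)"
    unfolding bb real_sqrt_mult[symmetric] using D \<eta> by simp
  have "normal_density 0 (sqrt D) x * (exp (\<mu>\<^sup>2 / (2 * \<eta>) - (x / D - \<mu> / \<eta>)\<^sup>2 / (2 * b)) / sqrt (\<eta> * b))
      = exp (- (x\<^sup>2 / (2 * D)) + (\<mu>\<^sup>2 / (2 * \<eta>) - (x / D - \<mu> / \<eta>)\<^sup>2 / (2 * b))) / (sqrt (2 * pi * (sqrt D)\<^sup>2) * sqrt (\<eta> * b))"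
    unfolding normal_density_def exp_add using D by simp
  also have "\<dots> = normal_density \<mu> a x"
    unfolding e s normal_density_def by simp
  finally have "of_real (normal_density 0 (sqrt D) x) * of_real (exp (\<mu>\<^sup>2 / (2 * \<eta>) - (x / D - \<mu> / \<eta>)\<^sup>2 / (2 * b)) / sqrt (\<eta> * b))
      = complex_of_real (normal_density \<mu> a x)" by (simp only: of_real_mult[symmetric])
  then show "of_real (normal_density 0 (sqrt (1 + S)) x) *
       (\<integral>s. null_spectrum \<delta> \<mu> s * (of_real (exp (- (S / (1 + S)) * s\<^sup>2 / 2)) * iexp (s * (x / (1 + S)))) \<partial>lborel)
     = of_real (normal_density \<mu> a x)"
    using null_spectrum_fourier(2)[OF \<delta> k, of \<mu> "x / (1 + S)"]
    by (simp only: b_def D_def \<eta>_def)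
qed

text \<open>
  Completing the square in \<open>u\<close>: the joint density of a Gaussian prior and a Gaussian observation
  factors into marginal and posterior.
\<close>
lemma normal_density_product:
  assumes S: "0 < S"
  shows "normal_density u (sqrt S) x * std_normal_density u
     = normal_density 0 (sqrt (1 + S)) x * normal_density (x / (1 + S)) (sqrt (S / (1 + S))) u"
proof -
  have e: "- (x - u)\<^sup>2 / (2 * S) + - u\<^sup>2 / 2 = - x\<^sup>2 / (2 * (1 + S)) + - (u - x / (1 + S))\<^sup>2 / (2 * (S / (1 + S)))"
  proof -
    have p: "1 + S > 0" using S by simp
    have 1: "(u - x / (1 + S))\<^sup>2 / (2 * (S / (1 + S))) = ((1 + S) * u - x)\<^sup>2 / (2 * S * (1 + S))"
      using S p by (simp add: divide_simps) (simp add: power2_eq_square algebra_simps)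
    have 2: "(x - u)\<^sup>2 * (1 + S) + u\<^sup>2 * S * (1 + S) = x\<^sup>2 * S + ((1 + S) * u - x)\<^sup>2"
      by (simp add: power2_eq_square algebra_simps)
    show ?thesis unfolding minus_divide_left[symmetric] 1
      using S p arg_cong[OF 2, of "\<lambda>z. - z / (2 * S * (1 + S))"]
      by (simp add: add_divide_distrib diff_divide_distrib)
  qed
  have s: "sqrt (2 * pi * S) * sqrt (2 * pi) = sqrt (2 * pi * (1 + S)) * sqrt (2 * pi * (S / (1 + S)))"
    unfolding real_sqrt_mult[symmetric] using S by (simp add: field_simps)
  have "normal_density u (sqrt S) x * std_normal_density u
     = exp (- (x - u)\<^sup>2 / (2 * S) + - u\<^sup>2 / 2) / (sqrt (2 * pi * S) * sqrt (2 * pi))"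
    unfolding normal_density_def exp_add using S by simp
  also have "\<dots> = normal_density 0 (sqrt (1 + S)) x * normal_density (x / (1 + S)) (sqrt (S / (1 + S))) u"
    unfolding e s unfolding normal_density_def exp_add using S by simp
  finally show ?thesis .
qed

lemma normal_smoothing_of_wave:
  assumes S: "0 < S"
  shows "integrable lborel (\<lambda>u. (normal_density u (sqrt S) x * std_normal_density u) *\<^sub>R iexp (s * u))"
    and "(\<integral>u. (normal_density u (sqrt S) x * std_normal_density u) *\<^sub>R iexp (s * u) \<partial>lborel)
     = of_real (normal_density 0 (sqrt (1 + S)) x) * (of_real (exp (- (S / (1 + S)) * s\<^sup>2 / 2)) * iexp (s * (x / (1 + S))))"
proof -
  have p: "0 < sqrt (S / (1 + S))" using S by simp
  show "integrable lborel (\<lambda>u. (normal_density u (sqrt S) x * std_normal_density u) *\<^sub>R iexp (s * u))"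
    unfolding normal_density_product[OF S] using p
    by (intro integrable_iexp_mult integrable_mult_right) auto
  have "(\<integral>u. (normal_density u (sqrt S) x * std_normal_density u) *\<^sub>R iexp (s * u) \<partial>lborel)
     = of_real (normal_density 0 (sqrt (1 + S)) x) *
        (\<integral>u. normal_density (x / (1 + S)) (sqrt (S / (1 + S))) u *\<^sub>R iexp (s * u) \<partial>lborel)"
    unfolding normal_density_product[OF S] scaleR_scaleR[symmetric]
    by (simp only: scaleR_conv_of_real integral_mult_right_zero)
  then show "(\<integral>u. (normal_density u (sqrt S) x * std_normal_density u) *\<^sub>R iexp (s * u) \<partial>lborel)
     = of_real (normal_density 0 (sqrt (1 + S)) x) * (of_real (exp (- (S / (1 + S)) * s\<^sup>2 / 2)) * iexp (s * (x / (1 + S))))"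
    unfolding normal_fourier[OF p] using S by (simp add: mult.commute)
qed

section \<open>Normal densities tilted by waves\<close>

text \<open>
  Subtracting \<open>exp (- s\<^sup>2 / 2)\<close>, the mean of \<open>e\<^sup>i\<^sup>s\<^sup>u\<close> under the standard normal law, makes every tilt
  orthogonal to constants, so that tilting preserves total mass.
\<close>
definition wave_tilt :: "(real \<Rightarrow> complex) \<Rightarrow> real \<Rightarrow> complex" where
  "wave_tilt W u = (\<integral>s. W s * (iexp (s * u) - of_real (exp (- s\<^sup>2 / 2))) \<partial>lborel)"

definition tilted_normal :: "(real \<Rightarrow> complex) \<Rightarrow> real \<Rightarrow> real" where
  "tilted_normal W u = std_normal_density u * (1 + Re (wave_tilt W u))"

lemma centred_wave_bound: "cmod (iexp (s * u) - of_real (exp (- s\<^sup>2 / 2))) \<le> 2"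
proof -
  have "cmod (of_real (exp (- s\<^sup>2 / 2))) \<le> 1" unfolding norm_of_real by simp
  moreover have "cmod (iexp (s * u)) = 1" by simp
  ultimately show ?thesis
    using norm_triangle_ineq4[of "iexp (s * u)" "of_real (exp (- s\<^sup>2 / 2))"] by linarith
qed

lemma integrable_wave_tilt:
  assumes "integrable lborel W"
  shows "integrable lborel (\<lambda>s. W s * (iexp (s * u) - of_real (exp (- s\<^sup>2 / 2))))"
proof (rule Bochner_Integration.integrable_bound)
  show "integrable lborel (\<lambda>s. 2 * norm (W s))" using assms by auto
  show "(\<lambda>s. W s * (iexp (s * u) - of_real (exp (- s\<^sup>2 / 2)))) \<in> borel_measurable lborel"
    using assms by measurable
  show "AE s in lborel. norm (W s * (iexp (s * u) - of_real (exp (- s\<^sup>2 / 2)))) \<le> norm (2 * norm (W s))"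
    using mult_left_mono[OF centred_wave_bound norm_ge_zero]
    by (auto simp: norm_mult mult.commute[of 2] simp del: of_real_mult of_real_exp)
qed

lemma wave_tilt_bound:
  assumes "integrable lborel W"
  shows "cmod (wave_tilt W u) \<le> 2 * (\<integral>s. cmod (W s) \<partial>lborel)"
proof -
  have "cmod (wave_tilt W u) \<le> (\<integral>s. cmod (W s * (iexp (s * u) - of_real (exp (- s\<^sup>2 / 2)))) \<partial>lborel)"
    unfolding wave_tilt_def by (rule integral_norm_bound)
  also have "\<dots> \<le> (\<integral>s. 2 * cmod (W s) \<partial>lborel)"
  proof (rule integral_mono)
    show "integrable lborel (\<lambda>s. cmod (W s * (iexp (s * u) - of_real (exp (- s\<^sup>2 / 2)))))"
      by (rule integrable_norm[OF integrable_wave_tilt[OF assms]])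
    show "integrable lborel (\<lambda>s. 2 * cmod (W s))" using assms by auto
    show "cmod (W s * (iexp (s * u) - of_real (exp (- s\<^sup>2 / 2)))) \<le> 2 * cmod (W s)" for s
      using mult_left_mono[OF centred_wave_bound[of s u] norm_ge_zero[of "W s"]]
      by (simp add: norm_mult mult.commute del: of_real_mult of_real_exp)
  qed
  finally show ?thesis by simp
qed

lemma measurable_wave_tilt [measurable]:
  assumes "integrable lborel W"
  shows "wave_tilt W \<in> borel_measurable borel"
proof -
  have [measurable]: "W \<in> borel_measurable borel" using assms by auto
  have "(\<lambda>(u, s). W s * (iexp (s * u) - of_real (exp (- s\<^sup>2 / 2)))) \<in> borel_measurable (borel \<Otimes>\<^sub>M lborel)"
    by measurable
  then show ?thesis unfolding wave_tilt_def[abs_def]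
    by (rule lborel.borel_measurable_lebesgue_integral)
qed

lemma integrable_times_wave_tilt:
  fixes \<psi> :: "real \<Rightarrow> complex"
  assumes W: "integrable lborel W" and \<psi>: "integrable lborel \<psi>"
  shows "integrable lborel (\<lambda>u. \<psi> u * wave_tilt W u)"
proof (rule Bochner_Integration.integrable_bound)
  show "integrable lborel (\<lambda>u. (2 * (\<integral>s. cmod (W s) \<partial>lborel)) * norm (\<psi> u))" using \<psi> by auto
  show "(\<lambda>u. \<psi> u * wave_tilt W u) \<in> borel_measurable lborel"
    using \<psi> measurable_wave_tilt[OF W] by measurable
  show "AE u in lborel. norm (\<psi> u * wave_tilt W u) \<le> norm ((2 * (\<integral>s. cmod (W s) \<partial>lborel)) * norm (\<psi> u))"
  proof (rule AE_I2)
    fix u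
    have "0 \<le> 2 * (\<integral>s. cmod (W s) \<partial>lborel)" by simp
    then show "norm (\<psi> u * wave_tilt W u) \<le> norm ((2 * (\<integral>s. cmod (W s) \<partial>lborel)) * norm (\<psi> u))"
      using mult_right_mono[OF wave_tilt_bound[OF W, of u] norm_ge_zero[of "\<psi> u"]]
      by (simp add: norm_mult abs_mult mult.commute)
  qed
qed

text \<open>
  Fubini, in the one form from which the mass, the Gaussian convolution and the Fourier transform of a
  tilted normal density are all read off.
\<close>
lemma integral_times_wave_tilt:
  fixes \<psi> :: "real \<Rightarrow> complex"
  assumes W: "integrable lborel W" and \<psi>: "integrable lborel \<psi>"
  shows "(\<integral>u. \<psi> u * wave_tilt W u \<partial>lborel) =
    (\<integral>s. W s * ((\<integral>u. \<psi> u * iexp (s * u) \<partial>lborel) - of_real (exp (- s\<^sup>2 / 2)) * (\<integral>u. \<psi> u \<partial>lborel)) \<partial>lborel)"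
proof -
  have [measurable]: "W \<in> borel_measurable borel" "\<psi> \<in> borel_measurable borel" using W \<psi> by auto
  define K where "K = (\<lambda>s u. iexp (s * u) - complex_of_real (exp (- s\<^sup>2 / 2)))"
  have "(\<lambda>p. K (snd p) (fst p)) \<in> borel_measurable (lborel \<Otimes>\<^sub>M lborel)"
    unfolding K_def by measurable
  then have m: "(\<lambda>(u, s). \<psi> u * (W s * K s u)) \<in> borel_measurable (lborel \<Otimes>\<^sub>M lborel)"
    unfolding split_beta by measurable
  have K: "cmod (K s u) \<le> 2" for s u unfolding K_def by (rule centred_wave_bound)
  have IW: "integrable lborel (\<lambda>s. W s * K s u)" for u
    unfolding K_def by (rule integrable_wave_tilt[OF W])
  have int: "integrable (lborel \<Otimes>\<^sub>M lborel) (\<lambda>(u, s). \<psi> u * (W s * K s u))"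
  proof (rule lborel_pair.Fubini_integrable[OF m])
    show "integrable lborel (\<lambda>u. \<integral>s. norm (case (u, s) of (u, s) \<Rightarrow> \<psi> u * (W s * K s u)) \<partial>lborel)"
    proof (rule Bochner_Integration.integrable_bound)
      show "integrable lborel (\<lambda>u. (2 * (\<integral>s. cmod (W s) \<partial>lborel)) * norm (\<psi> u))" using \<psi> by auto
      show "(\<lambda>u. \<integral>s. norm (case (u, s) of (u, s) \<Rightarrow> \<psi> u * (W s * K s u)) \<partial>lborel) \<in> borel_measurable lborel"
        using m by (intro lborel.borel_measurable_lebesgue_integral) (simp add: split_beta)
      show "AE u in lborel. norm (\<integral>s. norm (case (u, s) of (u, s) \<Rightarrow> \<psi> u * (W s * K s u)) \<partial>lborel)
          \<le> norm ((2 * (\<integral>s. cmod (W s) \<partial>lborel)) * norm (\<psi> u))"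
      proof (rule AE_I2)
        fix u
        have le: "(\<integral>s. cmod (W s * K s u) \<partial>lborel) \<le> (\<integral>s. 2 * cmod (W s) \<partial>lborel)"
        proof (rule integral_mono)
          show "integrable lborel (\<lambda>s. cmod (W s * K s u))" by (rule integrable_norm[OF IW])
          show "integrable lborel (\<lambda>s. 2 * cmod (W s))" using W by auto
          show "cmod (W s * K s u) \<le> 2 * cmod (W s)" for s
            using mult_left_mono[OF K[of s u] norm_ge_zero[of "W s"]] by (simp add: norm_mult mult.commute)
        qed
        moreover have "(\<integral>s. norm (case (u, s) of (u, s) \<Rightarrow> \<psi> u * (W s * K s u)) \<partial>lborel)
            = norm (\<psi> u) * (\<integral>s. cmod (W s * K s u) \<partial>lborel)"
          by (simp only: prod.case norm_mult[of "\<psi> u"] integral_mult_right_zero)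
        ultimately
        show "norm (\<integral>s. norm (case (u, s) of (u, s) \<Rightarrow> \<psi> u * (W s * K s u)) \<partial>lborel)
          \<le> norm ((2 * (\<integral>s. cmod (W s) \<partial>lborel)) * norm (\<psi> u))"
          using mult_left_mono[OF le norm_ge_zero[of "\<psi> u"]] by (simp add: abs_mult mult_ac)
      qed
    qed
    show "AE u in lborel. integrable lborel (\<lambda>s. case (u, s) of (u, s) \<Rightarrow> \<psi> u * (W s * K s u))"
      using IW by (auto intro!: AE_I2)
  qed
  have "(\<integral>u. \<psi> u * wave_tilt W u \<partial>lborel) = (\<integral>u. (\<integral>s. \<psi> u * (W s * K s u) \<partial>lborel) \<partial>lborel)"
    unfolding wave_tilt_def K_def by (simp only: integral_mult_right_zero)
  also have "\<dots> = (\<integral>s. (\<integral>u. \<psi> u * (W s * K s u) \<partial>lborel) \<partial>lborel)"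
    using lborel_pair.Fubini_integral[OF int] by simp
  also have "\<dots> = (\<integral>s. W s * ((\<integral>u. \<psi> u * iexp (s * u) \<partial>lborel) - of_real (exp (- s\<^sup>2 / 2)) * (\<integral>u. \<psi> u \<partial>lborel)) \<partial>lborel)"
  proof (rule Bochner_Integration.integral_cong[OF refl])
    fix s
    have i: "integrable lborel (\<lambda>u. \<psi> u * iexp (s * u))"
      by (rule Bochner_Integration.integrable_bound[OF \<psi>]) (auto simp: norm_mult)
    have "(\<integral>u. \<psi> u * (W s * K s u) \<partial>lborel) = W s * (\<integral>u. \<psi> u * iexp (s * u) - of_real (exp (- s\<^sup>2 / 2)) * \<psi> u \<partial>lborel)"
      unfolding K_def integral_mult_right_zero[symmetric]
      by (rule Bochner_Integration.integral_cong[OF refl]) (simp add: algebra_simps)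
    also have "(\<integral>u. \<psi> u * iexp (s * u) - of_real (exp (- s\<^sup>2 / 2)) * \<psi> u \<partial>lborel)
       = (\<integral>u. \<psi> u * iexp (s * u) \<partial>lborel) - of_real (exp (- s\<^sup>2 / 2)) * (\<integral>u. \<psi> u \<partial>lborel)"
      using i \<psi> by (subst Bochner_Integration.integral_diff) (auto simp only: integral_mult_right_zero intro: integrable_mult_right)
    finally show "(\<integral>u. \<psi> u * (W s * K s u) \<partial>lborel)
      = W s * ((\<integral>u. \<psi> u * iexp (s * u) \<partial>lborel) - of_real (exp (- s\<^sup>2 / 2)) * (\<integral>u. \<psi> u \<partial>lborel))" .
  qed
  finally show ?thesis .
qed

text \<open>
  Reflecting the weight conjugates the tilt. This expresses the real part, which defines
  the density, through the tilts by two weights, to which Fubini applies separately.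
\<close>
lemma cnj_wave_tilt: "cnj (wave_tilt W u) = wave_tilt (\<lambda>s. cnj (W (- s))) u"
proof -
  have "cnj (wave_tilt W u) = (\<integral>s. cnj (W s * (iexp (s * u) - of_real (exp (- s\<^sup>2 / 2)))) \<partial>lborel)"
    unfolding wave_tilt_def by (rule Bochner_Integration.integral_cnj[symmetric])
  also have "\<dots> = \<bar>- 1 :: real\<bar> *\<^sub>R (\<integral>s. cnj (W (0 + - 1 * s) * (iexp ((0 + - 1 * s) * u) - of_real (exp (- (0 + - 1 * s)\<^sup>2 / 2)))) \<partial>lborel)"
    by (rule lborel_integral_real_affine) simp
  also have "\<dots> = wave_tilt (\<lambda>s. cnj (W (- s))) u"
    by (simp add: wave_tilt_def exp_cnj)
  finally show ?thesis .
qed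

lemma tilted_normal_eq:
  "complex_of_real (tilted_normal W u) = of_real (std_normal_density u) +
     (of_real (std_normal_density u) * wave_tilt W u + of_real (std_normal_density u) * wave_tilt (\<lambda>s. cnj (W (- s))) u) / 2"
  unfolding cnj_wave_tilt[symmetric] tilted_normal_def
  by (simp add: distrib_left[symmetric] complex_add_cnj del: distrib_left_numeral) (simp add: algebra_simps)

lemma integrable_reflect_cnj:
  assumes "integrable lborel (W :: real \<Rightarrow> complex)"
  shows "integrable lborel (\<lambda>s. cnj (W (- s)))"
  using lborel_integrable_real_affine[OF assms, of "-1" 0] by simp

lemma std_normal_fourier:
  "integrable lborel (\<lambda>u. complex_of_real (std_normal_density u) * iexp (t * u))"
  "(\<integral>u. complex_of_real (std_normal_density u) * iexp (t * u) \<partial>lborel) = of_real (exp (- t\<^sup>2 / 2))"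
  using integrable_iexp_mult[of std_normal_density t] normal_fourier[of 1 0 t]
  by (simp_all add: scaleR_conv_of_real)

lemma tilted_normal_bounds:
  assumes W: "integrable lborel W" and \<kappa>: "2 * (\<integral>s. cmod (W s) \<partial>lborel) \<le> \<kappa>"
  shows "tilted_normal W u \<le> (1 + \<kappa>) * std_normal_density u"
    and "\<kappa> \<le> 1 \<Longrightarrow> 0 \<le> tilted_normal W u"
proof -
  have "\<bar>Re (wave_tilt W u)\<bar> \<le> \<kappa>"
    using abs_Re_le_cmod[of "wave_tilt W u"] wave_tilt_bound[OF W, of u] \<kappa> by linarith
  then have "1 + Re (wave_tilt W u) \<le> 1 + \<kappa>" "\<kappa> \<le> 1 \<Longrightarrow> 0 \<le> 1 + Re (wave_tilt W u)" by auto
  then show "tilted_normal W u \<le> (1 + \<kappa>) * std_normal_density u" "\<kappa> \<le> 1 \<Longrightarrow> 0 \<le> tilted_normal W u"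
    unfolding tilted_normal_def by (auto intro!: mult_left_mono mult_nonneg_nonneg simp: mult.commute[of "1 + \<kappa>"] simp del: distrib_left_numeral)
qed

lemma Re_integral_times_wave_tilt:
  fixes w :: "real \<Rightarrow> real"
  assumes W: "integrable lborel W" and w: "integrable lborel (\<lambda>u. w u * std_normal_density u)"
  shows "integrable lborel (\<lambda>u. w u * tilted_normal W u)"
    and "(\<integral>u. w u * tilted_normal W u \<partial>lborel) = (\<integral>u. w u * std_normal_density u \<partial>lborel) +
     Re (\<integral>s. W s * ((\<integral>u. (w u * std_normal_density u) *\<^sub>R iexp (s * u) \<partial>lborel)
         - of_real (exp (- s\<^sup>2 / 2) * (\<integral>u. w u * std_normal_density u \<partial>lborel))) \<partial>lborel)"
proof -
  define \<psi> where "\<psi> = (\<lambda>u. complex_of_real (w u * std_normal_density u))"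
  have \<psi>: "integrable lborel \<psi>" unfolding \<psi>_def using w by (rule integrable_of_real)
  note i = integrable_times_wave_tilt[OF W \<psi>]
  have eq: "w u * tilted_normal W u = w u * std_normal_density u + Re (\<psi> u * wave_tilt W u)" for u
    unfolding tilted_normal_def \<psi>_def by (simp add: algebra_simps)
  show "integrable lborel (\<lambda>u. w u * tilted_normal W u)"
    unfolding eq by (intro Bochner_Integration.integrable_add w integrable_Re i)
  have "(\<integral>u. w u * tilted_normal W u \<partial>lborel)
     = (\<integral>u. w u * std_normal_density u \<partial>lborel) + Re (\<integral>u. \<psi> u * wave_tilt W u \<partial>lborel)"
    unfolding eq integral_Re[OF i, symmetric]
    by (rule Bochner_Integration.integral_add[OF w integrable_Re[OF i]])
  then show "(\<integral>u. w u * tilted_normal W u \<partial>lborel) = (\<integral>u. w u * std_normal_density u \<partial>lborel) +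
     Re (\<integral>s. W s * ((\<integral>u. (w u * std_normal_density u) *\<^sub>R iexp (s * u) \<partial>lborel)
         - of_real (exp (- s\<^sup>2 / 2) * (\<integral>u. w u * std_normal_density u \<partial>lborel))) \<partial>lborel)"
    unfolding integral_times_wave_tilt[OF W \<psi>] unfolding \<psi>_def integral_complex_of_real scaleR_conv_of_real
    by (simp only: of_real_mult)
qed

lemma integral_tilted_normal:
  assumes W: "integrable lborel W"
  shows "integrable lborel (tilted_normal W)" "(\<integral>u. tilted_normal W u \<partial>lborel) = 1"
proof -
  have 1: "integrable lborel (\<lambda>u. 1 * std_normal_density u)" by simp
  show "integrable lborel (tilted_normal W)"
    using Re_integral_times_wave_tilt(1)[OF W 1] by simp
  show "(\<integral>u. tilted_normal W u \<partial>lborel) = 1"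
    using Re_integral_times_wave_tilt(2)[OF W 1] std_normal_fourier(2)
    by (simp add: scaleR_conv_of_real del: of_real_mult of_real_exp)
qed

lemma normal_smoothing_of_tilted_normal:
  assumes W: "integrable lborel W" and S: "0 < S"
  defines "wave \<equiv> \<lambda>x s. complex_of_real (exp (- (S / (1 + S)) * s\<^sup>2 / 2)) * iexp (s * (x / (1 + S)))"
  shows "(\<integral>u. normal_density u (sqrt S) x * tilted_normal W u \<partial>lborel) =
     normal_density 0 (sqrt (1 + S)) x * (1 + Re (\<integral>s. W s * (wave x s - of_real (exp (- s\<^sup>2 / 2))) \<partial>lborel))"
proof -
  define N where "N = normal_density 0 (sqrt (1 + S)) x"
  have 1: "integrable lborel (\<lambda>u. normal_density u (sqrt S) x * std_normal_density u)"
    unfolding normal_density_product[OF S] using S by auto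
  have 2: "(\<integral>u. normal_density u (sqrt S) x * std_normal_density u \<partial>lborel) = N"
    unfolding normal_density_product[OF S] N_def using S by simp
  have "(\<integral>u. normal_density u (sqrt S) x * tilted_normal W u \<partial>lborel) = N +
     Re (\<integral>s. W s * (of_real N * wave x s - of_real (exp (- s\<^sup>2 / 2) * N)) \<partial>lborel)"
    unfolding Re_integral_times_wave_tilt(2)[OF W 1] 2 normal_smoothing_of_wave(2)[OF S] wave_def N_def ..
  also have "(\<lambda>s. W s * (of_real N * wave x s - of_real (exp (- s\<^sup>2 / 2) * N)))
      = (\<lambda>s. of_real N * (W s * (wave x s - of_real (exp (- s\<^sup>2 / 2)))))"
    by (rule ext) (simp add: algebra_simps)
  finally show ?thesis unfolding integral_mult_right_zero N_def[symmetric]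
    by (simp add: algebra_simps)
qed

text \<open>
  The transform of \<open>e\<^sup>i\<^sup>s\<^sup>u\<close> under the standard Gaussian envelope is the Gaussian bump centred at \<open>- s\<close>.
\<close>
lemma tilted_normal_fourier:
  assumes W: "integrable lborel W"
  defines "\<Psi> \<equiv> \<lambda>V t. \<integral>s. V s * of_real (exp (- (t + s)\<^sup>2 / 2) - exp (- t\<^sup>2 / 2) * exp (- s\<^sup>2 / 2)) \<partial>lborel"
  shows "(\<integral>u. iexp (t * u) * complex_of_real (tilted_normal W u) \<partial>lborel)
     = of_real (exp (- t\<^sup>2 / 2)) + (\<Psi> W t + \<Psi> (\<lambda>s. cnj (W (- s))) t) / 2"
proof -
  define \<psi> where "\<psi> = (\<lambda>u. complex_of_real (std_normal_density u) * iexp (t * u))"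
  have \<psi>: "integrable lborel \<psi>" unfolding \<psi>_def by (rule std_normal_fourier)
  note W' = integrable_reflect_cnj[OF W]
  have *: "(\<integral>u. \<psi> u * wave_tilt V u \<partial>lborel) = \<Psi> V t" if V: "integrable lborel V" for V
  proof -
    have "\<psi> u * iexp (s * u) = complex_of_real (std_normal_density u) * iexp ((t + s) * u)" for u s
      unfolding \<psi>_def mult.assoc exp_add[symmetric] by (simp add: algebra_simps)
    then have "(\<integral>u. \<psi> u * iexp (s * u) \<partial>lborel) = of_real (exp (- (t + s)\<^sup>2 / 2))" for s
      by (simp only: std_normal_fourier(2))
    then show ?thesis unfolding integral_times_wave_tilt[OF V \<psi>] \<Psi>_def
      unfolding \<psi>_def std_normal_fourier(2)
      by (simp only: of_real_diff of_real_mult mult.commute)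
  qed
  have "iexp (t * u) * complex_of_real (tilted_normal W u)
     = \<psi> u + (\<psi> u * wave_tilt W u + \<psi> u * wave_tilt (\<lambda>s. cnj (W (- s))) u) / 2" for u
    unfolding tilted_normal_eq \<psi>_def by (simp add: algebra_simps add_divide_distrib)
  then have "(\<integral>u. iexp (t * u) * complex_of_real (tilted_normal W u) \<partial>lborel)
     = (\<integral>u. \<psi> u + (\<psi> u * wave_tilt W u + \<psi> u * wave_tilt (\<lambda>s. cnj (W (- s))) u) / 2 \<partial>lborel)" by simp
  also have "\<dots> = (\<integral>u. \<psi> u \<partial>lborel) + (\<Psi> W t + \<Psi> (\<lambda>s. cnj (W (- s))) t) / 2"
    using \<psi> integrable_times_wave_tilt[OF W \<psi>] integrable_times_wave_tilt[OF W' \<psi>]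
    by (simp add: *[OF W] *[OF W'])
  finally show ?thesis unfolding \<psi>_def std_normal_fourier(2) .
qed

section \<open>Rapid decay of characteristic functions\<close>

definition fast_decay :: "(real \<Rightarrow> complex) \<Rightarrow> bool" where
  "fast_decay F \<longleftrightarrow> (\<forall>k. ((\<lambda>t. t powr k * cmod (F t)) \<longlongrightarrow> 0) at_top)"

text \<open>
  The class of transforms that satisfy the tail condition for every exponent. Carrying the derivative
  along makes the class closed under sums, scalars and modulation, and modulation is what relates
  \<open>h_tilde\<close> to \<open>h_hat\<close>.
\<close>
definition fast_decay_deriv :: "(real \<Rightarrow> complex) \<Rightarrow> bool" where
  "fast_decay_deriv F \<longleftrightarrow> fast_decay F \<and>
     (\<exists>F'. (\<forall>t. (F has_vector_derivative F' t) (at t)) \<and> fast_decay F')"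

lemma fast_decay_derivI:
  assumes "\<And>t. (F has_vector_derivative F' t) (at t)" "fast_decay F'" "fast_decay F"
  shows "fast_decay_deriv F"
  using assms unfolding fast_decay_deriv_def by blast

lemma fast_decay_derivE:
  assumes "fast_decay_deriv F"
  obtains F' where "\<And>t. (F has_vector_derivative F' t) (at t)" "fast_decay F'" "fast_decay F"
  using assms unfolding fast_decay_deriv_def by blast

lemma fast_decay_mono:
  assumes G: "fast_decay G" and le: "\<forall>\<^sub>F t in at_top. cmod (F t) \<le> C * cmod (G t)"
  shows "fast_decay F"
  unfolding fast_decay_def
proof
  fix k
  show "((\<lambda>t. t powr k * cmod (F t)) \<longlongrightarrow> 0) at_top"
  proof (rule Lim_null_comparison)
    show "\<forall>\<^sub>F t in at_top. norm (t powr k * cmod (F t)) \<le> C * (t powr k * cmod (G t))"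
      using le
    proof eventually_elim
      case (elim t)
      show ?case using mult_left_mono[OF elim, of "t powr k"] by (simp add: abs_mult mult_ac)
    qed
    show "((\<lambda>t. C * (t powr k * cmod (G t))) \<longlongrightarrow> 0) at_top"
      using tendsto_mult[OF tendsto_const[of C], of _ 0 at_top] G unfolding fast_decay_def by fastforce
  qed
qed

lemma fast_decay_add:
  assumes F: "fast_decay F" and G: "fast_decay G"
  shows "fast_decay (\<lambda>t. F t + G t)"
  unfolding fast_decay_def
proof
  fix k
  show "((\<lambda>t. t powr k * cmod (F t + G t)) \<longlongrightarrow> 0) at_top"
  proof (rule Lim_null_comparison)
    show "\<forall>\<^sub>F t in at_top. norm (t powr k * cmod (F t + G t)) \<le> t powr k * cmod (F t) + t powr k * cmod (G t)"
      by (auto simp: abs_mult distrib_left[symmetric] intro!: always_eventually mult_left_mono norm_triangle_ineq)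
    show "((\<lambda>t. t powr k * cmod (F t) + t powr k * cmod (G t)) \<longlongrightarrow> 0) at_top"
      using F G unfolding fast_decay_def by (auto intro: tendsto_add_zero)
  qed
qed

lemma fast_decay_cmult: "fast_decay F \<Longrightarrow> fast_decay (\<lambda>t. c * F t)"
  by (erule fast_decay_mono[where C="cmod c"]) (simp add: norm_mult)

lemma fast_decay_gaussian_bound:
  assumes "\<forall>\<^sub>F t in at_top. cmod (F t) \<le> C * ((t + T) * exp (- (t - T)\<^sup>2 / 2))"
  shows "fast_decay F"
proof (rule fast_decay_mono[of "\<lambda>t. of_real ((t + T) * exp (- (t - T)\<^sup>2 / 2))" F C])
  have "((\<lambda>t. t powr k * \<bar>(t + T) * exp (- (t - T)\<^sup>2 / 2)\<bar>) \<longlongrightarrow> 0) at_top" for k :: real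
    by real_asymp
  then show "fast_decay (\<lambda>t. of_real ((t + T) * exp (- (t - T)\<^sup>2 / 2)))"
    unfolding fast_decay_def norm_of_real by blast
  show "\<forall>\<^sub>F t in at_top. cmod (F t) \<le> C * cmod (of_real ((t + T) * exp (- (t - T)\<^sup>2 / 2)))"
    using assms eventually_gt_at_top[of "-T"] unfolding norm_of_real
    by eventually_elim (simp add: abs_mult)
qed

lemma fast_decay_deriv_add:
  assumes "fast_decay_deriv F" "fast_decay_deriv G"
  shows "fast_decay_deriv (\<lambda>t. F t + G t)"
  using assms
  by (elim fast_decay_derivE) (rule fast_decay_derivI; (rule has_vector_derivative_add fast_decay_add); blast)

lemma fast_decay_deriv_cmult:
  assumes "fast_decay_deriv F"
  shows "fast_decay_deriv (\<lambda>t. c * F t)"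
  using assms
  by (elim fast_decay_derivE) (rule fast_decay_derivI; (rule has_vector_derivative_mult_right fast_decay_cmult); blast)

lemma fast_decay_deriv_modulate:
  assumes "fast_decay_deriv F"
  shows "fast_decay_deriv (\<lambda>t. iexp (t * v) * F t)"
proof -
  obtain F' where F: "fast_decay F" and F': "\<And>t. (F has_vector_derivative F' t) (at t)" "fast_decay F'"
    by (metis assms fast_decay_derivE)
  have e: "((\<lambda>t. iexp (t * v)) has_vector_derivative \<i> * v * iexp (t * v)) (at t)" for t
  proof -
    have "((\<lambda>z. exp (\<i> * (z * of_real v))) has_field_derivative \<i> * v * iexp (t * v)) (at (of_real t))"
      by (auto intro!: derivative_eq_intros)
    from has_vector_derivative_real_field[OF this] show ?thesis by simp
  qed
  have "((\<lambda>t. iexp (t * v) * F t) has_vector_derivative iexp (t * v) * F' t + \<i> * v * iexp (t * v) * F t) (at t)" for t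
    using has_vector_derivative_mult[OF e F'(1)] .
  moreover have "fast_decay (\<lambda>t. iexp (t * v) * F' t + \<i> * v * iexp (t * v) * F t)"
    by (intro fast_decay_add fast_decay_mono[OF F'(2), of _ 1] fast_decay_mono[OF F, of _ "\<bar>v\<bar>"]) (simp_all add: norm_mult)
  moreover have "fast_decay (\<lambda>t. iexp (t * v) * F t)"
    by (rule fast_decay_mono[OF F, of _ 1]) (simp add: norm_mult)
  ultimately show ?thesis by (rule fast_decay_derivI)
qed

lemma gaussian_has_vector_derivative:
  "((\<lambda>t. complex_of_real (exp (- (t + s)\<^sup>2 / 2))) has_vector_derivative
     of_real (- (t + s) * exp (- (t + s)\<^sup>2 / 2))) (at t within A)"
proof -
  have "((\<lambda>t. exp (- (t + s)\<^sup>2 / 2)) has_field_derivative (- (t + s) * exp (- (t + s)\<^sup>2 / 2))) (at t within A)"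
    by (auto intro!: derivative_eq_intros simp: field_simps)
  then show ?thesis
    by (rule has_vector_derivative_of_real)
qed

lemma fast_decay_deriv_gaussian: "fast_decay_deriv (\<lambda>t. of_real (exp (- t\<^sup>2 / 2)))"
  unfolding fast_decay_deriv_def
proof (intro conjI exI allI)
  show "fast_decay (\<lambda>t. of_real (exp (- t\<^sup>2 / 2)))"
    unfolding fast_decay_def norm_of_real abs_exp_cancel by (rule allI) real_asymp
  show "((\<lambda>t. complex_of_real (exp (- t\<^sup>2 / 2))) has_vector_derivative of_real (- t * exp (- t\<^sup>2 / 2))) (at t)" for t
    using gaussian_has_vector_derivative[of 0 t UNIV] by simp
  show "fast_decay (\<lambda>t. of_real (- t * exp (- t\<^sup>2 / 2)))"
    unfolding fast_decay_def norm_of_real abs_mult by (rule allI) real_asymp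
qed

lemma gaussian_shift_le:
  fixes s t T :: real
  assumes "\<bar>s\<bar> \<le> T" "T \<le> t"
  shows "exp (- (t + s)\<^sup>2 / 2) \<le> exp (- (t - T)\<^sup>2 / 2)"
proof -
  have "(t - T)\<^sup>2 \<le> (t + s)\<^sup>2" using assms by (intro power_mono) auto
  then show ?thesis by simp
qed

text \<open>
  All the Gaussian bumps are centred in \<open>[-T, T]\<close>, so beyond \<open>T\<close> each of them is dominated by the bump
  centred at \<open>T\<close>. The derivative may be taken under the integral over the compact window.
\<close>
lemma fast_decay_deriv_window:
  fixes G :: "real \<Rightarrow> complex"
  assumes G: "continuous_on UNIV G" and T: "0 \<le> T"
  shows "fast_decay_deriv (\<lambda>t. integral {-T..T} (\<lambda>s. G s * of_real (exp (- (t + s)\<^sup>2 / 2))))"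
proof -
  have Gc[continuous_intros]: "continuous_on A (\<lambda>x. G (g x))" if "continuous_on A g" for A :: "'c::topological_space set" and g
    using continuous_on_compose2[OF G that] by auto
  obtain B where B: "\<And>s. s \<in> {-T..T} \<Longrightarrow> cmod (G s) \<le> B"
  proof -
    have "compact (G ` {-T..T})"
      by (intro compact_continuous_image continuous_on_subset[OF G]) auto
    then have "bounded (G ` {-T..T})" by (rule compact_imp_bounded)
    then show ?thesis using that unfolding bounded_iff by (metis imageI)
  qed
  have bnd: "cmod (integral {-T..T} (\<lambda>s. G s * of_real (r t s))) \<le> B * E * (T - (-T))"
    if "continuous_on {-T..T} (r t)" and "\<And>s. s \<in> {-T..T} \<Longrightarrow> \<bar>r t s\<bar> \<le> E" for r :: "real \<Rightarrow> real \<Rightarrow> real" and t E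
  proof (rule integral_bound)
    show "-T \<le> T" using T by simp
    show "continuous_on {-T..T} (\<lambda>s. G s * of_real (r t s))"
      using that(1) by (intro continuous_intros)
    fix s assume s: "s \<in> {-T..T}"
    show "cmod (G s * of_real (r t s)) \<le> B * E"
      using B[OF s] that(2)[OF s] order_trans[OF norm_ge_zero B[OF s]]
      unfolding norm_mult norm_of_real by (intro mult_mono) auto
  qed
  have d: "((\<lambda>t. integral {-T..T} (\<lambda>s. G s * of_real (exp (- (t + s)\<^sup>2 / 2)))) has_vector_derivative
     integral {-T..T} (\<lambda>s. G s * of_real (- (t + s) * exp (- (t + s)\<^sup>2 / 2)))) (at t)" for t
  proof -
    have "((\<lambda>t. integral (cbox (-T) T) (\<lambda>s. G s * of_real (exp (- (t + s)\<^sup>2 / 2)))) has_vector_derivative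
     integral (cbox (-T) T) (\<lambda>s. G s * of_real (- (t + s) * exp (- (t + s)\<^sup>2 / 2)))) (at t within UNIV)"
    proof (rule leibniz_rule_vector_derivative)
      show "((\<lambda>t. G s * of_real (exp (- (t + s)\<^sup>2 / 2))) has_vector_derivative
         G s * of_real (- (t + s) * exp (- (t + s)\<^sup>2 / 2))) (at t within UNIV)" for t s
        by (rule has_vector_derivative_mult_right[OF gaussian_has_vector_derivative])
      show "(\<lambda>s. G s * of_real (exp (- (t + s)\<^sup>2 / 2))) integrable_on cbox (-T) T" for t
        by (intro integrable_continuous continuous_intros) auto
      show "continuous_on (UNIV \<times> cbox (-T) T) (\<lambda>(t, s). G s * complex_of_real (- (t + s) * exp (- (t + s)\<^sup>2 / 2)))"
        unfolding split_beta by (intro continuous_intros) auto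
    qed auto
    then show ?thesis by simp
  qed
  show ?thesis
  proof (rule fast_decay_derivI[OF d])
    show "fast_decay (\<lambda>t. integral {-T..T} (\<lambda>s. G s * of_real (exp (- (t + s)\<^sup>2 / 2))))"
    proof (rule fast_decay_gaussian_bound[where T=T and C="B * (2 * T)"])
      show "\<forall>\<^sub>F t in at_top. cmod (integral {-T..T} (\<lambda>s. G s * of_real (exp (- (t + s)\<^sup>2 / 2))))
          \<le> B * (2 * T) * ((t + T) * exp (- (t - T)\<^sup>2 / 2))"
        using eventually_ge_at_top[of "T + 1"]
      proof eventually_elim
        case (elim t)
        have "cmod (integral {-T..T} (\<lambda>s. G s * of_real (exp (- (t + s)\<^sup>2 / 2))))
          \<le> B * ((t + T) * exp (- (t - T)\<^sup>2 / 2)) * (T - (-T))"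
        proof (rule bnd)
          show "continuous_on {-T..T} (\<lambda>s. exp (- (t + s)\<^sup>2 / 2))" by (intro continuous_intros) auto
          fix s assume s: "s \<in> {-T..T}"
          have "1 * exp (- (t - T)\<^sup>2 / 2) \<le> (t + T) * exp (- (t - T)\<^sup>2 / 2)"
            using elim T by (intro mult_right_mono) auto
          moreover have "exp (- (t + s)\<^sup>2 / 2) \<le> exp (- (t - T)\<^sup>2 / 2)"
            using s elim by (intro gaussian_shift_le) auto
          ultimately show "\<bar>exp (- (t + s)\<^sup>2 / 2)\<bar> \<le> (t + T) * exp (- (t - T)\<^sup>2 / 2)"
            unfolding abs_exp_cancel by linarith
        qed
        then show ?case by (simp add: mult_ac)
      qed
    qed
    show "fast_decay (\<lambda>t. integral {-T..T} (\<lambda>s. G s * of_real (- (t + s) * exp (- (t + s)\<^sup>2 / 2))))"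
    proof (rule fast_decay_gaussian_bound[where T=T and C="B * (2 * T)"])
      show "\<forall>\<^sub>F t in at_top. cmod (integral {-T..T} (\<lambda>s. G s * of_real (- (t + s) * exp (- (t + s)\<^sup>2 / 2))))
          \<le> B * (2 * T) * ((t + T) * exp (- (t - T)\<^sup>2 / 2))"
        using eventually_ge_at_top[of T]
      proof eventually_elim
        case (elim t)
        have "cmod (integral {-T..T} (\<lambda>s. G s * of_real (- (t + s) * exp (- (t + s)\<^sup>2 / 2))))
          \<le> B * ((t + T) * exp (- (t - T)\<^sup>2 / 2)) * (T - (-T))"
        proof (rule bnd)
          show "continuous_on {-T..T} (\<lambda>s. - (t + s) * exp (- (t + s)\<^sup>2 / 2))" by (intro continuous_intros) auto
          fix s assume s: "s \<in> {-T..T}"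
          show "\<bar>- (t + s) * exp (- (t + s)\<^sup>2 / 2)\<bar> \<le> (t + T) * exp (- (t - T)\<^sup>2 / 2)"
            using gaussian_shift_le[of s T t] s elim unfolding abs_mult abs_exp_cancel
            by (intro mult_mono) auto
        qed
        then show ?case by (simp add: mult_ac)
      qed
    qed
  qed
qed

lemma integrable_window:
  fixes G :: "real \<Rightarrow> complex"
  assumes G: "continuous_on UNIV G"
  shows "integrable lborel (\<lambda>s. indicat_real {-T..T} s *\<^sub>R G s)"
  using borel_integrable_compact[of "{-T..T}" G] continuous_on_subset[OF G]
  by (simp add: indicator_scaleR_eq_if)

lemma integral_window:
  fixes G :: "real \<Rightarrow> complex"
  assumes G: "continuous_on UNIV G"
  shows "(\<integral>s. indicat_real {-T..T} s *\<^sub>R G s \<partial>lborel) = integral {-T..T} G"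
  using set_borel_integral_eq_integral(2)[of "{-T..T}" G] integrable_window[OF G, of T]
  by (simp add: set_lebesgue_integral_def set_integrable_def)

lemma fast_decay_tilted_normal:
  fixes G :: "real \<Rightarrow> complex"
  assumes G: "continuous_on UNIV G" and T: "0 \<le> T"
  defines "W \<equiv> \<lambda>s. indicat_real {-T..T} s *\<^sub>R G s"
  shows "fast_decay_deriv (\<lambda>t. \<integral>u. iexp (t * u) * complex_of_real (tilted_normal W u) \<partial>lborel)"
proof -
  define \<Psi> :: "(real \<Rightarrow> complex) \<Rightarrow> real \<Rightarrow> complex" where
    "\<Psi> = (\<lambda>V t. \<integral>s. V s * of_real (exp (- (t + s)\<^sup>2 / 2) - exp (- t\<^sup>2 / 2) * exp (- s\<^sup>2 / 2)) \<partial>lborel)"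
  have *: "fast_decay_deriv (\<Psi> (\<lambda>s. indicat_real {-T..T} s *\<^sub>R H s))" if H: "continuous_on UNIV H" for H :: "real \<Rightarrow> complex"
  proof -
    define c where "c = integral {-T..T} (\<lambda>s. H s * of_real (exp (- s\<^sup>2 / 2)))"
    have "\<Psi> (\<lambda>s. indicat_real {-T..T} s *\<^sub>R H s) t =
      integral {-T..T} (\<lambda>s. H s * of_real (exp (- (t + s)\<^sup>2 / 2))) + (- c) * of_real (exp (- t\<^sup>2 / 2))" for t
    proof -
      have c1: "continuous_on UNIV (\<lambda>s. H s * of_real (exp (- (t + s)\<^sup>2 / 2)))"
        by (intro continuous_intros H) auto
      have c2: "continuous_on UNIV (\<lambda>s. H s * of_real (exp (- s\<^sup>2 / 2)))"
        by (intro continuous_intros H) auto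
      have "\<Psi> (\<lambda>s. indicat_real {-T..T} s *\<^sub>R H s) t =
        (\<integral>s. indicat_real {-T..T} s *\<^sub>R (H s * of_real (exp (- (t + s)\<^sup>2 / 2)))
          - of_real (exp (- t\<^sup>2 / 2)) * (indicat_real {-T..T} s *\<^sub>R (H s * of_real (exp (- s\<^sup>2 / 2)))) \<partial>lborel)"
        unfolding \<Psi>_def by (rule Bochner_Integration.integral_cong[OF refl]) (simp add: algebra_simps scaleR_conv_of_real)
      also have "\<dots> = integral {-T..T} (\<lambda>s. H s * of_real (exp (- (t + s)\<^sup>2 / 2))) - of_real (exp (- t\<^sup>2 / 2)) * c"
        unfolding c_def integral_window[OF c1, symmetric] integral_window[OF c2, symmetric]
          integral_mult_right_zero[symmetric]
        by (intro Bochner_Integration.integral_diff integrable_mult_right integrable_window c1 c2)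
      finally show ?thesis by simp
    qed
    then have "\<Psi> (\<lambda>s. indicat_real {-T..T} s *\<^sub>R H s) = (\<lambda>t.
      integral {-T..T} (\<lambda>s. H s * of_real (exp (- (t + s)\<^sup>2 / 2))) + (- c) * of_real (exp (- t\<^sup>2 / 2)))"
      by (rule ext)
    then show ?thesis
      using fast_decay_deriv_add[OF fast_decay_deriv_window[OF H T]
          fast_decay_deriv_cmult[OF fast_decay_deriv_gaussian, of "- c"]] by simp
  qed
  have W: "integrable lborel W" unfolding W_def by (rule integrable_window[OF G])
  have W': "(\<lambda>s. cnj (W (- s))) = (\<lambda>s. indicat_real {-T..T} s *\<^sub>R cnj (G (- s)))"
    unfolding W_def by (rule ext) (auto simp: indicator_def)
  have G': "continuous_on UNIV (\<lambda>s. cnj (G (- s)))"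
    by (intro continuous_intros continuous_on_compose2[OF G]) auto
  have "(\<lambda>t. \<integral>u. iexp (t * u) * complex_of_real (tilted_normal W u) \<partial>lborel)
      = (\<lambda>t. of_real (exp (- t\<^sup>2 / 2)) + (1 / 2) * (\<Psi> W t + \<Psi> (\<lambda>s. cnj (W (- s))) t))"
    unfolding tilted_normal_fourier[OF W] \<Psi>_def by simp
  then show ?thesis
    unfolding W' unfolding W_def using *[OF G] *[OF G']
    by (simp only:) (intro fast_decay_deriv_add fast_decay_deriv_cmult fast_decay_deriv_gaussian)
qed

text \<open>
  The suprema over \<open>\<sigma>\<close> are trivial for a conditional density that does not depend on \<open>\<sigma>\<close>, and recentring
  at \<open>u0\<close> multiplies the transform by a unimodular wave.
\<close>
lemma tail_condition_of_fast_decay: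
  assumes F: "fast_decay_deriv (\<lambda>t. \<integral>u. iexp (t * u) * complex_of_real (h u) \<partial>lborel)"
    and A: "0 < A"
  shows "tail_condition \<alpha> A u0 \<sigma>0 (\<lambda>u \<sigma>. h u)"
proof -
  define F where "F = (\<lambda>t. \<integral>u. iexp (t * u) * complex_of_real (h u) \<partial>lborel)"
  have lim: "Limsup at_top (\<lambda>t. SUP \<sigma>\<in>{\<sigma>0..}. ereal (\<bar>t\<bar> powr k * cmod (Q \<sigma> t))) \<le> ereal A"
    if "fast_decay R" "\<And>\<sigma> t. Q \<sigma> t = R t" for k and R :: "real \<Rightarrow> complex" and Q :: "real \<Rightarrow> real \<Rightarrow> complex"
  proof -
    have "((\<lambda>t. \<bar>t\<bar> powr k * cmod (R t)) \<longlongrightarrow> 0) at_top"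
    proof (rule Lim_transform_eventually)
      show "((\<lambda>t. t powr k * cmod (R t)) \<longlongrightarrow> 0) at_top" using that unfolding fast_decay_def by blast
      show "\<forall>\<^sub>F t in at_top. t powr k * cmod (R t) = \<bar>t\<bar> powr k * cmod (R t)"
        using eventually_ge_at_top[of 0] by eventually_elim simp
    qed
    then have "((\<lambda>t. ereal (\<bar>t\<bar> powr k * cmod (R t))) \<longlongrightarrow> ereal 0) at_top" by (rule tendsto_ereal)
    then have "Limsup at_top (\<lambda>t. ereal (\<bar>t\<bar> powr k * cmod (R t))) = ereal 0"
      by (intro lim_imp_Limsup) auto
    moreover have "(SUP \<sigma>\<in>{\<sigma>0..}. ereal (\<bar>t\<bar> powr k * cmod (Q \<sigma> t))) = ereal (\<bar>t\<bar> powr k * cmod (R t))" for t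
      unfolding that(2) by (rule cSUP_const) auto
    ultimately show ?thesis using A by simp
  qed
  have hat: "h_hat (\<lambda>u \<sigma>. h u) \<sigma> t = F t" for \<sigma> t unfolding h_hat_def F_def ..
  have tilde: "h_tilde (\<lambda>u \<sigma>. h u) u0 \<sigma> = (\<lambda>t. iexp (t * (- u0)) * F t)" for \<sigma>
  proof
    fix t
    have "F t = \<bar>1 :: real\<bar> *\<^sub>R (\<integral>u. iexp (t * (u0 + 1 * u)) * complex_of_real (h (u0 + 1 * u)) \<partial>lborel)"
      unfolding F_def by (rule lborel_integral_real_affine) simp
    also have "\<dots> = (\<integral>u. iexp (t * u0) * (iexp (t * u) * complex_of_real (h (u + u0))) \<partial>lborel)"
      by (simp add: distrib_left exp_add add.commute[of u0] mult_ac)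
    also have "\<dots> = iexp (t * u0) * h_tilde (\<lambda>u \<sigma>. h u) u0 \<sigma> t"
      unfolding h_tilde_def by (rule integral_mult_right_zero)
    finally have "iexp (t * (- u0)) * F t = (iexp (t * (- u0)) * iexp (t * u0)) * h_tilde (\<lambda>u \<sigma>. h u) u0 \<sigma> t"
      by (simp only: mult.assoc)
    then show "h_tilde (\<lambda>u \<sigma>. h u) u0 \<sigma> t = iexp (t * (- u0)) * F t"
      unfolding exp_add[symmetric] by simp
  qed
  have "fast_decay_deriv (\<lambda>t. iexp (t * (- u0)) * F t)"
    by (rule fast_decay_deriv_modulate) (use F in \<open>simp add: F_def\<close>)
  then obtain D where D: "\<And>t. ((\<lambda>t. iexp (t * (- u0)) * F t) has_vector_derivative D t) (at t)" "fast_decay D"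
    unfolding fast_decay_deriv_def by blast
  have "fast_decay F" using F by (simp add: F_def fast_decay_deriv_def)
  then show ?thesis
    unfolding tail_condition_def tilde
    by (intro conjI lim[of F] lim[OF D(2)] hat allI impI vector_derivative_at[OF D(1)] differentiableI_vector[OF D(1)])
qed

section \<open>Gaussian location mixtures in the parameter space\<close>

definition convolution_model :: "real \<Rightarrow> real \<Rightarrow> real \<Rightarrow> real \<Rightarrow> (real \<Rightarrow> real) \<Rightarrow> real \<Rightarrow> real" where
  "convolution_model \<epsilon> \<mu> \<sigma>0 s h x =
     (1 - \<epsilon>) * normal_density \<mu> \<sigma>0 x + \<epsilon> * (\<integral>u. normal_density u s x * h u \<partial>lborel)"

definition fixed_scale_mixing :: "(real \<Rightarrow> real) \<Rightarrow> real \<Rightarrow> (real \<times> real) measure" where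
  "fixed_scale_mixing h s = distr (density lborel (\<lambda>u. ennreal (h u))) borel (\<lambda>u. (u, s))"

lemma measurable_Pair_const: "(\<lambda>u. (u, s)) \<in> borel \<rightarrow>\<^sub>M (borel :: (real \<times> real) measure)"
  unfolding borel_prod[symmetric] by measurable

lemma prob_space_density_real:
  fixes h :: "real \<Rightarrow> real"
  assumes "integrable lborel h" "\<And>u. 0 \<le> h u" "(\<integral>u. h u \<partial>lborel) = 1"
  shows "prob_space (density lborel (\<lambda>u. ennreal (h u)))" "(\<integral>\<^sup>+u. ennreal (h u) \<partial>lborel) = 1"
proof -
  show 1: "(\<integral>\<^sup>+u. ennreal (h u) \<partial>lborel) = 1"
    using assms by (subst nn_integral_eq_integral) auto
  show "prob_space (density lborel (\<lambda>u. ennreal (h u)))"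
    using assms 1 by (intro prob_spaceI) (simp add: emeasure_density)
qed

lemma sigma_marginal_fixed_scale_mixing:
  fixes h :: "real \<Rightarrow> real"
  assumes "integrable lborel h" "\<And>u. 0 \<le> h u" "(\<integral>u. h u \<partial>lborel) = 1"
  shows "sigma_marginal (fixed_scale_mixing h s) = return borel s"
proof -
  interpret prob_space "density lborel (\<lambda>u. ennreal (h u))" by (rule prob_space_density_real(1)[OF assms])
  have "sigma_marginal (fixed_scale_mixing h s) = distr (density lborel (\<lambda>u. ennreal (h u))) borel (snd \<circ> (\<lambda>u. (u, s)))"
    unfolding fixed_scale_mixing_def using measurable_Pair_const borel_measurable_snd_real
    by (intro distr_distr) auto
  also have "\<dots> = distr (density lborel (\<lambda>u. ennreal (h u))) borel (\<lambda>u. s)" by (simp add: comp_def)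
  also have "\<dots> = return borel s" by (rule distr_const) simp
  finally show ?thesis .
qed

lemma fixed_scale_mixing_eq_density:
  fixes h :: "real \<Rightarrow> real"
  assumes h: "integrable lborel h" "\<And>u. 0 \<le> h u" "(\<integral>u. h u \<partial>lborel) = 1"
  shows "fixed_scale_mixing h s = density (lborel \<Otimes>\<^sub>M return borel s) (\<lambda>(u, \<sigma>). ennreal (h u))"
proof (rule measure_eqI)
  have [measurable]: "h \<in> borel_measurable borel" using h by auto
  interpret R: prob_space "return borel s :: real measure" by (rule prob_space_return) simp
  have sets_eq: "sets (lborel \<Otimes>\<^sub>M return borel s) = sets (borel :: (real \<times> real) measure)"
    by (subst borel_prod[symmetric]) (rule sets_pair_measure_cong, simp_all)
  show "sets (fixed_scale_mixing h s) = sets (density (lborel \<Otimes>\<^sub>M return borel s) (\<lambda>(u, \<sigma>). ennreal (h u)))"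
    unfolding fixed_scale_mixing_def using sets_eq by simp
  fix X assume "X \<in> sets (fixed_scale_mixing h s)"
  then have X: "X \<in> sets (borel :: (real \<times> real) measure)" by (simp add: fixed_scale_mixing_def)
  then have Xp[measurable]: "X \<in> sets (lborel \<Otimes>\<^sub>M return borel s)" using sets_eq by simp
  have hm: "(\<lambda>p. ennreal (h (fst p)) * indicator X p) \<in> borel_measurable (lborel \<Otimes>\<^sub>M return borel s)"
    by measurable
  have pre: "(\<lambda>u. (u, s)) -` X \<in> sets borel"
    using measurable_sets[OF measurable_Pair_const X] by simp
  have "emeasure (fixed_scale_mixing h s) X = (\<integral>\<^sup>+u. ennreal (h u) * indicator ((\<lambda>u. (u, s)) -` X) u \<partial>lborel)"
    unfolding fixed_scale_mixing_def using X pre measurable_Pair_const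
    by (subst emeasure_distr) (auto simp: emeasure_density)
  also have "\<dots> = (\<integral>\<^sup>+u. (\<integral>\<^sup>+\<sigma>. ennreal (h u) * indicator X (u, \<sigma>) \<partial>return borel s) \<partial>lborel)"
  proof (rule nn_integral_cong)
    fix u
    have "(\<lambda>\<sigma>. ennreal (h u) * indicator X (u, \<sigma>)) \<in> borel_measurable borel"
      using measurable_compose[OF measurable_Pair1' hm, of u] by simp
    then show "ennreal (h u) * indicator ((\<lambda>u. (u, s)) -` X) u
       = (\<integral>\<^sup>+\<sigma>. ennreal (h u) * indicator X (u, \<sigma>) \<partial>return borel s)"
      by (subst nn_integral_return) (auto simp: indicator_def)
  qed
  also have "\<dots> = (\<integral>\<^sup>+p. ennreal (h (fst p)) * indicator X p \<partial>(lborel \<Otimes>\<^sub>M return borel s))"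
    using R.nn_integral_fst[OF hm] by simp
  also have "\<dots> = emeasure (density (lborel \<Otimes>\<^sub>M return borel s) (\<lambda>(u, \<sigma>). ennreal (h u))) X"
    unfolding split_beta by (rule emeasure_density[symmetric]) measurable
  finally show "emeasure (fixed_scale_mixing h s) X = emeasure (density (lborel \<Otimes>\<^sub>M return borel s) (\<lambda>(u, \<sigma>). ennreal (h u))) X" .
qed

text \<open>
  A conditional density has to be specified at every scale, although the mixing law charges only one.
  Taking the same \<open>h\<close> at all scales makes the suprema in the tail condition trivial.
\<close>
lemma eligible_rep_convolution_model:
  assumes h: "integrable lborel h" "\<And>u. 0 \<le> h u" "(\<integral>u. h u \<partial>lborel) = 1"
    and \<epsilon>: "0 < \<epsilon>" "\<epsilon> < 1" and s: "0 < \<sigma>0" "\<sigma>0 \<le> s"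
  shows "eligible_rep (convolution_model \<epsilon> \<mu> \<sigma>0 s h) \<epsilon> \<mu> \<sigma>0 (fixed_scale_mixing h s) (\<lambda>u \<sigma>. h u)"
proof -
  have hm[measurable]: "h \<in> borel_measurable borel" using h by auto
  have "(\<lambda>(u, \<sigma> :: real). h u) \<in> borel_measurable borel"
    unfolding borel_prod[symmetric] by measurable
  then have cond: "has_cond_density (fixed_scale_mixing h s) \<sigma>0 (\<lambda>u \<sigma>. h u)"
    unfolding has_cond_density_def sigma_marginal_fixed_scale_mixing[OF h]
    using h prob_space_density_real(2)[OF h] fixed_scale_mixing_eq_density[OF h] by blast
  have "(\<lambda>p. normal_density (fst p) (snd p) x) \<in> borel_measurable (borel :: (real \<times> real) measure)" for x
    unfolding normal_density_def borel_prod[symmetric] by measurable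
  then have "(\<integral>(u, \<sigma>). normal_density u \<sigma> x \<partial>fixed_scale_mixing h s) = (\<integral>u. normal_density u s x \<partial>density lborel (\<lambda>u. ennreal (h u)))" for x
    unfolding fixed_scale_mixing_def split_beta using measurable_Pair_const
    by (subst integral_distr) auto
  also have "(\<integral>u. normal_density u s x \<partial>density lborel (\<lambda>u. ennreal (h u))) = (\<integral>u. normal_density u s x * h u \<partial>lborel)" for x
    using h(2) by (subst integral_density) (auto simp: normal_density_def mult.commute)
  finally have "convolution_model \<epsilon> \<mu> \<sigma>0 s h = gauss_mixture \<epsilon> \<mu> \<sigma>0 (fixed_scale_mixing h s)"
    unfolding convolution_model_def gauss_mixture_def by auto
  moreover have "prob_space (fixed_scale_mixing h s)"
    unfolding fixed_scale_mixing_def using measurable_Pair_const prob_space_density_real(1)[OF h]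
    by (intro prob_space.prob_space_distr) auto
  moreover have "sets (fixed_scale_mixing h s) = sets borel" by (simp add: fixed_scale_mixing_def)
  moreover have "AE \<sigma> in sigma_marginal (fixed_scale_mixing h s). \<sigma>0 \<le> \<sigma>"
    unfolding sigma_marginal_fixed_scale_mixing[OF h] using s by (subst AE_return) auto
  ultimately show ?thesis using cond \<epsilon> s unfolding eligible_rep_def by auto
qed

lemma integrable_abs_powr_std_normal:
  assumes "0 < q"
  shows "integrable lborel (\<lambda>z. \<bar>z\<bar> powr q * std_normal_density z)"
proof (rule Bochner_Integration.integrable_bound)
  define k where "k = nat \<lceil>q\<rceil>"
  show "integrable lborel (\<lambda>z. std_normal_density z + std_normal_density z * \<bar>z\<bar> ^ k)"
    using integrable_std_normal_moment_abs[of k] by auto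
  show "(\<lambda>z. \<bar>z\<bar> powr q * std_normal_density z) \<in> borel_measurable lborel" by measurable
  show "AE z in lborel. norm (\<bar>z\<bar> powr q * std_normal_density z) \<le> norm (std_normal_density z + std_normal_density z * \<bar>z\<bar> ^ k)"
  proof (rule AE_I2)
    fix z :: real
    have "\<bar>z\<bar> powr q \<le> 1 + \<bar>z\<bar> ^ k"
    proof (cases "\<bar>z\<bar> \<le> 1")
      case True
      then have "\<bar>z\<bar> powr q \<le> 1" using assms by (simp add: powr_le1)
      then show ?thesis by (simp add: add_increasing2)
    next
      case False
      have "q \<le> real k" unfolding k_def by linarith
      then have "\<bar>z\<bar> powr q \<le> \<bar>z\<bar> powr real k" using False by (intro powr_mono) auto
      also have "\<dots> = \<bar>z\<bar> ^ k" using False by (intro powr_realpow) auto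
      finally show ?thesis by simp
    qed
    then have "\<bar>z\<bar> powr q * std_normal_density z \<le> (1 + \<bar>z\<bar> ^ k) * std_normal_density z"
      by (rule mult_right_mono) simp
    moreover have "0 \<le> std_normal_density z + std_normal_density z * \<bar>z\<bar> ^ k"
      by (intro add_nonneg_nonneg mult_nonneg_nonneg) auto
    ultimately show "norm (\<bar>z\<bar> powr q * std_normal_density z) \<le> norm (std_normal_density z + std_normal_density z * \<bar>z\<bar> ^ k)"
      by (simp add: abs_mult algebra_simps)
  qed
qed

lemma abs_normal_moment_nonneg: "0 \<le> abs_normal_moment q"
  unfolding abs_normal_moment_def by (rule integral_nonneg_AE) auto

lemma nn_integral_abs_powr_normal:
  assumes q: "0 < q" and \<tau>: "0 < \<tau>"
  shows "(\<integral>\<^sup>+x. ennreal (\<bar>x\<bar> powr q * normal_density 0 \<tau> x) \<partial>lborel) = ennreal (\<tau> powr q * abs_normal_moment q)"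
proof -
  have "(\<integral>\<^sup>+x. ennreal (\<bar>x\<bar> powr q * normal_density 0 \<tau> x) \<partial>lborel)
      = ennreal \<bar>\<tau>\<bar> * (\<integral>\<^sup>+z. ennreal (\<bar>0 + \<tau> * z\<bar> powr q * normal_density 0 \<tau> (0 + \<tau> * z)) \<partial>lborel)"
    using \<tau> by (intro nn_integral_real_affine) auto
  also have "\<dots> = (\<integral>\<^sup>+z. ennreal \<bar>\<tau>\<bar> * ennreal (\<bar>0 + \<tau> * z\<bar> powr q * normal_density 0 \<tau> (0 + \<tau> * z)) \<partial>lborel)"
    by (rule nn_integral_cmult[symmetric]) measurable
  also have "\<dots> = (\<integral>\<^sup>+z. ennreal (\<tau> powr q * (\<bar>z\<bar> powr q * std_normal_density z)) \<partial>lborel)"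
  proof (rule nn_integral_cong)
    fix z
    have "\<tau> * normal_density 0 \<tau> (\<tau> * z) = std_normal_density z"
      using \<tau> by (simp add: normal_density_def real_sqrt_mult power_mult_distrib)
    moreover have "\<bar>\<tau> * z\<bar> powr q = \<tau> powr q * \<bar>z\<bar> powr q"
      using \<tau> by (simp add: abs_mult powr_mult)
    ultimately have "\<bar>\<tau>\<bar> * (\<bar>0 + \<tau> * z\<bar> powr q * normal_density 0 \<tau> (0 + \<tau> * z)) = \<tau> powr q * (\<bar>z\<bar> powr q * std_normal_density z)"
      using \<tau> by (simp add: mult_ac)
    then show "ennreal \<bar>\<tau>\<bar> * ennreal (\<bar>0 + \<tau> * z\<bar> powr q * normal_density 0 \<tau> (0 + \<tau> * z))
       = ennreal (\<tau> powr q * (\<bar>z\<bar> powr q * std_normal_density z))"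
      by (subst ennreal_mult[symmetric]) auto
  qed
  also have "\<dots> = ennreal (\<tau> powr q * abs_normal_moment q)"
    unfolding abs_normal_moment_def integral_mult_right_zero[symmetric]
    by (rule nn_integral_eq_integral) (auto intro!: integrable_mult_right integrable_abs_powr_std_normal q)
  finally show ?thesis .
qed

text \<open>
  A small shift is absorbed by a slightly larger variance at the cost of a constant close to one. This
  controls the absolute moments of a shifted normal law for arbitrary real exponents. The inequality
  rests on \<open>(1 + \<mu>) ((x - \<mu>)\<^sup>2 + \<mu>) - x\<^sup>2 = \<mu> (x - 1 - \<mu>)\<^sup>2\<close>.
\<close>
lemma shifted_normal_le_wider_normal:
  assumes \<mu>: "0 \<le> \<mu>" and a: "0 < a"
  shows "normal_density \<mu> a x \<le> sqrt (1 + \<mu>) * exp (\<mu> / (2 * a\<^sup>2)) * normal_density 0 (a * sqrt (1 + \<mu>)) x"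
proof -
  have "x\<^sup>2 \<le> ((x - \<mu>)\<^sup>2 + \<mu>) * (1 + \<mu>)"
  proof -
    have "((x - \<mu>)\<^sup>2 + \<mu>) * (1 + \<mu>) - x\<^sup>2 = \<mu> * (x - (1 + \<mu>))\<^sup>2"
      by (simp add: power2_eq_square algebra_simps)
    moreover have "0 \<le> \<mu> * (x - (1 + \<mu>))\<^sup>2" using \<mu> by simp
    ultimately show ?thesis by linarith
  qed
  then have "x\<^sup>2 / (1 + \<mu>) \<le> (x - \<mu>)\<^sup>2 + \<mu>" using \<mu> by (simp add: pos_divide_le_eq)
  then have "x\<^sup>2 / (1 + \<mu>) / (2 * a\<^sup>2) \<le> ((x - \<mu>)\<^sup>2 + \<mu>) / (2 * a\<^sup>2)" by (rule divide_right_mono) simp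
  then have "- (x - \<mu>)\<^sup>2 / (2 * a\<^sup>2) \<le> \<mu> / (2 * a\<^sup>2) + - x\<^sup>2 / (2 * (a * sqrt (1 + \<mu>))\<^sup>2)"
    using \<mu> by (simp add: power_mult_distrib add_divide_distrib mult_ac)
  then have "exp (- (x - \<mu>)\<^sup>2 / (2 * a\<^sup>2)) \<le> exp (\<mu> / (2 * a\<^sup>2)) * exp (- x\<^sup>2 / (2 * (a * sqrt (1 + \<mu>))\<^sup>2))"
    unfolding exp_add[symmetric] by simp
  then have "exp (- (x - \<mu>)\<^sup>2 / (2 * a\<^sup>2)) / sqrt (2 * pi * a\<^sup>2)
      \<le> exp (\<mu> / (2 * a\<^sup>2)) * exp (- x\<^sup>2 / (2 * (a * sqrt (1 + \<mu>))\<^sup>2)) / sqrt (2 * pi * a\<^sup>2)"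
    by (rule divide_right_mono) simp
  moreover have "sqrt (2 * pi * (a * sqrt (1 + \<mu>))\<^sup>2) = sqrt (1 + \<mu>) * sqrt (2 * pi * a\<^sup>2)"
    using \<mu> a by (simp add: power_mult_distrib real_sqrt_mult)
  ultimately show ?thesis using \<mu> unfolding normal_density_def by simp
qed

lemma convolution_model_le:
  assumes h: "integrable lborel h" "\<And>u. 0 \<le> h u" "(\<integral>u. h u \<partial>lborel) = 1"
    and \<epsilon>: "0 < \<epsilon>" "\<epsilon> < 1" and S: "0 < S"
    and hle: "\<And>u. h u \<le> (1 + \<kappa>) * std_normal_density u" and \<kappa>: "0 \<le> \<kappa>"
    and nle: "\<And>x. normal_density \<mu> \<sigma>0 x \<le> (1 + \<kappa>) * normal_density 0 \<tau> x"
  shows "convolution_model \<epsilon> \<mu> \<sigma>0 (sqrt S) h x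
     \<le> (1 + \<kappa>) * ((1 - \<epsilon>) * normal_density 0 \<tau> x + \<epsilon> * normal_density 0 (sqrt (1 + S)) x)"
proof -
  have i: "integrable lborel (\<lambda>u. normal_density u (sqrt S) x * std_normal_density u)"
    unfolding normal_density_product[OF S] using S by auto
  have eq: "(\<integral>u. normal_density u (sqrt S) x * std_normal_density u \<partial>lborel) = normal_density 0 (sqrt (1 + S)) x"
    unfolding normal_density_product[OF S] using S by simp
  have "(\<integral>u. normal_density u (sqrt S) x * h u \<partial>lborel) \<le> (\<integral>u. (1 + \<kappa>) * (normal_density u (sqrt S) x * std_normal_density u) \<partial>lborel)"
  proof (rule integral_mono')
    show "integrable lborel (\<lambda>u. (1 + \<kappa>) * (normal_density u (sqrt S) x * std_normal_density u))"
      by (rule integrable_mult_right[OF i])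
    fix u
    show "normal_density u (sqrt S) x * h u \<le> (1 + \<kappa>) * (normal_density u (sqrt S) x * std_normal_density u)"
      using mult_left_mono[OF hle[of u], of "normal_density u (sqrt S) x"] by (simp add: mult_ac)
    show "0 \<le> (1 + \<kappa>) * (normal_density u (sqrt S) x * std_normal_density u)" using \<kappa> by simp
  qed
  also have "\<dots> = (1 + \<kappa>) * normal_density 0 (sqrt (1 + S)) x"
    unfolding integral_mult_right_zero eq ..
  finally have 1: "\<epsilon> * (\<integral>u. normal_density u (sqrt S) x * h u \<partial>lborel) \<le> \<epsilon> * ((1 + \<kappa>) * normal_density 0 (sqrt (1 + S)) x)"
    by (rule mult_left_mono) (use \<epsilon> in simp)
  have 2: "(1 - \<epsilon>) * normal_density \<mu> \<sigma>0 x \<le> (1 - \<epsilon>) * ((1 + \<kappa>) * normal_density 0 \<tau> x)"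
    by (rule mult_left_mono[OF nle]) (use \<epsilon> in simp)
  have "(1 + \<kappa>) * ((1 - \<epsilon>) * normal_density 0 \<tau> x + \<epsilon> * normal_density 0 (sqrt (1 + S)) x)
    = (1 - \<epsilon>) * ((1 + \<kappa>) * normal_density 0 \<tau> x) + \<epsilon> * ((1 + \<kappa>) * normal_density 0 (sqrt (1 + S)) x)"
    by (simp add: algebra_simps)
  then show ?thesis using 1 2 unfolding convolution_model_def by linarith
qed

text \<open>
  Domination of both components by centred Gaussians of variance at most \<open>1 + S\<close>, up to a factor
  \<open>1 + \<kappa>\<close>, reduces the moment condition to a single inequality; the strict gap between \<open>A\<close> and
  \<open>sqrt (a\<^sup>2 + 1) * abs_normal_moment q powr (1 / q)\<close> will leave room for it.
\<close>
lemma convolution_model_in_param_space: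
  assumes h: "integrable lborel h" "\<And>u. 0 \<le> h u" "(\<integral>u. h u \<partial>lborel) = 1"
    and \<epsilon>: "0 < \<epsilon>" "\<epsilon> < 1" "\<epsilon> \<le> \<epsilon>0 * real n powr (- \<beta>)"
    and S: "0 < \<sigma>0" "\<sigma>0\<^sup>2 \<le> S" "a \<le> \<sigma>0"
    and hle: "\<And>u. h u \<le> (1 + \<kappa>) * std_normal_density u" and \<kappa>: "0 \<le> \<kappa>"
    and nle: "\<And>x. normal_density \<mu> \<sigma>0 x \<le> (1 + \<kappa>) * normal_density 0 \<tau> x"
    and \<tau>: "0 < \<tau>" "\<tau>\<^sup>2 \<le> 1 + S"
    and moment: "(1 + \<kappa>) * (sqrt (1 + S) powr q * abs_normal_moment q) \<le> A powr q" and q: "0 < q"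
    and tail: "fast_decay_deriv (\<lambda>t. \<integral>u. iexp (t * u) * complex_of_real (h u) \<partial>lborel)" and A: "0 < A"
  defines "f \<equiv> convolution_model \<epsilon> \<mu> \<sigma>0 (sqrt S) h"
  shows "f \<in> param_space \<alpha> \<beta> \<epsilon>0 q a A n" "proportion f = \<epsilon>" "null_mean f = \<mu>" "null_sd f = \<sigma>0"
proof -
  have S0: "0 < S" using S(1,2) zero_less_power[of \<sigma>0 2] by linarith
  have s: "\<sigma>0 \<le> sqrt S" using S(1,2) by (intro real_le_rsqrt) auto
  note rep = eligible_rep_convolution_model[OF h \<epsilon>(1,2) S(1) s, of \<mu>, folded f_def]
  note par = eligible_rep_params[OF rep]
  show "proportion f = \<epsilon>" "null_mean f = \<mu>" "null_sd f = \<sigma>0" by (fact par)+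
  have tc: "tail_condition \<alpha> A \<mu> \<sigma>0 (\<lambda>u \<sigma>. h u)" by (rule tail_condition_of_fast_decay[OF tail A])
  define D where "D = sqrt (1 + S)"
  have D: "0 < D" "\<tau> \<le> D" using S0 \<tau> unfolding D_def by (auto intro!: real_le_rsqrt)
  define Mq where "Mq = abs_normal_moment q"
  have Mq: "0 \<le> Mq" unfolding Mq_def by (rule abs_normal_moment_nonneg)
  have "(\<integral>\<^sup>+x. ennreal (\<bar>x\<bar> powr q * f x) \<partial>lborel)
     \<le> (\<integral>\<^sup>+x. ennreal ((1 + \<kappa>) * (1 - \<epsilon>)) * ennreal (\<bar>x\<bar> powr q * normal_density 0 \<tau> x)
           + ennreal ((1 + \<kappa>) * \<epsilon>) * ennreal (\<bar>x\<bar> powr q * normal_density 0 D x) \<partial>lborel)"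
  proof (rule nn_integral_mono)
    fix x
    have "\<bar>x\<bar> powr q * f x \<le> \<bar>x\<bar> powr q * ((1 + \<kappa>) * ((1 - \<epsilon>) * normal_density 0 \<tau> x + \<epsilon> * normal_density 0 D x))"
      unfolding f_def D_def by (intro mult_left_mono convolution_model_le[OF h \<epsilon>(1,2) S0 hle \<kappa> nle]) simp
    also have "\<dots> = (1 + \<kappa>) * (1 - \<epsilon>) * (\<bar>x\<bar> powr q * normal_density 0 \<tau> x) + (1 + \<kappa>) * \<epsilon> * (\<bar>x\<bar> powr q * normal_density 0 D x)"
      by (simp add: algebra_simps)
    finally show "ennreal (\<bar>x\<bar> powr q * f x) \<le> ennreal ((1 + \<kappa>) * (1 - \<epsilon>)) * ennreal (\<bar>x\<bar> powr q * normal_density 0 \<tau> x)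
           + ennreal ((1 + \<kappa>) * \<epsilon>) * ennreal (\<bar>x\<bar> powr q * normal_density 0 D x)"
      using \<kappa> \<epsilon> by (simp add: ennreal_mult[symmetric] ennreal_plus[symmetric] ennreal_leI del: ennreal_plus)
  qed
  also have "\<dots> = ennreal ((1 + \<kappa>) * (1 - \<epsilon>)) * ennreal (\<tau> powr q * Mq) + ennreal ((1 + \<kappa>) * \<epsilon>) * ennreal (D powr q * Mq)"
    unfolding Mq_def nn_integral_abs_powr_normal[OF q \<tau>(1), symmetric] nn_integral_abs_powr_normal[OF q D(1), symmetric]
    by (subst nn_integral_add) (auto simp: nn_integral_cmult)
  also have "\<dots> = ennreal ((1 + \<kappa>) * (1 - \<epsilon>) * (\<tau> powr q * Mq) + (1 + \<kappa>) * \<epsilon> * (D powr q * Mq))"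
    using \<kappa> \<epsilon> Mq by (simp add: ennreal_mult[symmetric] ennreal_plus[symmetric] del: ennreal_plus)
  also have "\<dots> \<le> ennreal (A powr q)"
  proof (rule ennreal_leI)
    have "\<tau> powr q * Mq \<le> D powr q * Mq"
      using D \<tau> q Mq by (intro mult_right_mono powr_mono2) auto
    then have "(1 + \<kappa>) * (1 - \<epsilon>) * (\<tau> powr q * Mq) \<le> (1 + \<kappa>) * (1 - \<epsilon>) * (D powr q * Mq)"
      using \<kappa> \<epsilon> by (intro mult_left_mono) auto
    moreover have "(1 + \<kappa>) * (1 - \<epsilon>) * (D powr q * Mq) + (1 + \<kappa>) * \<epsilon> * (D powr q * Mq) = (1 + \<kappa>) * (D powr q * Mq)"
      by (simp add: algebra_simps)
    ultimately show "(1 + \<kappa>) * (1 - \<epsilon>) * (\<tau> powr q * Mq) + (1 + \<kappa>) * \<epsilon> * (D powr q * Mq) \<le> A powr q"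
      using moment unfolding D_def Mq_def by linarith
  qed
  finally have mom: "(\<integral>\<^sup>+x. ennreal (\<bar>x\<bar> powr q * f x) \<partial>lborel) \<le> ennreal (A powr q)" .
  show "f \<in> param_space \<alpha> \<beta> \<epsilon>0 q a A n"
    unfolding param_space_def eligible_def mem_Collect_eq par using rep tc mom \<epsilon>(3) S(3) by blast
qed

lemma measurable_convolution_model:
  assumes h: "integrable lborel h"
  shows "convolution_model \<epsilon> \<mu> \<sigma>0 s h \<in> borel_measurable borel"
proof -
  have [measurable]: "h \<in> borel_measurable borel" using h by auto
  have "(\<lambda>(x, u). normal_density u s x * h u) \<in> borel_measurable (borel \<Otimes>\<^sub>M lborel)"
    unfolding normal_density_def by measurable
  then have [measurable]: "(\<lambda>x. \<integral>u. normal_density u s x * h u \<partial>lborel) \<in> borel_measurable borel"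
    by (rule lborel.borel_measurable_lebesgue_integral)
  show ?thesis unfolding convolution_model_def[abs_def] by measurable
qed

section \<open>The indistinguishable pair\<close>

definition spectral_gap :: "real \<Rightarrow> real \<Rightarrow> real \<Rightarrow> complex" where
  "spectral_gap \<delta> \<mu> s = null_spectrum 0 0 s - null_spectrum \<delta> \<mu> s"

text \<open>
  The factor \<open>(1 - \<epsilon>) / \<epsilon>\<close> arises because a component of mass \<open>\<epsilon>\<close> has to compensate for a change of the
  null component of mass \<open>1 - \<epsilon>\<close>. It is what makes the admissible separation proportional to \<open>\<epsilon>\<close>.
\<close>
definition gap_weight :: "real \<Rightarrow> real \<Rightarrow> real \<Rightarrow> real \<Rightarrow> real \<Rightarrow> complex" where
  "gap_weight \<epsilon> \<delta> \<mu> T s = indicat_real {-T..T} s *\<^sub>R (of_real ((1 - \<epsilon>) / \<epsilon>) * spectral_gap \<delta> \<mu> s)"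

lemma continuous_null_spectrum [continuous_intros]: "continuous_on UNIV (null_spectrum \<delta> \<mu>)"
  unfolding null_spectrum_def[abs_def] divide_inverse by (intro continuous_intros)

lemma continuous_spectral_gap: "continuous_on UNIV (spectral_gap \<delta> \<mu>)"
  unfolding spectral_gap_def[abs_def] by (intro continuous_intros)

lemma continuous_scaled_spectral_gap: "continuous_on UNIV (\<lambda>s. of_real c * spectral_gap \<delta> \<mu> s)"
  by (intro continuous_intros continuous_spectral_gap)

lemma integrable_gap_weight: "integrable lborel (gap_weight \<epsilon> \<delta> \<mu> T)"
  unfolding gap_weight_def[abs_def] by (rule integrable_window[OF continuous_scaled_spectral_gap])

lemma cmod_null_spectrum:
  "0 \<le> \<delta> \<Longrightarrow> cmod (null_spectrum \<delta> \<mu> s)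
     = exp ((\<delta> / (1 + \<delta>)) * s\<^sup>2 / 2 + \<mu>\<^sup>2 / (2 * (1 + \<delta>))) / sqrt (2 * pi * (1 + \<delta>))"
  unfolding null_spectrum_def norm_mult norm_of_real by simp

lemma sqrt_2pi_ge_2: "2 \<le> sqrt (2 * pi)"
  using pi_gt3 by (intro real_le_rsqrt) auto

lemma one_minus_phase_bound:
  assumes "0 \<le> \<rho>"
  shows "cmod (1 - of_real \<rho> * iexp \<theta>) \<le> \<bar>1 - \<rho>\<bar> + \<rho> * \<bar>\<theta>\<bar>"
proof -
  have "cmod (iexp \<theta> - 1) \<le> \<bar>\<theta>\<bar>"
    using iexp_approx1[of \<theta> 0] by simp
  then have 1: "cmod (of_real \<rho> * (1 - iexp \<theta>)) \<le> \<rho> * \<bar>\<theta>\<bar>"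
    unfolding norm_mult using assms by (auto simp: norm_minus_commute intro!: mult_left_mono)
  have "1 - of_real \<rho> * iexp \<theta> = of_real (1 - \<rho>) + of_real \<rho> * (1 - iexp \<theta>)"
    by (simp add: algebra_simps)
  then have "cmod (1 - of_real \<rho> * iexp \<theta>) \<le> cmod (of_real (1 - \<rho>)) + cmod (of_real \<rho> * (1 - iexp \<theta>))"
    by (simp only:) (rule norm_triangle_ineq)
  then show ?thesis using 1 unfolding norm_of_real by linarith
qed

text \<open>
  Up to the factor \<open>1 / sqrt (2 \<pi>)\<close>, the gap is the deviation from one of a complex number with modulus
  \<open>1 + O(\<delta> T\<^sup>2 + \<mu>)\<close> and phase \<open>O(\<mu> T)\<close>.
\<close>
lemma spectral_gap_bound:
  assumes \<delta>: "0 \<le> \<delta>" and \<mu>: "0 \<le> \<mu>" "\<mu> \<le> 1" and T: "1 \<le> T" and small: "\<delta> * T\<^sup>2 \<le> 1"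
    and s: "\<bar>s\<bar> \<le> T"
  shows "cmod (spectral_gap \<delta> \<mu> s) \<le> 2 * (\<delta> * T\<^sup>2 + \<mu> * T)"
proof -
  define E where "E = (\<delta> / (1 + \<delta>)) * s\<^sup>2 / 2 + \<mu>\<^sup>2 / (2 * (1 + \<delta>))"
  define \<rho> where "\<rho> = exp E / sqrt (1 + \<delta>)"
  have s2: "s\<^sup>2 \<le> T\<^sup>2" using s by (metis abs_le_square_iff abs_of_nonneg T order_trans zero_le_one)
  have T2: "1 \<le> T\<^sup>2" using T by (simp add: one_le_power)
  have dd: "\<delta> \<le> \<delta> * T\<^sup>2" using mult_left_mono[OF T2 \<delta>] by simp
  have E: "0 \<le> E" "E \<le> (\<delta> * T\<^sup>2 + \<mu>) / 2"
  proof -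
    show "0 \<le> E" unfolding E_def using \<delta> by auto
    have "\<delta> / (1 + \<delta>) \<le> \<delta>" using \<delta> by (simp add: divide_le_eq mult_le_cancel_left1 add_increasing)
    then have 1: "(\<delta> / (1 + \<delta>)) * s\<^sup>2 \<le> \<delta> * T\<^sup>2" using s2 \<delta> by (intro mult_mono) auto
    have "\<mu>\<^sup>2 / (1 + \<delta>) \<le> \<mu>\<^sup>2" using \<delta> by (simp add: divide_le_eq mult_le_cancel_left1 add_increasing)
    also have "\<mu>\<^sup>2 \<le> \<mu>" using \<mu> by (simp add: power2_eq_square mult_left_le)
    finally have "\<mu>\<^sup>2 / (1 + \<delta>) \<le> \<mu>" .
    moreover have "\<mu>\<^sup>2 / (2 * z) = (\<mu>\<^sup>2 / z) / 2" for z :: real by simp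
    ultimately have "\<mu>\<^sup>2 / (2 * (1 + \<delta>)) \<le> \<mu> / 2" by (metis divide_right_mono zero_le_numeral)
    moreover have "x / 2 + m \<le> (y + \<mu>) / 2" if "x \<le> y" "m \<le> \<mu> / 2" for x y m :: real
      using that by simp
    ultimately show "E \<le> (\<delta> * T\<^sup>2 + \<mu>) / 2" unfolding E_def using 1 by blast
  qed
  have E1: "E \<le> 1" using E(2) small \<mu> by simp
  have expE: "exp E \<le> 1 + 2 * E"
  proof -
    have "exp E \<le> 1 + E + E\<^sup>2" using E(1) E1 by (intro exp_bound)
    moreover have "E\<^sup>2 \<le> E" using E(1) E1 by (simp add: power2_eq_square mult_left_le)
    ultimately show ?thesis by linarith
  qed
  have sq: "1 \<le> sqrt (1 + \<delta>)" using \<delta> by simp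
  have \<rho>0: "0 \<le> \<rho>" unfolding \<rho>_def using sq by simp
  have \<rho>u: "\<rho> \<le> 1 + 2 * E"
  proof -
    have "\<rho> \<le> exp E" unfolding \<rho>_def using sq by (simp add: divide_le_eq mult_le_cancel_left1)
    then show ?thesis using expE by linarith
  qed
  have \<rho>l: "1 - \<delta> \<le> \<rho>"
  proof -
    have "sqrt (1 + \<delta>) \<le> 1 + \<delta>" using \<delta> by (intro real_le_lsqrt) (auto simp: power2_eq_square algebra_simps)
    then have "(1 - \<delta>) * sqrt (1 + \<delta>) \<le> 1" if "\<delta> \<le> 1"
    proof -
      have "(1 - \<delta>) * sqrt (1 + \<delta>) \<le> (1 - \<delta>) * (1 + \<delta>)"
        using \<open>sqrt (1 + \<delta>) \<le> 1 + \<delta>\<close> that by (intro mult_left_mono) auto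
      also have "\<dots> \<le> 1" by (simp add: algebra_simps)
      finally show ?thesis .
    qed
    then have "(1 - \<delta>) * sqrt (1 + \<delta>) \<le> exp E"
      using dd small E(1) one_le_exp_iff[of E] by linarith
    then show ?thesis unfolding \<rho>_def using sq by (simp add: le_divide_eq)
  qed
  have 1: "\<bar>1 - \<rho>\<bar> \<le> \<delta> * T\<^sup>2 + \<mu>" using \<rho>u \<rho>l E dd \<mu> by (auto simp: abs_le_iff)
  have \<rho>3: "\<rho> \<le> 3" using \<rho>u E1 by linarith
  have \<theta>: "\<bar>s * (- \<mu> / (1 + \<delta>))\<bar> \<le> T * \<mu>"
  proof -
    have "\<mu> / (1 + \<delta>) \<le> \<mu>" using \<delta> \<mu> by (simp add: divide_le_eq mult_le_cancel_left1)
    then have "\<bar>s\<bar> * (\<mu> / (1 + \<delta>)) \<le> T * \<mu>" using s \<delta> \<mu> T by (intro mult_mono) auto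
    then show ?thesis using \<delta> \<mu> by (simp add: abs_mult)
  qed
  have "\<rho> * \<bar>s * (- \<mu> / (1 + \<delta>))\<bar> \<le> 3 * (T * \<mu>)"
    using \<rho>3 \<theta> \<rho>0 by (intro mult_mono) auto
  moreover have "\<mu> \<le> T * \<mu>" using mult_right_mono[OF T \<mu>(1)] by simp
  moreover have "0 \<le> \<delta> * T\<^sup>2" using \<delta> by simp
  moreover have "\<mu> * T = T * \<mu>" by simp
  moreover have "x + y \<le> 4 * (d + m)" if "y \<le> 3 * p" "\<mu> \<le> p" "0 \<le> d" "m = p" "x \<le> d + \<mu>" for x y d m p :: real
    using that by (simp add: algebra_simps)
  ultimately have "\<bar>1 - \<rho>\<bar> + \<rho> * \<bar>s * (- \<mu> / (1 + \<delta>))\<bar> \<le> 4 * (\<delta> * T\<^sup>2 + \<mu> * T)"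
    using 1 by blast
  with one_minus_phase_bound[OF \<rho>0]
  have 2: "cmod (1 - of_real \<rho> * iexp (s * (- \<mu> / (1 + \<delta>)))) \<le> 4 * (\<delta> * T\<^sup>2 + \<mu> * T)"
    by (rule order_trans)
  have "spectral_gap \<delta> \<mu> s = (1 - of_real \<rho> * iexp (s * (- \<mu> / (1 + \<delta>)))) / of_real (sqrt (2 * pi))"
  proof -
    have "sqrt (2 * pi * (1 + \<delta>)) = sqrt (1 + \<delta>) * sqrt (2 * pi)"
      by (simp only: real_sqrt_mult[symmetric] mult.commute)
    then show ?thesis
      unfolding spectral_gap_def null_spectrum_def \<rho>_def E_def[symmetric]
      by (simp add: diff_divide_distrib mult_ac)
  qed
  then have "cmod (spectral_gap \<delta> \<mu> s) = cmod (1 - of_real \<rho> * iexp (s * (- \<mu> / (1 + \<delta>)))) / sqrt (2 * pi)"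
    by (simp only: norm_divide norm_of_real) simp
  also have "\<dots> \<le> 4 * (\<delta> * T\<^sup>2 + \<mu> * T) / 2"
    using 2 order_trans[OF norm_ge_zero 2] sqrt_2pi_ge_2 by (intro frac_le) auto
  finally show ?thesis by simp
qed

lemma gap_weight_mass:
  assumes \<epsilon>: "0 < \<epsilon>" "\<epsilon> < 1" and \<delta>: "0 \<le> \<delta>" and \<mu>: "0 \<le> \<mu>" "\<mu> \<le> 1" and T: "1 \<le> T"
    and small: "\<delta> * T\<^sup>2 \<le> 1"
  shows "2 * (\<integral>s. cmod (gap_weight \<epsilon> \<delta> \<mu> T s) \<partial>lborel) \<le> 8 * (\<delta> * T ^ 3 + \<mu> * T\<^sup>2) / \<epsilon>"
proof -
  define B where "B = (1 / \<epsilon>) * (2 * (\<delta> * T\<^sup>2 + \<mu> * T))"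
  have B: "0 \<le> B" unfolding B_def using \<epsilon> \<delta> \<mu> T by auto
  have "(\<integral>s. cmod (gap_weight \<epsilon> \<delta> \<mu> T s) \<partial>lborel) \<le> (\<integral>s. B * indicat_real {-T..T} s \<partial>lborel)"
  proof (rule integral_mono)
    show "integrable lborel (\<lambda>s. cmod (gap_weight \<epsilon> \<delta> \<mu> T s))"
      by (rule integrable_norm[OF integrable_gap_weight])
    show "integrable lborel (\<lambda>s. B * indicat_real {-T..T} s)"
      using finite_indicator_integrable[of UNIV T] by (intro integrable_mult_right) simp
    fix s
    show "cmod (gap_weight \<epsilon> \<delta> \<mu> T s) \<le> B * indicat_real {-T..T} s"
    proof (cases "s \<in> {-T..T}")
      case True
      then have "\<bar>s\<bar> \<le> T" by auto
      have "\<bar>(1 - \<epsilon>) / \<epsilon>\<bar> \<le> 1 / \<epsilon>" using \<epsilon> by (simp add: divide_right_mono)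
      then have "cmod (of_real ((1 - \<epsilon>) / \<epsilon>) * spectral_gap \<delta> \<mu> s) \<le> B"
        unfolding norm_mult norm_of_real B_def
        using spectral_gap_bound[OF \<delta> \<mu> T small \<open>\<bar>s\<bar> \<le> T\<close>] \<epsilon> by (intro mult_mono) auto
      then show ?thesis unfolding gap_weight_def using True by simp
    qed (simp add: gap_weight_def)
  qed
  also have "\<dots> = B * (2 * T)" using T by simp
  finally have "2 * (\<integral>s. cmod (gap_weight \<epsilon> \<delta> \<mu> T s) \<partial>lborel) \<le> 2 * (B * (2 * T))" by simp
  also have "\<dots> = 8 * (\<delta> * T ^ 3 + \<mu> * T\<^sup>2) / \<epsilon>"
    unfolding B_def using \<epsilon> by (simp add: field_simps power2_eq_square power3_eq_cube)
  finally show ?thesis .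
qed

text \<open>
  After smoothing, the growth of the weight and the damping \<open>S / (1 + S) \<le> 1\<close> combine to a Gaussian
  of rate at least \<open>a\<^sup>2 / ((1 + S) (1 + \<delta>))\<close>, and \<open>\<delta> \<le> 1\<close> bounds this below by the constant \<open>b\<close>. The
  centring term has damping rate one and is smaller still.
\<close>
lemma spectral_gap_times_wave_bound:
  assumes a: "0 < a" and \<delta>: "0 \<le> \<delta>" "\<delta> \<le> 1" and \<mu>: "0 \<le> \<mu>" "\<mu> \<le> 1"
  defines "S \<equiv> a\<^sup>2 + \<delta>" and "b \<equiv> a\<^sup>2 / (2 * (2 + a\<^sup>2))"
  shows "cmod (spectral_gap \<delta> \<mu> s * (of_real (exp (- (S / (1 + S)) * s\<^sup>2 / 2)) * iexp (s * r) - of_real (exp (- s\<^sup>2 / 2))))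
     \<le> 4 * exp (- b * s\<^sup>2 / 2)"
proof -
  define v where "v = S / (1 + S)"
  have S: "0 < S" unfolding S_def using a \<delta> by (simp add: add_pos_nonneg)
  have v: "v \<le> 1" unfolding v_def using S by simp
  have bv: "b \<le> v - \<delta> / (1 + \<delta>)"
  proof -
    have "v - \<delta> / (1 + \<delta>) = (S * (1 + \<delta>) - \<delta> * (1 + S)) / ((1 + S) * (1 + \<delta>))"
      unfolding v_def using S \<delta> by (simp add: field_simps)
    also have "S * (1 + \<delta>) - \<delta> * (1 + S) = a\<^sup>2" unfolding S_def by (simp add: algebra_simps)
    finally have "v - \<delta> / (1 + \<delta>) = a\<^sup>2 / ((1 + S) * (1 + \<delta>))" .
    moreover have "(1 + S) * (1 + \<delta>) \<le> (2 + a\<^sup>2) * 2" using S \<delta> unfolding S_def by (intro mult_mono) auto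
    moreover have "0 < (1 + S) * (1 + \<delta>)" using S \<delta> by simp
    ultimately show ?thesis unfolding b_def by (simp only:) (intro frac_le, auto simp: mult.commute)
  qed
  have \<delta>': "0 \<le> \<delta> / (1 + \<delta>)" using \<delta> by simp
  have wave: "cmod (of_real (exp (- v * s\<^sup>2 / 2)) * iexp (s * r) - of_real (exp (- s\<^sup>2 / 2))) \<le> 2 * exp (- v * s\<^sup>2 / 2)"
  proof -
    have "exp (- s\<^sup>2 / 2) \<le> exp (- v * s\<^sup>2 / 2)" using mult_right_mono[OF v, of "s\<^sup>2"] by simp
    moreover have "cmod (of_real (exp (- v * s\<^sup>2 / 2)) * iexp (s * r)) = exp (- v * s\<^sup>2 / 2)"
      unfolding norm_mult norm_of_real by simp
    moreover have "cmod (of_real (exp (- s\<^sup>2 / 2))) = exp (- s\<^sup>2 / 2)" unfolding norm_of_real by simp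
    ultimately show ?thesis
      using norm_triangle_ineq4[of "of_real (exp (- v * s\<^sup>2 / 2)) * iexp (s * r)" "of_real (exp (- s\<^sup>2 / 2))"] by linarith
  qed
  have Q: "cmod (null_spectrum \<delta>' \<mu>' s) * exp (- v * s\<^sup>2 / 2) \<le> exp (\<mu>'\<^sup>2 / 2) / 2 * exp (- b * s\<^sup>2 / 2)"
    if "0 \<le> \<delta>'" "\<delta>' / (1 + \<delta>') \<le> \<delta> / (1 + \<delta>)" for \<delta>' \<mu>' :: real
  proof -
    have "b + \<delta>' / (1 + \<delta>') \<le> v" using bv that by linarith
    then have "(b + \<delta>' / (1 + \<delta>')) * s\<^sup>2 \<le> v * s\<^sup>2" by (rule mult_right_mono) simp
    moreover have "\<mu>'\<^sup>2 / (2 * (1 + \<delta>')) \<le> \<mu>'\<^sup>2 / 2" using that by (intro divide_left_mono) auto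
    ultimately
    have "(\<delta>' / (1 + \<delta>')) * s\<^sup>2 / 2 + \<mu>'\<^sup>2 / (2 * (1 + \<delta>')) + - v * s\<^sup>2 / 2 \<le> \<mu>'\<^sup>2 / 2 + - b * s\<^sup>2 / 2"
    proof -
      have "d * s\<^sup>2 / 2 + m + - v * s\<^sup>2 / 2 \<le> m' + - b * s\<^sup>2 / 2"
        if "(b + d) * s\<^sup>2 \<le> v * s\<^sup>2" "m \<le> m'" for d m m' :: real
        using that by (simp add: distrib_right)
      then show ?thesis using \<open>(b + \<delta>' / (1 + \<delta>')) * s\<^sup>2 \<le> v * s\<^sup>2\<close>
          \<open>\<mu>'\<^sup>2 / (2 * (1 + \<delta>')) \<le> \<mu>'\<^sup>2 / 2\<close> by blast
    qed
    then have e: "exp ((\<delta>' / (1 + \<delta>')) * s\<^sup>2 / 2 + \<mu>'\<^sup>2 / (2 * (1 + \<delta>'))) * exp (- v * s\<^sup>2 / 2) \<le> exp (\<mu>'\<^sup>2 / 2) * exp (- b * s\<^sup>2 / 2)"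
      unfolding exp_add[symmetric] by simp
    have "2 \<le> sqrt (2 * pi * (1 + \<delta>'))"
      using that by (intro order_trans[OF sqrt_2pi_ge_2]) simp
    then have "exp ((\<delta>' / (1 + \<delta>')) * s\<^sup>2 / 2 + \<mu>'\<^sup>2 / (2 * (1 + \<delta>'))) * exp (- v * s\<^sup>2 / 2) / sqrt (2 * pi * (1 + \<delta>'))
       \<le> exp (\<mu>'\<^sup>2 / 2) * exp (- b * s\<^sup>2 / 2) / 2"
      using e by (intro frac_le) auto
    then show ?thesis unfolding cmod_null_spectrum[OF that(1)] by simp
  qed
  have "cmod (spectral_gap \<delta> \<mu> s) * exp (- v * s\<^sup>2 / 2) \<le>
     cmod (null_spectrum 0 0 s) * exp (- v * s\<^sup>2 / 2) + cmod (null_spectrum \<delta> \<mu> s) * exp (- v * s\<^sup>2 / 2)"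
    unfolding spectral_gap_def distrib_right[symmetric] by (intro mult_right_mono norm_triangle_ineq4) simp
  also have "\<dots> \<le> exp (0\<^sup>2 / 2) / 2 * exp (- b * s\<^sup>2 / 2) + exp (\<mu>\<^sup>2 / 2) / 2 * exp (- b * s\<^sup>2 / 2)"
    using \<delta> \<delta>' by (intro add_mono Q) auto
  also have "\<dots> \<le> 2 * exp (- b * s\<^sup>2 / 2)"
  proof -
    have "\<mu>\<^sup>2 \<le> 1" using \<mu> by (simp add: power_le_one)
    then have "exp (\<mu>\<^sup>2 / 2) \<le> exp 1" by simp
    then have "exp (\<mu>\<^sup>2 / 2) \<le> 3" using exp_le by linarith
    then have "exp (0\<^sup>2 / 2) / 2 + exp (\<mu>\<^sup>2 / 2) / 2 \<le> 2" by simp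
    then show ?thesis unfolding distrib_right[symmetric] by (rule mult_right_mono) simp
  qed
  finally have 2: "cmod (spectral_gap \<delta> \<mu> s) * exp (- v * s\<^sup>2 / 2) \<le> 2 * exp (- b * s\<^sup>2 / 2)" .
  show ?thesis unfolding v_def[symmetric] norm_mult[of "spectral_gap \<delta> \<mu> s"]
    using mult_left_mono[OF wave norm_ge_zero[of "spectral_gap \<delta> \<mu> s"]] 2 by linarith
qed

text \<open>
  Half of the exponent is spent on the factor \<open>exp (- b T\<^sup>2 / 4)\<close>, the other half on integrability.
\<close>
lemma gaussian_tail_integral:
  assumes b: "0 < b" and T: "0 \<le> T"
  shows "integrable lborel (\<lambda>s. indicat_real (- {-T..T}) s * exp (- b * s\<^sup>2 / 2))"
    and "(\<integral>s. indicat_real (- {-T..T}) s * exp (- b * s\<^sup>2 / 2) \<partial>lborel) \<le> exp (- b * T\<^sup>2 / 4) * sqrt (4 * pi / b)"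
proof -
  have i: "integrable lborel (\<lambda>s. exp (- c * s\<^sup>2 / 2))" "(\<integral>s. exp (- c * s\<^sup>2 / 2) \<partial>lborel) = sqrt (2 * pi / c)" if "0 < c" for c :: real
    unfolding gaussian_eq_normal_density[OF that] using that by auto
  show I: "integrable lborel (\<lambda>s. indicat_real (- {-T..T}) s * exp (- b * s\<^sup>2 / 2))"
    using integrable_mult_indicator[of "- {-T..T}" lborel, OF _ i(1)[OF b]] by simp
  have "(\<integral>s. indicat_real (- {-T..T}) s * exp (- b * s\<^sup>2 / 2) \<partial>lborel)
     \<le> (\<integral>s. exp (- b * T\<^sup>2 / 4) * exp (- (b / 2) * s\<^sup>2 / 2) \<partial>lborel)"
  proof (rule integral_mono[OF I])
    show "integrable lborel (\<lambda>s. exp (- b * T\<^sup>2 / 4) * exp (- (b / 2) * s\<^sup>2 / 2))"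
      using b by (intro integrable_mult_right i(1)) simp
    fix s :: real
    show "indicat_real (- {-T..T}) s * exp (- b * s\<^sup>2 / 2) \<le> exp (- b * T\<^sup>2 / 4) * exp (- (b / 2) * s\<^sup>2 / 2)"
    proof (cases "s \<in> {-T..T}")
      case False
      then have "T \<le> \<bar>s\<bar>" by auto
      then have "T\<^sup>2 \<le> s\<^sup>2" using T by (metis abs_le_square_iff abs_of_nonneg)
      then have "b * T\<^sup>2 \<le> b * s\<^sup>2" using b by (intro mult_left_mono) auto
      then have "- b * s\<^sup>2 / 2 \<le> - b * T\<^sup>2 / 4 + - (b / 2) * s\<^sup>2 / 2" by simp
      then have "exp (- b * s\<^sup>2 / 2) \<le> exp (- b * T\<^sup>2 / 4) * exp (- (b / 2) * s\<^sup>2 / 2)"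
        unfolding exp_add[symmetric] by simp
      then show ?thesis using False by simp
    qed simp
  qed
  also have "\<dots> = exp (- b * T\<^sup>2 / 4) * sqrt (4 * pi / b)"
    unfolding integral_mult_right_zero using b by (subst i(2)) (auto simp: field_simps)
  finally show "(\<integral>s. indicat_real (- {-T..T}) s * exp (- b * s\<^sup>2 / 2) \<partial>lborel) \<le> exp (- b * T\<^sup>2 / 4) * sqrt (4 * pi / b)" .
qed

text \<open>
  The untruncated tilt would reproduce the first model exactly, by \<open>normal_density_spectral\<close> applied to
  both null densities and \<open>null_spectrum_mass\<close> for the centring terms. What remains of
  \<open>f1 - f0\<close> is the contribution of the discarded frequencies, at most a small multiple of
  the normal density of variance \<open>1 + S\<close>.
\<close>
lemma convolution_model_gap:
  assumes a: "0 < a" and \<epsilon>: "0 < \<epsilon>" "\<epsilon> < 1" and \<delta>: "0 \<le> \<delta>" "\<delta> \<le> 1" and \<mu>: "0 \<le> \<mu>" "\<mu> \<le> 1" and T: "0 \<le> T"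
  defines "S \<equiv> a\<^sup>2 + \<delta>" and "b \<equiv> a\<^sup>2 / (2 * (2 + a\<^sup>2))"
  defines "f0 \<equiv> convolution_model \<epsilon> 0 (sqrt S) (sqrt S) std_normal_density"
    and "f1 \<equiv> convolution_model \<epsilon> \<mu> a (sqrt S) (tilted_normal (gap_weight \<epsilon> \<delta> \<mu> T))"
  shows "f0 x - 4 * exp (- b * T\<^sup>2 / 4) * sqrt (4 * pi / b) * normal_density 0 (sqrt (1 + S)) x \<le> f1 x"
proof -
  have S: "0 < S" unfolding S_def using a \<delta> by (simp add: add_pos_nonneg)
  have b: "0 < b" unfolding b_def using a by (simp add: add_pos_pos)
  define N where "N = normal_density 0 (sqrt (1 + S)) x"
  have N: "0 < N" unfolding N_def using S by (intro normal_density_pos) simp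
  define W where "W = gap_weight \<epsilon> \<delta> \<mu> T"
  define w where "w = (\<lambda>s. complex_of_real (exp (- (S / (1 + S)) * s\<^sup>2 / 2)) * iexp (s * (x / (1 + S))))"
  \<comment> \<open>the integrand of the smoothed tilt; its integral over all frequencies is known in closed form\<close>
  define K where "K = (\<lambda>s. spectral_gap \<delta> \<mu> s * (w s - of_real (exp (- s\<^sup>2 / 2))))"
  have split: "K s = null_spectrum 0 0 s * w s - null_spectrum \<delta> \<mu> s * w s
      - (null_spectrum 0 0 s * of_real (exp (- s\<^sup>2 / 2)) - null_spectrum \<delta> \<mu> s * of_real (exp (- s\<^sup>2 / 2)))" for s
    unfolding K_def spectral_gap_def by (simp add: algebra_simps)
  have sqS: "sqrt S ^ 2 + 0 = S" using S by simp
  have sp1: "integrable lborel (\<lambda>s. null_spectrum \<delta> \<mu> s * w s)"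
    "of_real N * (\<integral>s. null_spectrum \<delta> \<mu> s * w s \<partial>lborel) = of_real (normal_density \<mu> a x)"
    using normal_density_spectral[OF a \<delta>(1), where \<mu>=\<mu> and x=x] unfolding S_def w_def N_def by auto
  have sp0: "integrable lborel (\<lambda>s. null_spectrum 0 0 s * w s)"
    "of_real N * (\<integral>s. null_spectrum 0 0 s * w s \<partial>lborel) = of_real (normal_density 0 (sqrt S) x)"
    using normal_density_spectral[where a="sqrt S" and \<delta>=0 and \<mu>=0 and x=x] S
    unfolding sqS w_def N_def by auto
  have iK: "integrable lborel K"
    unfolding split using sp0(1) sp1(1) null_spectrum_mass(1)[of 0 0] null_spectrum_mass(1)[OF \<delta>(1), of \<mu>]
    by (intro Bochner_Integration.integrable_diff) auto
  have "(\<integral>s. K s \<partial>lborel) = (\<integral>s. null_spectrum 0 0 s * w s \<partial>lborel) - (\<integral>s. null_spectrum \<delta> \<mu> s * w s \<partial>lborel)"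
    unfolding split using sp0(1) sp1(1) null_spectrum_mass[of 0 0] null_spectrum_mass[OF \<delta>(1), of \<mu>]
    by (simp add: Bochner_Integration.integral_diff Bochner_Integration.integrable_diff del: of_real_exp)
  then have "of_real N * (\<integral>s. K s \<partial>lborel) = of_real (normal_density 0 (sqrt S) x) - of_real (normal_density \<mu> a x)"
    using sp0(2) sp1(2) by (simp add: right_diff_distrib)
  then have full: "N * Re (\<integral>s. K s \<partial>lborel) = normal_density 0 (sqrt S) x - normal_density \<mu> a x"
    by (metis Re_complex_of_real of_real_diff times_complex.sel(1) Im_complex_of_real mult_zero_left diff_zero)
  \<comment> \<open>the discarded frequencies\<close>
  define R where "R = (\<integral>s. indicat_real (- {-T..T}) s *\<^sub>R K s \<partial>lborel)"
  have iR: "integrable lborel (\<lambda>s. indicat_real (- {-T..T}) s *\<^sub>R K s)"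
    by (rule integrable_mult_indicator[OF _ iK]) simp
  have iI: "integrable lborel (\<lambda>s. indicat_real {-T..T} s *\<^sub>R K s)"
    by (rule integrable_mult_indicator[OF _ iK]) simp
  have "cmod R \<le> (\<integral>s. 4 * (indicat_real (- {-T..T}) s * exp (- b * s\<^sup>2 / 2)) \<partial>lborel)"
    unfolding R_def
  proof (rule order_trans[OF integral_norm_bound integral_mono])
    show "integrable lborel (\<lambda>s. cmod (indicat_real (- {-T..T}) s *\<^sub>R K s))" by (rule integrable_norm[OF iR])
    show "integrable lborel (\<lambda>s. 4 * (indicat_real (- {-T..T}) s * exp (- b * s\<^sup>2 / 2)))"
      by (rule integrable_mult_right[OF gaussian_tail_integral(1)[OF b T]])
    fix s
    have "cmod (K s) \<le> 4 * exp (- b * s\<^sup>2 / 2)"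
      unfolding K_def w_def S_def b_def by (rule spectral_gap_times_wave_bound[OF a \<delta> \<mu>])
    then show "cmod (indicat_real (- {-T..T}) s *\<^sub>R K s) \<le> 4 * (indicat_real (- {-T..T}) s * exp (- b * s\<^sup>2 / 2))"
      by (simp add: indicator_def)
  qed
  also have "\<dots> \<le> 4 * (exp (- b * T\<^sup>2 / 4) * sqrt (4 * pi / b))"
    unfolding integral_mult_right_zero by (intro mult_left_mono gaussian_tail_integral(2)[OF b T]) simp
  finally have R: "Re R \<le> 4 * exp (- b * T\<^sup>2 / 4) * sqrt (4 * pi / b)"
    using complex_Re_le_cmod[of R] by linarith
  have "(\<integral>s. indicat_real {-T..T} s *\<^sub>R K s \<partial>lborel) = (\<integral>s. K s - indicat_real (- {-T..T}) s *\<^sub>R K s \<partial>lborel)"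
    by (rule Bochner_Integration.integral_cong[OF refl]) (simp add: indicator_def)
  also have "\<dots> = (\<integral>s. K s \<partial>lborel) - R"
    unfolding R_def by (rule Bochner_Integration.integral_diff[OF iK iR])
  finally have trunc: "(\<integral>s. indicat_real {-T..T} s *\<^sub>R K s \<partial>lborel) = (\<integral>s. K s \<partial>lborel) - R" .
  have "W s * (w s - of_real (exp (- s\<^sup>2 / 2))) = of_real ((1 - \<epsilon>) / \<epsilon>) * (indicat_real {-T..T} s *\<^sub>R K s)" for s
    unfolding W_def gap_weight_def K_def by (simp add: scaleR_conv_of_real mult_ac)
  then have "(\<integral>s. W s * (w s - of_real (exp (- s\<^sup>2 / 2))) \<partial>lborel) = of_real ((1 - \<epsilon>) / \<epsilon>) * ((\<integral>s. K s \<partial>lborel) - R)"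
    by (simp only: integral_mult_right_zero trunc)
  then have ReW: "Re (\<integral>s. W s * (w s - of_real (exp (- s\<^sup>2 / 2))) \<partial>lborel) = (1 - \<epsilon>) / \<epsilon> * (Re (\<integral>s. K s \<partial>lborel) - Re R)"
    by (simp only: Re_complex_of_real times_complex.sel Im_complex_of_real mult_zero_left diff_zero minus_complex.sel)
  have W: "integrable lborel W" unfolding W_def by (rule integrable_gap_weight)
  have "(\<integral>u. normal_density u (sqrt S) x * tilted_normal W u \<partial>lborel) =
     N * (1 + (1 - \<epsilon>) / \<epsilon> * (Re (\<integral>s. K s \<partial>lborel) - Re R))"
    unfolding normal_smoothing_of_tilted_normal[OF W S] N_def[symmetric] w_def[symmetric]
    using ReW unfolding w_def by simp
  then have "\<epsilon> * (\<integral>u. normal_density u (sqrt S) x * tilted_normal W u \<partial>lborel)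
     = \<epsilon> * N + (1 - \<epsilon>) * (N * Re (\<integral>s. K s \<partial>lborel)) - (1 - \<epsilon>) * (N * Re R)"
    using \<epsilon> by (simp add: field_simps)
  then have f1: "f1 x = \<epsilon> * N + (1 - \<epsilon>) * normal_density 0 (sqrt S) x - (1 - \<epsilon>) * (N * Re R)"
    unfolding f1_def convolution_model_def W_def[symmetric] full by (simp add: algebra_simps)
  have f0: "f0 x = \<epsilon> * N + (1 - \<epsilon>) * normal_density 0 (sqrt S) x"
    unfolding f0_def convolution_model_def normal_density_product[OF S] N_def using S by simp
  define r where "r = 4 * exp (- b * T\<^sup>2 / 4) * sqrt (4 * pi / b)"
  have r: "0 \<le> r" unfolding r_def using b by simp
  have "(1 - \<epsilon>) * (N * Re R) \<le> 1 * (N * r)"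
  proof -
    have "(1 - \<epsilon>) * (N * Re R) \<le> (1 - \<epsilon>) * (N * r)"
      using R N \<epsilon> unfolding r_def[symmetric] by (intro mult_left_mono) auto
    also have "\<dots> \<le> 1 * (N * r)" using N r \<epsilon> by (intro mult_right_mono) auto
    finally show ?thesis .
  qed
  then show ?thesis unfolding f0 f1 r_def[symmetric] N_def[symmetric] by (simp add: mult.commute)
qed

section \<open>Rates\<close>

text \<open>
  The number \<open>\<kappa>\<close> bounds both ways in which the models can exceed centred Gaussians: the tilt of \<open>h\<close> and
  the shift of the null mean; \<open>\<kappa> \<le> 1\<close> makes \<open>h\<close> nonnegative. For the affinity, both densities dominate
  \<open>f0\<close> minus the small multiple of a normal density from \<open>convolution_model_gap\<close>, and this function
  has an explicit integral.
\<close>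
lemma indistinguishable_pair:
  fixes a \<epsilon> \<epsilon>0 \<delta> \<mu> T \<kappa> q A \<alpha> \<beta> :: real and n :: nat
  assumes a: "0 < a" and \<epsilon>: "0 < \<epsilon>" "\<epsilon> < 1" "\<epsilon> \<le> \<epsilon>0 * real n powr (- \<beta>)"
    and \<delta>: "0 \<le> \<delta>" "\<delta> \<le> 1" and \<mu>: "0 \<le> \<mu>" "\<mu> \<le> 1" and T: "1 \<le> T" "\<delta> * T\<^sup>2 \<le> 1"
    and \<kappa>: "8 * (\<delta> * T ^ 3 + \<mu> * T\<^sup>2) / \<epsilon> \<le> \<kappa>" "\<kappa> \<le> 1"
    and shift: "sqrt (1 + \<mu>) * exp (\<mu> / (2 * a\<^sup>2)) \<le> 1 + \<kappa>" "a\<^sup>2 * \<mu> \<le> 1"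
    and moment: "(1 + \<kappa>) * (sqrt (1 + (a\<^sup>2 + \<delta>)) powr q * abs_normal_moment q) \<le> A powr q"
    and q: "0 < q" and A: "0 < A"
  defines "F \<equiv> param_space \<alpha> \<beta> \<epsilon>0 q a A n" and "b \<equiv> a\<^sup>2 / (2 * (2 + a\<^sup>2))"
  obtains f0 f1 where "f0 \<in> F" "f1 \<in> F"
    and "null_mean f0 = 0" "(null_sd f0)\<^sup>2 = a\<^sup>2 + \<delta>" "null_mean f1 = \<mu>" "(null_sd f1)\<^sup>2 = a\<^sup>2"
    and "f0 \<in> borel_measurable borel" "f1 \<in> borel_measurable borel"
    and "ennreal (1 - 4 * exp (- b * T\<^sup>2 / 4) * sqrt (4 * pi / b))
        \<le> (\<integral>\<^sup>+x. min (ennreal (f0 x)) (ennreal (f1 x)) \<partial>lborel)"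
proof -
  define S where "S = a\<^sup>2 + \<delta>"
  have S: "0 < S" "a\<^sup>2 \<le> S" unfolding S_def using a \<delta> by (simp_all add: add_pos_nonneg)
  have \<kappa>0: "0 \<le> \<kappa>"
  proof -
    have "1 \<le> sqrt (1 + \<mu>)" "1 \<le> exp (\<mu> / (2 * a\<^sup>2))" using \<mu> a by auto
    then have "1 * 1 \<le> sqrt (1 + \<mu>) * exp (\<mu> / (2 * a\<^sup>2))" by (intro mult_mono) auto
    then show ?thesis using shift(1) by linarith
  qed
  define W where "W = gap_weight \<epsilon> \<delta> \<mu> T"
  define h where "h = tilted_normal W"
  have W: "integrable lborel W" unfolding W_def by (rule integrable_gap_weight)
  have Wm: "2 * (\<integral>s. cmod (W s) \<partial>lborel) \<le> \<kappa>"
    unfolding W_def using gap_weight_mass[OF \<epsilon>(1,2) \<delta>(1) \<mu> T] \<kappa>(1) by (rule order_trans)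
  note h = integral_tilted_normal[OF W, folded h_def] and hb = tilted_normal_bounds[OF W Wm, folded h_def]
  have h0: "0 \<le> h u" for u using hb(2)[OF \<kappa>(2)] .
  have hint: "integrable lborel h" "(\<integral>u. h u \<partial>lborel) = 1"
    using h unfolding h_def by simp_all
  have htail: "fast_decay_deriv (\<lambda>t. \<integral>u. iexp (t * u) * complex_of_real (h u) \<partial>lborel)"
    unfolding h_def W_def gap_weight_def[abs_def] using T
    by (intro fast_decay_tilted_normal continuous_scaled_spectral_gap) simp
  define \<phi> :: "real \<Rightarrow> real" where "\<phi> = std_normal_density"
  have \<phi>: "integrable lborel \<phi>" "\<And>u. 0 \<le> \<phi> u" "(\<integral>u. \<phi> u \<partial>lborel) = 1" by (simp_all add: \<phi>_def)
  have \<phi>le: "\<phi> u \<le> (1 + \<kappa>) * std_normal_density u" for u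
    using mult_right_mono[of 1 "1 + \<kappa>" "std_normal_density u"] \<kappa>0 by (simp add: \<phi>_def)
  have \<phi>tail: "fast_decay_deriv (\<lambda>t. \<integral>u. iexp (t * u) * complex_of_real (\<phi> u) \<partial>lborel)"
  proof -
    have "(\<lambda>t. \<integral>u. iexp (t * u) * complex_of_real (\<phi> u) \<partial>lborel) = (\<lambda>t. of_real (exp (- t\<^sup>2 / 2)))"
      unfolding \<phi>_def by (subst mult.commute) (simp only: std_normal_fourier(2))
    then show ?thesis using fast_decay_deriv_gaussian by simp
  qed
  define f0 where "f0 = convolution_model \<epsilon> 0 (sqrt S) (sqrt S) \<phi>"
  define f1 where "f1 = convolution_model \<epsilon> \<mu> a (sqrt S) h"
  have mom: "(1 + \<kappa>) * (sqrt (1 + S) powr q * abs_normal_moment q) \<le> A powr q"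
    using moment unfolding S_def .
  have asS: "a \<le> sqrt S" using S a by (intro real_le_rsqrt) auto
  have nle0: "normal_density 0 (sqrt S) x \<le> (1 + \<kappa>) * normal_density 0 (sqrt S) x" for x
    using mult_right_mono[of 1 "1 + \<kappa>" "normal_density 0 (sqrt S) x"] \<kappa>0 by simp
  have F0: "f0 \<in> F" "null_mean f0 = 0" "null_sd f0 = sqrt S"
    unfolding F_def f0_def
    using convolution_model_in_param_space[OF \<phi> \<epsilon> _ _ asS \<phi>le \<kappa>0 nle0 _ _ mom q \<phi>tail A] S by auto
  have nle1: "normal_density \<mu> a x \<le> (1 + \<kappa>) * normal_density 0 (a * sqrt (1 + \<mu>)) x" for x
    by (rule order_trans[OF shifted_normal_le_wider_normal[OF \<mu>(1) a]], rule mult_right_mono[OF shift(1)]) simp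
  have \<tau>: "0 < a * sqrt (1 + \<mu>)" "(a * sqrt (1 + \<mu>))\<^sup>2 \<le> 1 + S"
    using a \<mu> shift(2) \<delta> unfolding S_def by (auto simp: power_mult_distrib distrib_left)
  have F1: "f1 \<in> F" "null_mean f1 = \<mu>" "null_sd f1 = a"
    unfolding F_def f1_def
    using convolution_model_in_param_space[OF hint(1) h0 hint(2) \<epsilon> a S(2) order_refl hb(1) \<kappa>0 nle1 \<tau> mom q htail A] by auto
  have meas: "f0 \<in> borel_measurable borel" "f1 \<in> borel_measurable borel"
    unfolding f0_def f1_def by (intro measurable_convolution_model \<phi> hint)+
  define r where "r = 4 * exp (- b * T\<^sup>2 / 4) * sqrt (4 * pi / b)"
  have b: "0 < b" unfolding b_def using a by (simp add: add_pos_pos)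
  have r: "0 \<le> r" unfolding r_def using b by simp
  define N where "N = normal_density 0 (sqrt (1 + S))"
  have N0: "0 \<le> N x" for x unfolding N_def by simp
  have gap: "f0 x - r * N x \<le> f1 x" for x
    unfolding f0_def f1_def r_def N_def b_def S_def \<phi>_def h_def W_def
    using convolution_model_gap[OF a \<epsilon>(1,2) \<delta> \<mu>, of T x] T by simp
  have f0eq: "f0 x = (1 - \<epsilon>) * normal_density 0 (sqrt S) x + \<epsilon> * N x" for x
    unfolding f0_def convolution_model_def \<phi>_def normal_density_product[OF S(1)] N_def using S by simp
  have "integrable lborel (\<lambda>x. f0 x - r * N x)"
    unfolding f0eq N_def using S by (intro Bochner_Integration.integrable_diff Bochner_Integration.integrable_add integrable_mult_right) auto
  moreover have "(\<integral>x. f0 x - r * N x \<partial>lborel) = 1 - r"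
    unfolding f0eq N_def using S by (simp add: Bochner_Integration.integral_diff Bochner_Integration.integral_add)
  ultimately have i: "integrable lborel (\<lambda>x. f0 x - r * N x)" "(\<integral>x. f0 x - r * N x \<partial>lborel) = 1 - r" by auto
  have "ennreal (1 - r) \<le> (\<integral>\<^sup>+x. ennreal (max 0 (f0 x - r * N x)) \<partial>lborel)"
  proof -
    have im: "integrable lborel (\<lambda>x. max 0 (f0 x - r * N x))" using i(1) by (intro integrable_max) auto
    have "1 - r \<le> (\<integral>x. max 0 (f0 x - r * N x) \<partial>lborel)"
      unfolding i(2)[symmetric] by (rule integral_mono[OF i(1) im]) simp
    then have "ennreal (1 - r) \<le> ennreal (\<integral>x. max 0 (f0 x - r * N x) \<partial>lborel)" by (rule ennreal_leI)
    also have "\<dots> = (\<integral>\<^sup>+x. ennreal (max 0 (f0 x - r * N x)) \<partial>lborel)"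
      using im by (intro nn_integral_eq_integral[symmetric]) auto
    finally show ?thesis .
  qed
  also have "\<dots> \<le> (\<integral>\<^sup>+x. min (ennreal (f0 x)) (ennreal (f1 x)) \<partial>lborel)"
  proof (rule nn_integral_mono)
    fix x
    have "f0 x - r * N x \<le> f0 x" using r N0[of x] by simp
    then have "ennreal (f0 x - r * N x) \<le> ennreal (f0 x)" "ennreal (f0 x - r * N x) \<le> ennreal (f1 x)"
      using gap[of x] by (auto intro: ennreal_leI)
    then show "ennreal (max 0 (f0 x - r * N x)) \<le> min (ennreal (f0 x)) (ennreal (f1 x))"
      by (auto simp: max_def ennreal_neg)
  qed
  finally have aff: "ennreal (1 - r) \<le> (\<integral>\<^sup>+x. min (ennreal (f0 x)) (ennreal (f1 x)) \<partial>lborel)" .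
  show ?thesis
    by (rule that[OF F0(1) F1(1)]) (use F0 F1 meas aff S in \<open>auto simp: S_def r_def\<close>)
qed

text \<open>
  Both the variance and the mean are covered: \<open>\<delta>\<close> and \<open>\<mu>\<close> are any nonnegative sequences for which the
  bound in \<open>gap_weight_mass\<close> tends to zero. The cutoff satisfies \<open>T\<^sup>2 = (8 / b) ln n\<close>, so that the
  error \<open>exp (- b T\<^sup>2 / 4)\<close> is exactly \<open>n\<^sup>-\<^sup>2\<close> and the affinity of \<open>n\<close> observations is eventually
  at least one half.
\<close>
lemma eventually_risk_lower_bound:
  fixes \<alpha> \<beta> \<epsilon>0 q a A :: real and \<delta> \<mu> :: "nat \<Rightarrow> real"
  assumes \<beta>: "0 \<le> \<beta>" and \<epsilon>0: "0 < \<epsilon>0" "\<epsilon>0 < 1" and q: "0 < q" and a: "0 < a"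
    and A: "sqrt (a\<^sup>2 + 1) * abs_normal_moment q powr (1 / q) < A"
    and \<delta>: "\<And>n. 0 \<le> \<delta> n" "(\<lambda>n. \<delta> n * sqrt (ln (real n)) ^ 3 / (\<epsilon>0 * real n powr (- \<beta>))) \<longlonglongrightarrow> 0"
    and \<mu>: "\<And>n. 0 \<le> \<mu> n" "(\<lambda>n. \<mu> n * ln (real n) / (\<epsilon>0 * real n powr (- \<beta>))) \<longlonglongrightarrow> 0"
  defines "F \<equiv> param_space \<alpha> \<beta> \<epsilon>0 q a A"
  shows "\<forall>\<^sub>F n in sequentially. ennreal ((\<delta> n)\<^sup>2 / 8) \<le> risk_sigma n (F n) \<and> ennreal ((\<mu> n)\<^sup>2 / 8) \<le> risk_u n (F n)"
proof -
  define b where "b = a\<^sup>2 / (2 * (2 + a\<^sup>2))"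
  have b: "0 < b" unfolding b_def using a by (simp add: add_pos_pos)
  define \<epsilon> where "\<epsilon> = (\<lambda>n. \<epsilon>0 * real n powr (- \<beta>))"
  define T where "T = (\<lambda>n. sqrt (8 / b * ln (real n)))"
  have T2: "(T n)\<^sup>2 = 8 / b * ln (real n)" if "1 \<le> n" for n
    unfolding T_def using that b by (intro real_sqrt_pow2) auto
  have \<epsilon>: "0 < \<epsilon> n" "\<epsilon> n < 1" if "1 \<le> n" for n
  proof -
    show "0 < \<epsilon> n" unfolding \<epsilon>_def using that \<epsilon>0 by simp
    have "real n powr (- \<beta>) \<le> real n powr 0" using that \<beta> by (intro powr_mono) auto
    then have "\<epsilon> n \<le> \<epsilon>0 * 1" unfolding \<epsilon>_def using that \<epsilon>0 by (intro mult_left_mono) auto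
    then show "\<epsilon> n < 1" using \<epsilon>0 by simp
  qed
  have Ttop: "filterlim T at_top sequentially"
  proof -
    have "filterlim (\<lambda>n. 8 / b * ln (real n)) at_top sequentially"
      using b by (intro filterlim_tendsto_pos_mult_at_top[OF tendsto_const]) (auto intro!: filterlim_compose[OF ln_at_top filterlim_real_sequentially])
    then show ?thesis unfolding T_def by (rule filterlim_compose[OF sqrt_at_top])
  qed
  define k1 where "k1 = (\<lambda>n. \<delta> n * T n ^ 3 / \<epsilon> n)"
  define k2 where "k2 = (\<lambda>n. \<mu> n * (T n)\<^sup>2 / \<epsilon> n)"
  have k1: "k1 \<longlonglongrightarrow> 0"
  proof -
    have "k1 = (\<lambda>n. sqrt (8 / b) ^ 3 * (\<delta> n * sqrt (ln (real n)) ^ 3 / (\<epsilon>0 * real n powr (- \<beta>))))"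
      unfolding k1_def T_def \<epsilon>_def real_sqrt_mult power_mult_distrib by (rule ext) simp
    then show ?thesis using tendsto_mult[OF tendsto_const \<delta>(2), of "sqrt (8 / b) ^ 3"] by simp
  qed
  have k2: "k2 \<longlonglongrightarrow> 0"
  proof (rule Lim_transform_eventually)
    show "(\<lambda>n. 8 / b * (\<mu> n * ln (real n) / (\<epsilon>0 * real n powr (- \<beta>)))) \<longlonglongrightarrow> 0"
      using tendsto_mult[OF tendsto_const \<mu>(2), of "8 / b"] by simp
    show "\<forall>\<^sub>F n in sequentially. 8 / b * (\<mu> n * ln (real n) / (\<epsilon>0 * real n powr (- \<beta>))) = k2 n"
      using eventually_ge_at_top[of 1] by eventually_elim (simp add: k2_def T2 \<epsilon>_def)
  qed
  have ev1: "\<forall>\<^sub>F n in sequentially. 1 \<le> n \<and> 1 \<le> T n"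
    using eventually_ge_at_top[of 1] Ttop[unfolded filterlim_at_top] by (auto intro: eventually_conj)
  have \<delta>k: "\<forall>\<^sub>F n in sequentially. \<delta> n * (T n)\<^sup>2 \<le> k1 n \<and> \<delta> n \<le> k1 n \<and> \<mu> n \<le> k2 n"
    using ev1
  proof eventually_elim
    case (elim n)
    then have n: "1 \<le> n" and Tn: "1 \<le> T n" by auto
    have e1: "x \<le> x / \<epsilon> n" if "0 \<le> x" for x
      using \<epsilon>[OF n] that by (simp add: pos_le_divide_eq mult_left_le)
    have "(T n)\<^sup>2 \<le> T n ^ 3" "1 \<le> T n ^ 3" "1 \<le> (T n)\<^sup>2" using Tn by (auto intro: power_increasing one_le_power)
    then have "\<delta> n * (T n)\<^sup>2 \<le> \<delta> n * T n ^ 3" "\<delta> n * 1 \<le> \<delta> n * T n ^ 3" "\<mu> n * 1 \<le> \<mu> n * (T n)\<^sup>2"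
      using \<delta>(1) \<mu>(1) by (intro mult_left_mono; simp)+
    moreover have "\<delta> n * T n ^ 3 \<le> k1 n" "\<mu> n * (T n)\<^sup>2 \<le> k2 n"
      unfolding k1_def k2_def using \<delta>(1) \<mu>(1) Tn by (intro e1; simp)+
    ultimately show ?case by auto
  qed
  have \<delta>0: "\<delta> \<longlonglongrightarrow> 0"
    by (rule tendsto_sandwich[OF _ _ tendsto_const k1]) (use \<delta>(1) \<delta>k in \<open>auto elim: eventually_mono\<close>)
  have \<mu>0: "\<mu> \<longlonglongrightarrow> 0"
    by (rule tendsto_sandwich[OF _ _ tendsto_const k2]) (use \<mu>(1) \<delta>k in \<open>auto elim: eventually_mono\<close>)
  define s where "s = (\<lambda>n. sqrt (1 + \<mu> n) * exp (\<mu> n / (2 * a\<^sup>2)))"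
  have s: "s \<longlonglongrightarrow> 1"
  proof -
    have "s \<longlonglongrightarrow> sqrt (1 + 0) * exp (0 / (2 * a\<^sup>2))" unfolding s_def using a by (intro tendsto_intros \<mu>0) auto
    then show ?thesis by simp
  qed
  \<comment> \<open>the two reasons for exceeding a Gaussian bound: the tilt of \<open>h\<close> and the shift of the null mean\<close>
  define \<kappa> where "\<kappa> = (\<lambda>n. 8 * (k1 n + k2 n) + (s n - 1))"
  have \<kappa>: "\<kappa> \<longlonglongrightarrow> 0"
  proof -
    have "\<kappa> \<longlonglongrightarrow> 8 * (0 + 0) + (1 - 1)" unfolding \<kappa>_def by (intro tendsto_intros k1 k2 s)
    then show ?thesis by simp
  qed
  have k0: "0 \<le> k1 n" "0 \<le> k2 n" "1 \<le> s n" if "1 \<le> n" "1 \<le> T n" for n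
  proof -
    show "0 \<le> k1 n" "0 \<le> k2 n" unfolding k1_def k2_def using \<delta>(1) \<mu>(1) \<epsilon>(1)[OF that(1)] that(2) by simp_all
    have "1 * 1 \<le> s n" unfolding s_def using \<mu>(1)[of n] a by (intro mult_mono) auto
    then show "1 \<le> s n" by simp
  qed
  define M where "M = abs_normal_moment q"
  have M: "0 \<le> M" unfolding M_def by (rule abs_normal_moment_nonneg)
  have "0 \<le> sqrt (a\<^sup>2 + 1) * abs_normal_moment q powr (1 / q)" by simp
  then have A0: "0 < A" using A by (rule order_le_less_trans)
  have mom: "sqrt (1 + (a\<^sup>2 + 0)) powr q * M < A powr q"
  proof -
    have "(sqrt (a\<^sup>2 + 1) * M powr (1 / q)) powr q < A powr q"
      using A q unfolding M_def[symmetric] by (intro powr_less_mono2) auto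
    moreover have "(M powr (1 / q)) powr q = M" using M q by (simp add: powr_powr)
    ultimately show ?thesis using M by (simp add: powr_mult add.commute)
  qed
  have momlim: "(\<lambda>n. (1 + \<kappa> n) * (sqrt (1 + (a\<^sup>2 + \<delta> n)) powr q * M)) \<longlonglongrightarrow> (1 + 0) * (sqrt (1 + (a\<^sup>2 + 0)) powr q * M)"
    using a by (intro tendsto_intros \<kappa> \<delta>0) (auto simp: add_nonneg_eq_0_iff)
  define R where "R = (\<lambda>n. 4 * exp (- b * (T n)\<^sup>2 / 4) * sqrt (4 * pi / b))"
  have R: "R n = 4 * sqrt (4 * pi / b) / (real n)\<^sup>2" if "1 \<le> n" for n
  proof -
    have "exp (- b * (T n)\<^sup>2 / 4) = exp (- (2 * ln (real n)))" unfolding T2[OF that] using b by simp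
    also have "\<dots> = 1 / (real n)\<^sup>2" using that by (simp add: exp_minus exp_double inverse_eq_divide)
    finally show ?thesis unfolding R_def by simp
  qed
  \<comment> \<open>\<open>n\<close> times the one-observation error, the loss allowed by the Bernoulli inequality\<close>
  have nR: "(\<lambda>n. 4 * sqrt (4 * pi / b) / real n) \<longlonglongrightarrow> 0"
    by (rule lim_const_over_n)
  have ev: "\<forall>\<^sub>F n in sequentially. \<kappa> n < 1 \<and> k1 n < 1 \<and> k2 n < 1 \<and> a\<^sup>2 * \<mu> n < 1 \<and>
      (1 + \<kappa> n) * (sqrt (1 + (a\<^sup>2 + \<delta> n)) powr q * M) < A powr q \<and> 4 * sqrt (4 * pi / b) / real n < 1 / 2"
  proof -
    have am: "(\<lambda>n. a\<^sup>2 * \<mu> n) \<longlonglongrightarrow> 0" using tendsto_mult[OF tendsto_const \<mu>0, of "a\<^sup>2"] by simp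
    have "\<forall>\<^sub>F n in sequentially. (1 + \<kappa> n) * (sqrt (1 + (a\<^sup>2 + \<delta> n)) powr q * M) < A powr q"
      using order_tendstoD(2)[OF momlim] mom by simp
    then show ?thesis
      using order_tendstoD(2)[OF \<kappa>, of 1] order_tendstoD(2)[OF k1, of 1] order_tendstoD(2)[OF k2, of 1]
        order_tendstoD(2)[OF am, of 1] order_tendstoD(2)[OF nR, of "1/2"]
      by (auto intro!: eventually_conj)
  qed
  show ?thesis using ev1 \<delta>k ev
  proof eventually_elim
    case (elim n)
    then have n: "1 \<le> n" and Tn: "1 \<le> T n" and kn: "\<kappa> n < 1" "k1 n < 1" "k2 n < 1" "a\<^sup>2 * \<mu> n < 1"
      "(1 + \<kappa> n) * (sqrt (1 + (a\<^sup>2 + \<delta> n)) powr q * M) < A powr q" "4 * sqrt (4 * pi / b) / real n < 1 / 2"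
      and dn: "\<delta> n * (T n)\<^sup>2 \<le> k1 n" "\<delta> n \<le> k1 n" "\<mu> n \<le> k2 n" by auto
    note k0n = k0[OF n Tn]
    have kle: "8 * (\<delta> n * T n ^ 3 + \<mu> n * (T n)\<^sup>2) / \<epsilon> n \<le> \<kappa> n"
    proof -
      have "8 * (\<delta> n * T n ^ 3 + \<mu> n * (T n)\<^sup>2) / \<epsilon> n = 8 * (k1 n + k2 n)"
        unfolding k1_def k2_def by (simp add: add_divide_distrib)
      then show ?thesis unfolding \<kappa>_def using k0n by simp
    qed
    have sle: "sqrt (1 + \<mu> n) * exp (\<mu> n / (2 * a\<^sup>2)) \<le> 1 + \<kappa> n"
      unfolding s_def[THEN fun_cong, symmetric] \<kappa>_def using k0n by simp
    obtain f0 f1 where f: "f0 \<in> F n" "f1 \<in> F n"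
      and par: "null_mean f0 = 0" "(null_sd f0)\<^sup>2 = a\<^sup>2 + \<delta> n" "null_mean f1 = \<mu> n" "(null_sd f1)\<^sup>2 = a\<^sup>2"
      and m: "f0 \<in> borel_measurable borel" "f1 \<in> borel_measurable borel"
      and aff: "ennreal (1 - R n) \<le> (\<integral>\<^sup>+x. min (ennreal (f0 x)) (ennreal (f1 x)) \<partial>lborel)"
    proof -
      have c: "\<epsilon> n \<le> \<epsilon>0 * real n powr (- \<beta>)" "\<delta> n \<le> 1" "\<mu> n \<le> 1" "\<delta> n * (T n)\<^sup>2 \<le> 1" "\<kappa> n \<le> 1" "a\<^sup>2 * \<mu> n \<le> 1"
        "(1 + \<kappa> n) * (sqrt (1 + (a\<^sup>2 + \<delta> n)) powr q * abs_normal_moment q) \<le> A powr q"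
        using kn dn by (simp_all add: \<epsilon>_def M_def)
      show ?thesis
        by (rule indistinguishable_pair[OF a \<epsilon>[OF n] c(1) \<delta>(1) c(2) \<mu>(1) c(3) Tn c(4) kle c(5) sle c(6) c(7) q A0, of \<alpha>];
            rule that; simp only: F_def R_def b_def)
    qed
    have nRn: "real n * R n = 4 * sqrt (4 * pi / b) / real n"
      unfolding R[OF n] using n by (simp add: power2_eq_square)
    have R0: "0 \<le> R n" unfolding R_def using b by simp
    have R1: "R n \<le> 1"
    proof -
      have "1 * R n \<le> real n * R n" using n R0 by (intro mult_right_mono) auto
      then show ?thesis using nRn kn(6) by simp
    qed
    have "1 / 2 \<le> (1 - R n) ^ n"
    proof -
      have "1 + real n * (- R n) \<le> (1 + (- R n)) ^ n" using R1 by (intro Bernoulli_inequality) simp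
      then show ?thesis using nRn kn(6) by simp
    qed
    then have half: "x / 8 \<le> x / 4 * (1 - R n) ^ n" if "0 \<le> x" for x
      using mult_left_mono[of "1 / 2" "(1 - R n) ^ n" "x / 4"] that by simp
    have *: "ennreal ((\<theta> f1 - \<theta> f0)\<^sup>2 / 8) \<le> minimax_risk n (F n) \<theta>" for \<theta>
      using order_trans[OF ennreal_leI[OF half] minimax_risk_two_point[OF f m aff]] R1 by simp
    show ?case
      unfolding risk_sigma_def risk_u_def
      using *[of "\<lambda>f. (null_sd f)\<^sup>2"] *[of null_mean] par by simp
  qed
qed

lemma log_powr_rate:
  fixes p k c :: real
  assumes "0 < c" "k < p"
  shows "(\<lambda>n. (c * real n powr (- \<beta>) * ln (real n) powr (- p)) * ln (real n) powr k / (c * real n powr (- \<beta>))) \<longlonglongrightarrow> 0"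
proof (rule Lim_transform_eventually)
  have "filterlim (\<lambda>n. ln (real n)) at_top sequentially"
    by (rule filterlim_compose[OF ln_at_top filterlim_real_sequentially])
  then show "(\<lambda>n. ln (real n) powr (k - p)) \<longlonglongrightarrow> 0"
    using assms by (intro tendsto_neg_powr) auto
  show "\<forall>\<^sub>F n in sequentially. ln (real n) powr (k - p) =
      (c * real n powr (- \<beta>) * ln (real n) powr (- p)) * ln (real n) powr k / (c * real n powr (- \<beta>))"
    using eventually_gt_at_top[of 1]
  proof eventually_elim
    case (elim n)
    then have "0 < real n powr (- \<beta>)" by simp
    moreover have "ln (real n) powr (k - p) = ln (real n) powr (- p) * ln (real n) powr k"
      unfolding powr_add[symmetric] by simp
    ultimately show ?case using assms by simp
  qed
qed

lemma liminf_scaled_risk: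
  fixes c p :: real and r :: "nat \<Rightarrow> ennreal"
  assumes "0 < c"
    and "\<forall>\<^sub>F n in sequentially. ennreal ((c * real n powr (- \<beta>) * ln (real n) powr (- p / 2))\<^sup>2 / 8) \<le> r n"
  shows "ennreal (c\<^sup>2 / 8) \<le> liminf (\<lambda>n. ennreal (real n powr (2 * \<beta>) * ln (real n) powr p) * r n)"
proof (rule Liminf_bounded)
  show "\<forall>\<^sub>F n in sequentially. ennreal (c\<^sup>2 / 8) \<le> ennreal (real n powr (2 * \<beta>) * ln (real n) powr p) * r n"
    using assms(2) eventually_gt_at_top[of 1]
  proof eventually_elim
    case (elim n)
    define L where "L = ln (real n)"
    have L: "0 < L" unfolding L_def using elim by simp
    have 1: "(real n powr (- \<beta>))\<^sup>2 * real n powr (2 * \<beta>) = 1"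
      unfolding powr_power[of _ _ 2, symmetric] using elim by (simp add: powr_power powr_add[symmetric])
    have 2: "(L powr (- p / 2))\<^sup>2 * L powr p = 1"
      using L by (simp add: powr_power powr_add[symmetric])
    have "(real n powr (2 * \<beta>) * L powr p) * ((c * real n powr (- \<beta>) * L powr (- p / 2))\<^sup>2 / 8)
        = c\<^sup>2 / 8 * ((real n powr (- \<beta>))\<^sup>2 * real n powr (2 * \<beta>)) * ((L powr (- p / 2))\<^sup>2 * L powr p)"
      by (simp add: power_mult_distrib mult_ac)
    then have "ennreal (c\<^sup>2 / 8) = ennreal ((real n powr (2 * \<beta>) * L powr p) * ((c * real n powr (- \<beta>) * L powr (- p / 2))\<^sup>2 / 8))"
      unfolding 1 2 by simp
    also have "\<dots> = ennreal (real n powr (2 * \<beta>) * L powr p) * ennreal ((c * real n powr (- \<beta>) * L powr (- p / 2))\<^sup>2 / 8)"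
      by (rule ennreal_mult) auto
    also have "\<dots> \<le> ennreal (real n powr (2 * \<beta>) * L powr p) * r n"
      using elim unfolding L_def by (intro mult_left_mono) auto
    finally show ?case unfolding L_def .
  qed
qed

theorem theorem2p1:
  fixes \<alpha> \<beta> \<epsilon>0 q a A :: real
  assumes "2 < \<alpha>"
    and "0 \<le> \<beta>" "\<beta> < 1 / 2"
    and "0 < \<epsilon>0" "\<epsilon>0 < 1"
    and "0 < q"
    and "0 < a"
    and "sqrt (a\<^sup>2 + 1) * abs_normal_moment q powr (1 / q) < A"
  shows "\<exists>C>0.
     ennreal C \<le> liminf (\<lambda>n. ennreal (real n powr (2 * \<beta>) * ln (real n) powr (\<alpha> + 2)) *
                       risk_sigma n (param_space \<alpha> \<beta> \<epsilon>0 q a A n)) \<and>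
     ennreal C \<le> liminf (\<lambda>n. ennreal (real n powr (2 * \<beta>) * ln (real n) powr (\<alpha> + 1)) *
                       risk_u n (param_space \<alpha> \<beta> \<epsilon>0 q a A n))"
proof -
  define d where "d = (\<lambda>p n. \<epsilon>0 * real n powr (- \<beta>) * ln (real n) powr (- p / 2))"
  have d0: "0 \<le> d p n" for p n unfolding d_def using assms by simp
  have rate: "(\<lambda>n. d p n * ln (real n) powr k / (\<epsilon>0 * real n powr (- \<beta>))) \<longlonglongrightarrow> 0" if "k < p / 2" for p k
    using log_powr_rate[OF assms(4) that, of \<beta>] unfolding d_def by simp
  have sq3: "sqrt (ln (real n)) ^ 3 = ln (real n) powr (3 / 2)" for n
  proof (cases "n \<le> 1")
    case True
    then have "ln (real n) = 0" by (cases "n = 0") auto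
    then show ?thesis by simp
  next
    case False
    then have "0 < ln (real n)" by simp
    then show ?thesis by (simp add: powr_half_sqrt[symmetric] powr_power)
  qed
  have lnp: "ln (real n) = ln (real n) powr 1" for n
    by (cases "n = 0") auto
  note bound = eventually_risk_lower_bound[OF assms(2,4,5,6,7,8)]
  have \<sigma>: "\<forall>\<^sub>F n in sequentially. ennreal ((d (\<alpha> + 2) n)\<^sup>2 / 8) \<le> risk_sigma n (param_space \<alpha> \<beta> \<epsilon>0 q a A n)"
  proof -
    have "(\<lambda>n. d (\<alpha> + 2) n * sqrt (ln (real n)) ^ 3 / (\<epsilon>0 * real n powr (- \<beta>))) \<longlonglongrightarrow> 0"
      unfolding sq3 using assms(1) by (intro rate) simp
    from bound[OF d0 this, of "\<lambda>_. 0"] show ?thesis by (auto elim: eventually_mono)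
  qed
  have u: "\<forall>\<^sub>F n in sequentially. ennreal ((d (\<alpha> + 1) n)\<^sup>2 / 8) \<le> risk_u n (param_space \<alpha> \<beta> \<epsilon>0 q a A n)"
  proof -
    have "(\<lambda>n. d (\<alpha> + 1) n * ln (real n) powr 1 / (\<epsilon>0 * real n powr (- \<beta>))) \<longlonglongrightarrow> 0"
      using assms(1) by (intro rate) simp
    then have "(\<lambda>n. d (\<alpha> + 1) n * ln (real n) / (\<epsilon>0 * real n powr (- \<beta>))) \<longlonglongrightarrow> 0"
      unfolding lnp[symmetric] .
    from bound[OF _ _ d0 this, of "\<lambda>_. 0"] show ?thesis by (auto elim: eventually_mono)
  qed
  show ?thesis
    using liminf_scaled_risk[OF assms(4) \<sigma>[unfolded d_def]] liminf_scaled_risk[OF assms(4) u[unfolded d_def]] assms(4)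
    by (intro exI[of _ "\<epsilon>0\<^sup>2 / 8"]) auto
qed

end
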